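(* Let $d\ge 2$ and $n\ge1$ be integers, and let $X_1,\dots,X_n$ be independent identically distributed Rademacher random variables, $P(X_i=1)=P(X_i=-1)=\frac12$. Let $Y$ be a centered $d$-dimensional Gaussian vector with covariance matrix $C=(C_{ij})_{d\times d}$. Let $F=(F_1,\dots,F_d)$ be an $\mathbb{R}^d$-valued random vector of Rademacher functionals (each $F_i=F_i(X_1,\dots,X_n)$ is a real-valued function of $X_1,\dots,X_n$) such that $E[F_i]=0$ and $E[F_iF_j]<\infty$ for all $1\le i,j\le d$. For $\alpha\in[0,1]$ and $1\le i,j\le d$ set $$T^{(\alpha)}_{ij}:=\sum_{k=1}^n D_kF_i\big(\alpha E[D_kF_j\mid\mathcal{F}_{k-1}]+(1-\alpha)E[D_kF_j\mid\mathcal{G}_{k+1}]\big).$$ Then, for any $\alpha\in[0,1]$, $$d_3(F,Y)\le \frac d2\Big(\sum_{i,j=1}^d E|C_{ij}-T^{(\alpha)}_{ij}|^2\Big)^{1/2}+\frac{d^2}{3}\sum_{i=1}^d\sum_{k=1}^n E|D_kF_i|^3.$$ Assume in addition that $C$ is positive definite. Then, for any $\alpha\in[0,1]$, $$d_2(F,Y)\le \|C^{-1}\|_{op}\|C\|_{op}^{1/2}\Big(\sum_{i,j=1}^d E|C_{ij}-T^{(\alpha)}_{ij}|^2\Big)^{1/2}+\frac{\sqrt{2\pi}\,\|C^{-1}\|_{op}^{3/2}\|C\|_{op}\,d^2}{4}\sum_{i=1}^d\sum_{k=1}^n E|D_kF_i|^3.$$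
   Context: For $U=U(X_1,\dots,X_n)$, the discrete Malliavin derivative is $D_kU:=\frac{U_k^+-U_k^-}{2}$, $1\le k\le n$, where $U_k^{\pm}=U(X_1,\dots,X_{k-1},\pm1,X_{k+1},\dots,X_n)$. The $\sigma$-fields are $\mathcal{F}_0:=\{\emptyset,\Omega\}$, $\mathcal{F}_k:=\sigma(X_l,l\le k)$, $\mathcal{G}_{n+1}:=\{\emptyset,\Omega\}$, $\mathcal{G}_k:=\sigma(X_l,l\ge k)$ for $1\le k\le n$. Distances: $d_3(F,Y):=\sup|E[g(F)]-E[g(Y)]|$ over $g\in\mathcal{C}^3(\mathbb{R}^d)$ with $\|g^{(k)}\|_\infty\le1$ for $k=1,2,3$, and $d_2(F,Y):=\sup|E[g(F)]-E[g(Y)]|$ over $g\in\mathcal{C}^2(\mathbb{R}^d)$ with $\|g\|_{Lip}\le1$ and $M_2(g)\le1$. Here $\|g^{(k)}\|_\infty:=\max_{1\le i_1\le\dots\le i_k\le d}\sup_{x\in\mathbb{R}^d}\big|\frac{\partial^k g}{\partial x_{i_1}\cdots\partial x_{i_k}}(x)\big|$, $\|g\|_{Lip}:=\sup_{x\ne y}\frac{|g(x)-g(y)|}{\|x-y\|}$, $M_2(g):=\sup_{x\ne y}\frac{\|\nabla g(x)-\nabla g(y)\|}{\|x-y\|}$, with $\|\cdot\|$ the Euclidean norm, and $\|A\|_{op}:=\sup_{\|x\|=1}\|Ax\|$ for a matrix $A$. *)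

theory Defs
  imports "HOL-Probability.Probability"
begin

section \<open>Rademacher functionals\<close>

definition iid_rademacher :: "'a measure \<Rightarrow> nat \<Rightarrow> (nat \<Rightarrow> 'a \<Rightarrow> real) \<Rightarrow> bool" where
  "iid_rademacher M n X \<longleftrightarrow>
     prob_space.indep_vars M (\<lambda>_. borel) X {1..n} \<and>
     (\<forall>k\<in>{1..n}. measure M {\<omega> \<in> space M. X k \<omega> = 1} = 1 / 2 \<and>
                  measure M {\<omega> \<in> space M. X k \<omega> = - 1} = 1 / 2)"

text \<open>A functional is given by a function \<open>U\<close> of \<open>n\<close> real arguments, i.e. of an extensional
  function on \<open>{1..n}\<close>; the values of \<open>X k\<close> for \<open>k \<notin> {1..n}\<close> play no role.\<close>

definition functional ::
    "nat \<Rightarrow> (nat \<Rightarrow> 'a \<Rightarrow> real) \<Rightarrow> ((nat \<Rightarrow> real) \<Rightarrow> real) \<Rightarrow> 'a \<Rightarrow> real" where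
  "functional n X U \<omega> = U (\<lambda>l\<in>{1..n}. X l \<omega>)"

definition malliavin ::
    "nat \<Rightarrow> (nat \<Rightarrow> 'a \<Rightarrow> real) \<Rightarrow> nat \<Rightarrow> ((nat \<Rightarrow> real) \<Rightarrow> real) \<Rightarrow> 'a \<Rightarrow> real" where
  "malliavin n X k U \<omega> =
     (U ((\<lambda>l\<in>{1..n}. X l \<omega>)(k := 1)) - U ((\<lambda>l\<in>{1..n}. X l \<omega>)(k := - 1))) / 2"

text \<open>For \<open>I = {}\<close> the generated \<open>\<sigma>\<close>-field is the trivial one, which covers
  \<open>past_field M X 0\<close> and \<open>future_field M X n (n + 1)\<close>.\<close>

definition generated_field ::
    "'a measure \<Rightarrow> (nat \<Rightarrow> 'a \<Rightarrow> real) \<Rightarrow> nat set \<Rightarrow> 'a measure" where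
  "generated_field M X I =
     sigma (space M) {X l -` A \<inter> space M | l A. l \<in> I \<and> A \<in> sets borel}"

definition past_field :: "'a measure \<Rightarrow> (nat \<Rightarrow> 'a \<Rightarrow> real) \<Rightarrow> nat \<Rightarrow> 'a measure" where
  "past_field M X k = generated_field M X {1..k}"

definition future_field ::
    "'a measure \<Rightarrow> (nat \<Rightarrow> 'a \<Rightarrow> real) \<Rightarrow> nat \<Rightarrow> nat \<Rightarrow> 'a measure" where
  "future_field M X n k = generated_field M X {k..n}"

definition T_alpha ::
    "'a measure \<Rightarrow> nat \<Rightarrow> (nat \<Rightarrow> 'a \<Rightarrow> real) \<Rightarrow> ('d \<Rightarrow> (nat \<Rightarrow> real) \<Rightarrow> real) \<Rightarrow> real
      \<Rightarrow> 'd \<Rightarrow> 'd \<Rightarrow> 'a \<Rightarrow> real" where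
  "T_alpha M n X F \<alpha> i j \<omega> =
     (\<Sum>k=1..n. malliavin n X k (F i) \<omega> *
        (\<alpha> * real_cond_exp M (past_field M X (k - 1)) (malliavin n X k (F j)) \<omega> +
         (1 - \<alpha>) * real_cond_exp M (future_field M X n (k + 1)) (malliavin n X k (F j)) \<omega>))"

section \<open>Gaussian vectors\<close>

text \<open>The Dirac measures are Gaussian (with variance zero), so that a Gaussian vector may have
  a singular covariance matrix.\<close>

definition gaussian_law :: "real measure \<Rightarrow> bool" where
  "gaussian_law \<mu> \<longleftrightarrow>
     (\<exists>m. \<mu> = return borel m) \<or>
     (\<exists>m s. s > 0 \<and> \<mu> = density lborel (\<lambda>x. ennreal (normal_density m s x)))"

definition gaussian_vector :: "'b measure \<Rightarrow> ('b \<Rightarrow> real ^ 'd) \<Rightarrow> bool" where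
  "gaussian_vector N Y \<longleftrightarrow>
     Y \<in> borel_measurable N \<and> (\<forall>u. gaussian_law (distr N borel (\<lambda>\<omega>. u \<bullet> Y \<omega>)))"

definition covariance_matrix :: "'b measure \<Rightarrow> ('b \<Rightarrow> real ^ 'd) \<Rightarrow> real ^ 'd ^ 'd" where
  "covariance_matrix N Y =
     (\<chi> i j. \<integral>\<omega>. (Y \<omega> $ i - (\<integral>\<eta>. Y \<eta> $ i \<partial>N)) * (Y \<omega> $ j - (\<integral>\<eta>. Y \<eta> $ j \<partial>N)) \<partial>N)"

definition centered_gaussian_vector ::
    "'b measure \<Rightarrow> ('b \<Rightarrow> real ^ 'd) \<Rightarrow> real ^ 'd ^ 'd \<Rightarrow> bool" where
  "centered_gaussian_vector N Y C \<longleftrightarrow>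
     gaussian_vector N Y \<and> (\<forall>i. (\<integral>\<omega>. Y \<omega> $ i \<partial>N) = 0) \<and> covariance_matrix N Y = C"

definition positive_definite :: "real ^ 'd ^ 'd \<Rightarrow> bool" where
  "positive_definite A \<longleftrightarrow> transpose A = A \<and> (\<forall>x. x \<noteq> 0 \<longrightarrow> x \<bullet> (A *v x) > 0)"

section \<open>Smooth test functions and the distances\<close>

definition partial_derivative :: "'d \<Rightarrow> (real ^ 'd \<Rightarrow> real) \<Rightarrow> real ^ 'd \<Rightarrow> real" where
  "partial_derivative i g x = frechet_derivative g (at x) (axis i 1)"

primrec C_k :: "nat \<Rightarrow> (real ^ 'd \<Rightarrow> real) \<Rightarrow> bool" where
  "C_k 0 g \<longleftrightarrow> continuous_on UNIV g"
| "C_k (Suc k) g \<longleftrightarrow> g differentiable_on UNIV \<and> (\<forall>i. C_k k (partial_derivative i g))"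

definition gradient :: "(real ^ 'd \<Rightarrow> real) \<Rightarrow> real ^ 'd \<Rightarrow> real ^ 'd" where
  "gradient g x = (\<chi> i. partial_derivative i g x)"

text \<open>All suprema are taken in the extended reals, since a supremum of an unbounded set of reals
  is unspecified.\<close>

definition deriv_sup_norm :: "nat \<Rightarrow> (real ^ 'd::{finite,linorder} \<Rightarrow> real) \<Rightarrow> ereal" where
  "deriv_sup_norm k g =
     (SUP is \<in> {is. length is = k \<and> sorted is}. SUP x. ereal \<bar>foldr partial_derivative is g x\<bar>)"

definition lip_norm :: "(real ^ 'd \<Rightarrow> real) \<Rightarrow> ereal" where
  "lip_norm g = (SUP (x, y) \<in> {(x, y). x \<noteq> y}. ereal (\<bar>g x - g y\<bar> / norm (x - y)))"

definition M2 :: "(real ^ 'd \<Rightarrow> real) \<Rightarrow> ereal" where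
  "M2 g = (SUP (x, y) \<in> {(x, y). x \<noteq> y}.
             ereal (norm (gradient g x - gradient g y) / norm (x - y)))"

text \<open>The two vectors may live on different probability spaces: only their laws matter.\<close>

definition test_distance ::
    "(real ^ 'd \<Rightarrow> real) set \<Rightarrow> 'a measure \<Rightarrow> ('a \<Rightarrow> real ^ 'd) \<Rightarrow>
      'b measure \<Rightarrow> ('b \<Rightarrow> real ^ 'd) \<Rightarrow> ereal" where
  "test_distance \<G> M F N Y =
     (SUP g\<in>\<G>. ereal \<bar>(\<integral>\<omega>. g (F \<omega>) \<partial>M) - (\<integral>\<omega>. g (Y \<omega>) \<partial>N)\<bar>)"

definition d3 ::
    "'a measure \<Rightarrow> ('a \<Rightarrow> real ^ 'd::{finite,linorder}) \<Rightarrow>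
      'b measure \<Rightarrow> ('b \<Rightarrow> real ^ 'd::{finite,linorder}) \<Rightarrow> ereal" where
  "d3 = test_distance {g. C_k 3 g \<and> (\<forall>k\<in>{1,2,3}. deriv_sup_norm k g \<le> 1)}"

definition d2 ::
    "'a measure \<Rightarrow> ('a \<Rightarrow> real ^ 'd) \<Rightarrow> 'b measure \<Rightarrow> ('b \<Rightarrow> real ^ 'd) \<Rightarrow> ereal" where
  "d2 = test_distance {g. C_k 2 g \<and> lip_norm g \<le> 1 \<and> M2 g \<le> 1}"

end

theory Submission
  imports Defs
begin

text \<open>Stein's method by direct interpolation. Writing \<open>W t = sin t F + cos t Y\<close> with \<open>F\<close> and \<open>Y\<close>
  independent, \<open>E g(F) - E g(Y)\<close> is the integral over \<open>0 < t < \<pi>/2\<close> of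
  \<open>E \<langle>cos t F - sin t Y, \<nabla>g(W t)\<rangle>\<close>. Gaussian integration by parts turns the \<open>Y\<close>-part into
  \<open>- sin t cos t E \<langle>C, D\<^sup>2 g(W t)\<rangle>\<close>; the discrete Clark formula turns the \<open>F\<close>-part into
  \<open>sin t cos t E \<langle>T, D\<^sup>2 g(W t)\<rangle>\<close> up to a remainder of third order in \<open>D\<^sub>k F\<close>, controlled by the Lipschitz
  constant of the second derivatives. For \<open>d\<^sub>3\<close> these are Lipschitz by assumption. For \<open>d\<^sub>2\<close> one derivative
  is moved onto the Gaussian density, once for the size and once for the Lipschitz constant of the
  averaged second derivatives, at the cost of a factor \<open>1 / cos t\<close>, which stays integrable.\<close>

section \<open>Discrete calculus on the cube\<close>

text \<open>Two obstacles shape the argument. For \<open>d3\<close> the matrix \<open>C\<close> may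
  be singular, so \<open>Y\<close> need not have a density and is known only through its
  one-dimensional projections. Gaussian integration by parts is therefore done in one direction at a
  time, by exchanging \<open>w \<bullet> Y\<close> for a fresh standard normal variable;
  characteristic functions of vectors justify the exchange, and directions of variance zero are
  treated apart. Test functions for \<open>d2\<close> have only two derivatives, so there a shift of
  the argument is absorbed by the Gaussian part, at a price governed by the first absolute moment
  \<open>sqrt (2 / pi)\<close> of the standard normal law.

  The constants are integrals over 0 < t < pi/2. For \<open>d3\<close>, sin t cos t and sin^2 t cos
  t give 1/2 and 1/3; the factor d is the Cauchy-Schwarz loss over d^2 matrix entries, and d^2 in
  the remainder counts free indices in a triple sum. For \<open>d2\<close>, sin t and sin^2 t give 1
  and pi/4, and sqrt(2/pi) * pi/4 = sqrt(2 pi)/4. The \<open>d2\<close> argument produces the square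
  root of the operator norm of the inverse of \<open>C\<close> in both terms; the norms of
  \<open>C\<close> and of its inverse have product at least 1, which leads to the stated
  constants.\<close>

definition cube :: "nat \<Rightarrow> (nat \<Rightarrow> real) set" where
  "cube n = PiE {1..n} (\<lambda>_. {- 1, 1})"

definition cube_mean :: "nat \<Rightarrow> ((nat \<Rightarrow> real) \<Rightarrow> real) \<Rightarrow> real" where
  "cube_mean n U = (\<Sum>x\<in>cube n. U x) / 2 ^ n"

definition coord_diff :: "nat \<Rightarrow> ((nat \<Rightarrow> real) \<Rightarrow> real) \<Rightarrow> (nat \<Rightarrow> real) \<Rightarrow> real" where
  "coord_diff k U x = (U (x(k := 1)) - U (x(k := - 1))) / 2"

definition coord_mean :: "nat \<Rightarrow> ((nat \<Rightarrow> real) \<Rightarrow> real) \<Rightarrow> (nat \<Rightarrow> real) \<Rightarrow> real" where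
  "coord_mean k U x = (U (x(k := 1)) + U (x(k := - 1))) / 2"

text \<open>On the cube this is the conditional expectation given the coordinates outside
  \<open>S\<close>. The fold lets proofs average one coordinate at a time and in any order, since
  coordinate averages commute.\<close>

definition partial_mean :: "nat set \<Rightarrow> ((nat \<Rightarrow> real) \<Rightarrow> real) \<Rightarrow> (nat \<Rightarrow> real) \<Rightarrow> real" where
  "partial_mean S U = Finite_Set.fold coord_mean U S"

lemma finite_cube: "finite (cube n)"
  by (auto simp: cube_def intro!: finite_PiE)

lemma card_cube: "card (cube n) = 2 ^ n"
  by (simp add: cube_def card_PiE numeral_2_eq_2)

lemma cube_coord: "x \<in> cube n \<Longrightarrow> k \<in> {1..n} \<Longrightarrow> x k = 1 \<or> x k = - 1"
  by (auto simp: cube_def PiE_iff)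

lemma cube_upd: "x \<in> cube n \<Longrightarrow> k \<in> {1..n} \<Longrightarrow> a = 1 \<or> a = - 1 \<Longrightarrow> x(k := a) \<in> cube n"
  by (auto simp: cube_def PiE_iff extensional_def)

lemma coord_mean_commute: "coord_mean k (coord_mean l U) = coord_mean l (coord_mean k U)"
proof (cases "k = l")
  case False
  then have "x(l := a, k := b) = x(k := b, l := a)" for x :: "nat \<Rightarrow> real" and a b
    by (simp add: fun_upd_twist)
  then show ?thesis by (intro ext) (simp add: coord_mean_def add_divide_distrib del: fun_upd_apply)
qed simp

interpretation coord_mean: comp_fun_commute coord_mean
  by standard (auto simp: fun_eq_iff coord_mean_commute)

lemma partial_mean_empty [simp]: "partial_mean {} U = U"
  by (simp add: partial_mean_def)

lemma partial_mean_insert: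
  "finite S \<Longrightarrow> k \<notin> S \<Longrightarrow> partial_mean (insert k S) U = coord_mean k (partial_mean S U)"
  by (simp add: partial_mean_def)

lemma partial_mean_insert2:
  "finite S \<Longrightarrow> k \<notin> S \<Longrightarrow> partial_mean (insert k S) U = partial_mean S (coord_mean k U)"
  by (simp add: partial_mean_def coord_mean.fold_fun_left_comm)

lemma coord_diff_mean_commute:
  "k \<noteq> l \<Longrightarrow> coord_diff k (coord_mean l U) = coord_mean l (coord_diff k U)"
  by (auto simp: coord_mean_def coord_diff_def fun_eq_iff fun_upd_twist field_simps)

lemma coord_diff_partial_mean:
  "finite S \<Longrightarrow> k \<notin> S \<Longrightarrow> coord_diff k (partial_mean S U) = partial_mean S (coord_diff k U)"
  by (induction S rule: finite_induct) (auto simp: partial_mean_insert coord_diff_mean_commute)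

lemma coord_mean_coord_diff [simp]: "coord_mean k (coord_diff k U) = coord_diff k U"
  by (simp add: coord_mean_def coord_diff_def fun_eq_iff)

lemma partial_mean_upd: "finite S \<Longrightarrow> k \<in> S \<Longrightarrow> partial_mean S U (x(k := a)) = partial_mean S U x"
proof -
  assume S: "finite S" "k \<in> S"
  \<comment> \<open>With \<open>k\<close> as the outermost average, the coordinate is overwritten by
    1 and -1, so its old value is lost.\<close>
  have "partial_mean (insert k (S - {k})) U (x(k := a)) = partial_mean (insert k (S - {k})) U x"
    using S by (subst (1 2) partial_mean_insert) (auto simp: coord_mean_def)
  then show ?thesis using S by (simp add: insert_absorb)
qed

lemma partial_mean_upd_notin:
  assumes "finite S" "\<And>x. U (x(k := a)) = U x"
  shows "partial_mean S U (x(k := a)) = partial_mean S U x"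
proof (cases "k \<in> S")
  case True then show ?thesis using assms by (simp add: partial_mean_upd)
next
  case False
  show ?thesis using assms(1) False
  proof (induction S arbitrary: x rule: finite_induct)
    case (insert l S)
    then have "x(k := a, l := b) = x(l := b, k := a)" for b
      by (intro fun_upd_twist) auto
    then show ?case using insert by (simp add: partial_mean_insert coord_mean_def del: fun_upd_apply)
  qed (use assms in auto)
qed

text \<open>The measurability half of a conditional expectation. The points \<open>x\<close> and
  \<open>y\<close> are joined by overwriting the coordinates in \<open>S\<close> one at a time, none
  of which changes the average.\<close>

lemma partial_mean_agree:
  assumes "finite S" "\<And>l. l \<notin> S \<Longrightarrow> x l = y l"
  shows "partial_mean S U x = partial_mean S U y"
proof -
  have "partial_mean S U (override_on x z R) = partial_mean S U x" if "R \<subseteq> S" for R z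
  proof -
    have "finite R" using that assms(1) finite_subset by auto
    then show ?thesis using that
    proof (induction R rule: finite_induct)
      case (insert r R)
      have "override_on x z (insert r R) = (override_on x z R)(r := z r)"
        by (auto simp: override_on_def)
      then have "partial_mean S U (override_on x z (insert r R)) = partial_mean S U (override_on x z R)"
        using insert.prems assms(1) by (simp only:) (simp add: partial_mean_upd del: fun_upd_apply)
      then show ?case using insert by simp
    qed simp
  qed
  from this[of S y] have "partial_mean S U (override_on x y S) = partial_mean S U x" by simp
  moreover have "override_on x y S = y" using assms(2) by (auto simp: override_on_def)
  ultimately show ?thesis by simp
qed

text \<open>Flipping the sign of coordinate \<open>k\<close> permutes the cube, and on the cube the
  coordinate average is the mean of the values at a point and at its flip.\<close>

lemma cube_mean_coord_mean:
  assumes k: "k \<in> {1..n}"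
  shows "cube_mean n (coord_mean k U) = cube_mean n U"
proof -
  let ?f = "\<lambda>x::nat\<Rightarrow>real. x(k := - x k)"
  have "bij_betw ?f (cube n) (cube n)"
    by (rule bij_betw_byWitness[where f' = ?f]) (use k in \<open>auto dest: cube_coord intro!: cube_upd\<close>)
  then have "(\<Sum>x\<in>cube n. U (?f x)) = (\<Sum>x\<in>cube n. U x)" by (rule sum.reindex_bij_betw)
  moreover have "(\<Sum>x\<in>cube n. coord_mean k U x) = (\<Sum>x\<in>cube n. (U x + U (?f x)) / 2)"
  proof (rule sum.cong)
    fix x assume "x \<in> cube n"
    then show "coord_mean k U x = (U x + U (?f x)) / 2"
      using cube_coord[OF _ k, of x] by (auto simp: coord_mean_def fun_upd_idem)
  qed simp
  ultimately show ?thesis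
    by (simp add: cube_mean_def sum.distrib flip: sum_divide_distrib)
qed

lemma cube_mean_partial_mean:
  assumes "finite S" "S \<subseteq> {1..n}" shows "cube_mean n (partial_mean S U) = cube_mean n U"
  using assms by (induction S rule: finite_induct) (auto simp: partial_mean_insert cube_mean_coord_mean)

lemma cube_mean_cong: "(\<And>x. x \<in> cube n \<Longrightarrow> U x = V x) \<Longrightarrow> cube_mean n U = cube_mean n V"
  by (simp add: cube_mean_def)

lemma cube_mean_add: "cube_mean n (\<lambda>x. U x + V x) = cube_mean n U + cube_mean n V"
  by (simp add: cube_mean_def sum.distrib add_divide_distrib)

lemma cube_mean_diff: "cube_mean n (\<lambda>x. U x - V x) = cube_mean n U - cube_mean n V"
  by (simp add: cube_mean_def sum_subtractf diff_divide_distrib)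

lemma cube_mean_cmult: "cube_mean n (\<lambda>x. c * U x) = c * cube_mean n U"
  by (simp add: cube_mean_def sum_distrib_left)

lemma cube_mean_sum: "cube_mean n (\<lambda>x. \<Sum>i\<in>I. U i x) = (\<Sum>i\<in>I. cube_mean n (U i))"
  unfolding cube_mean_def by (subst sum.swap) (simp add: sum_divide_distrib)

lemma cube_mean_const [simp]: "cube_mean n (\<lambda>x. c) = c"
  by (simp add: cube_mean_def card_cube)

lemma cube_mean_mono: "(\<And>x. x \<in> cube n \<Longrightarrow> U x \<le> V x) \<Longrightarrow> cube_mean n U \<le> cube_mean n V"
  by (auto simp: cube_mean_def intro!: divide_right_mono sum_mono)

lemma cube_mean_nonneg: "(\<And>x. x \<in> cube n \<Longrightarrow> 0 \<le> U x) \<Longrightarrow> 0 \<le> cube_mean n U"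
  by (auto simp: cube_mean_def intro!: divide_nonneg_nonneg sum_nonneg)

lemma cube_mean_abs: "\<bar>cube_mean n U\<bar> \<le> cube_mean n (\<lambda>x. \<bar>U x\<bar>)"
  by (auto simp: cube_mean_def intro!: divide_right_mono)

text \<open>Points of the cube agree outside \<open>{1..n}\<close>, being extensional, so the full
  average is constant on the cube and equals its own mean.\<close>

lemma partial_mean_full:
  assumes "x \<in> cube n" shows "partial_mean {1..n} U x = cube_mean n U"
proof -
  have "cube_mean n U = cube_mean n (partial_mean {1..n} U)" by (simp add: cube_mean_partial_mean)
  also have "\<dots> = cube_mean n (\<lambda>_. partial_mean {1..n} U x)"
    by (intro cube_mean_cong partial_mean_agree)
       (use assms in \<open>auto simp: cube_def PiE_def extensional_def\<close>)
  finally show ?thesis by simp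
qed

text \<open>A function of a single sign is affine in it: the mean is the constant term and the half
  difference is the slope.\<close>

lemma coord_mean_decomp:
  assumes "x \<in> cube n" "k \<in> {1..n}"
  shows "U x - coord_mean k U x = x k * coord_diff k U x"
  using cube_coord[OF assms]
proof
  assume k: "x k = 1"
  then have "x(k := 1) = x" by (simp add: fun_upd_idem)
  then show ?thesis using k by (simp add: coord_mean_def coord_diff_def field_simps)
next
  assume k: "x k = - 1"
  then have "x(k := - 1) = x" by (simp add: fun_upd_idem)
  then show ?thesis using k by (simp add: coord_mean_def coord_diff_def field_simps)
qed

text \<open>Integration by parts in one sign: averaging \<open>x k * U x\<close> over the two values
  of \<open>x k\<close> leaves the half difference of \<open>U\<close>, while \<open>Z\<close> acts
  as a constant.\<close>

lemma cube_mean_coord_mult: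
  assumes "k \<in> {1..n}" "\<And>x a. Z (x(k := a)) = Z x"
  shows "cube_mean n (\<lambda>x. U x * (x k * Z x)) = cube_mean n (\<lambda>x. coord_diff k U x * Z x)"
proof -
  have "coord_mean k (\<lambda>x. U x * (x k * Z x)) x = coord_diff k U x * Z x" for x
    unfolding coord_mean_def coord_diff_def assms(2) by (simp add: field_simps)
  then have "coord_mean k (\<lambda>x. U x * (x k * Z x)) = (\<lambda>x. coord_diff k U x * Z x)" by (rule ext)
  then show ?thesis
    using cube_mean_coord_mean[OF assms(1), of "\<lambda>x. U x * (x k * Z x)"] by simp
qed

lemma coord_diff_upd [simp]: "coord_diff k U (x(k := a)) = coord_diff k U x"
  by (simp add: coord_diff_def)

text \<open>The martingale increment obtained by averaging out one more coordinate is
  \<open>x k\<close> times an average of \<open>coord_diff k V\<close>. That average does not see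
  coordinate \<open>k\<close>, so the one-sign integration by parts applies.\<close>

lemma cube_mean_ibp_step:
  assumes "k \<in> {1..n}" "finite S" "k \<notin> S"
  shows "cube_mean n (\<lambda>x. U x * (partial_mean S V x - partial_mean (insert k S) V x)) =
         cube_mean n (\<lambda>x. coord_diff k U x * partial_mean S (coord_diff k V) x)"
proof -
  have "cube_mean n (\<lambda>x. U x * (partial_mean S V x - partial_mean (insert k S) V x)) =
        cube_mean n (\<lambda>x. U x * (x k * partial_mean S (coord_diff k V) x))"
    using assms by (intro cube_mean_cong)
      (simp add: partial_mean_insert coord_mean_decomp flip: coord_diff_partial_mean)
  also have "\<dots> = cube_mean n (\<lambda>x. coord_diff k U x * partial_mean S (coord_diff k V) x)"
    using assms by (intro cube_mean_coord_mult partial_mean_upd_notin) auto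
  finally show ?thesis .
qed

text \<open>The discrete Clark formula: telescoping the martingale \<open>E[V | \<F>\<^sub>k]\<close>, whose increments are
  \<open>X\<^sub>k E[D\<^sub>k V | \<F>\<^sub>k\<^sub>-\<^sub>1]\<close>.\<close>

lemma cube_mean_ibp_past:
  assumes "cube_mean n V = 0"
  shows "cube_mean n (\<lambda>x. U x * V x) =
    (\<Sum>k=1..n. cube_mean n (\<lambda>x. coord_diff k U x * partial_mean {k+1..n} (coord_diff k V) x))"
proof -
  have "(\<Sum>k=1..n. cube_mean n (\<lambda>x. coord_diff k U x * partial_mean {k+1..n} (coord_diff k V) x)) =
    (\<Sum>k=1..n. cube_mean n (\<lambda>x. U x * (partial_mean {k+1..n} V x - partial_mean {k..n} V x)))"
  proof (rule sum.cong)
    fix k assume "k \<in> {1..n}"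
    then have "{k..n} = insert k {k+1..n}" by auto
    then show "cube_mean n (\<lambda>x. coord_diff k U x * partial_mean {k+1..n} (coord_diff k V) x) =
        cube_mean n (\<lambda>x. U x * (partial_mean {k+1..n} V x - partial_mean {k..n} V x))"
      using \<open>k \<in> {1..n}\<close> by (simp add: cube_mean_ibp_step)
  qed simp
  also have "\<dots> = cube_mean n (\<lambda>x. U x * (\<Sum>k=1..n. partial_mean {Suc k..n} V x - partial_mean {k..n} V x))"
    by (simp add: cube_mean_sum sum_distrib_left)
  also have "\<dots> = cube_mean n (\<lambda>x. U x * V x)"
  proof (rule cube_mean_cong)
    fix x assume "x \<in> cube n"
    have "(\<Sum>k=1..n. partial_mean {Suc k..n} V x - partial_mean {k..n} V x) =
        partial_mean {Suc n..n} V x - partial_mean {1..n} V x"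
      by (rule sum_Suc_diff) simp
    then show "U x * (\<Sum>k=1..n. partial_mean {Suc k..n} V x - partial_mean {k..n} V x) = U x * V x"
      using partial_mean_full[OF \<open>x \<in> cube n\<close>, of V] assms by simp
  qed
  finally show ?thesis by simp
qed

text \<open>Telescoping in the reversed order of coordinates: averaging over \<open>{1..<k}\<close>
  conditions on the coordinates from \<open>k\<close> on, which gives the martingale along the
  fields \<open>\<G>\<close>.\<close>

lemma cube_mean_ibp_future:
  assumes "cube_mean n V = 0"
  shows "cube_mean n (\<lambda>x. U x * V x) =
    (\<Sum>k=1..n. cube_mean n (\<lambda>x. coord_diff k U x * partial_mean {1..<k} (coord_diff k V) x))"
proof -
  have "(\<Sum>k=1..n. cube_mean n (\<lambda>x. coord_diff k U x * partial_mean {1..<k} (coord_diff k V) x)) =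
    (\<Sum>k=1..n. cube_mean n (\<lambda>x. U x * (partial_mean {1..<k} V x - partial_mean {1..<Suc k} V x)))"
  proof (rule sum.cong)
    fix k assume "k \<in> {1..n}"
    then have "{1..<Suc k} = insert k {1..<k}" by auto
    then show "cube_mean n (\<lambda>x. coord_diff k U x * partial_mean {1..<k} (coord_diff k V) x) =
        cube_mean n (\<lambda>x. U x * (partial_mean {1..<k} V x - partial_mean {1..<Suc k} V x))"
      using \<open>k \<in> {1..n}\<close> by (simp add: cube_mean_ibp_step)
  qed simp
  also have "\<dots> = cube_mean n (\<lambda>x. U x * (\<Sum>k=1..n. partial_mean {1..<k} V x - partial_mean {1..<Suc k} V x))"
    by (simp add: cube_mean_sum sum_distrib_left)
  also have "\<dots> = cube_mean n (\<lambda>x. U x * V x)"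
  proof (rule cube_mean_cong)
    fix x assume "x \<in> cube n"
    \<comment> \<open>Minus signs turn the decreasing differences into the increasing ones that
      \<open>sum_Suc_diff\<close> telescopes.\<close>
    have "(\<Sum>k=1..n. - partial_mean {1..<Suc k} V x - - partial_mean {1..<k} V x) =
        - partial_mean {1..<Suc n} V x - - partial_mean {1..<1} V x"
      by (rule sum_Suc_diff) simp
    moreover have "{1..<Suc n} = {1..n}" by auto
    ultimately show "U x * (\<Sum>k=1..n. partial_mean {1..<k} V x - partial_mean {1..<Suc k} V x) = U x * V x"
      using partial_mean_full[OF \<open>x \<in> cube n\<close>, of V] assms by simp
  qed
  finally show ?thesis by simp
qed

section \<open>Third moment inequalities\<close>

lemma abs_cube_convex:
  fixes a b t :: real
  assumes "0 \<le> t" "t \<le> 1"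
  shows "\<bar>t * a + (1 - t) * b\<bar> ^ 3 \<le> t * \<bar>a\<bar> ^ 3 + (1 - t) * \<bar>b\<bar> ^ 3"
proof -
  have "\<bar>t * a + (1 - t) * b\<bar> ^ 3 \<le> (t * \<bar>a\<bar> + (1 - t) * \<bar>b\<bar>) ^ 3"
    using assms by (intro power_mono) (auto simp: abs_mult intro!: order_trans[OF abs_triangle_ineq])
  also have "\<dots> \<le> t * \<bar>a\<bar> ^ 3 + (1 - t) * \<bar>b\<bar> ^ 3"
    using convex_onD[OF convex_power_odd[of 3], of "1 - t" "\<bar>a\<bar>" "\<bar>b\<bar>"] assms by simp
  finally show ?thesis .
qed

text \<open>Conditional Jensen inequality for the absolute third power, one coordinate at a time
  with weights 1/2.\<close>

lemma partial_mean_abs_cube: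
  assumes "finite S"
  shows "\<bar>partial_mean S U x\<bar> ^ 3 \<le> partial_mean S (\<lambda>x. \<bar>U x\<bar> ^ 3) x"
  using assms
proof (induction S arbitrary: x rule: finite_induct)
  case (insert k S)
  have "\<bar>coord_mean k (partial_mean S U) x\<bar> ^ 3 \<le>
      (\<bar>partial_mean S U (x(k := 1))\<bar> ^ 3 + \<bar>partial_mean S U (x(k := - 1))\<bar> ^ 3) / 2"
    using abs_cube_convex[of "1/2" "partial_mean S U (x(k := 1))" "partial_mean S U (x(k := - 1))"]
    by (simp add: coord_mean_def add_divide_distrib)
  also have "\<dots> \<le> coord_mean k (partial_mean S (\<lambda>x. \<bar>U x\<bar> ^ 3)) x"
    unfolding coord_mean_def by (intro divide_right_mono add_mono insert) auto
  finally show ?case using insert by (simp add: partial_mean_insert)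
qed simp

lemma young3:
  fixes a b c :: real
  assumes "0 \<le> a" "0 \<le> b" "0 \<le> c"
  shows "a * b * c \<le> (a ^ 3 + b ^ 3 + c ^ 3) / 3"
proof -
  \<comment> \<open>The right side is twice a^3 + b^3 + c^3 - 3abc, in its classical
    factorization.\<close>
  have "0 \<le> (a + b + c) * ((a - b)\<^sup>2 + (b - c)\<^sup>2 + (c - a)\<^sup>2)" using assms by simp
  then show ?thesis by (simp add: power2_eq_square power3_eq_cube algebra_simps)
qed

text \<open>The product of sums expands into terms a b b with three indices, each bounded by a third
  of the sum of the cubes. A cube depends on one index only, so the other two contribute the factor
  d^2.\<close>

lemma cube_mean_triple_le:
  fixes a b c :: "'d::finite \<Rightarrow> (nat \<Rightarrow> real) \<Rightarrow> real"
  assumes "\<And>i. cube_mean n (\<lambda>x. \<bar>a i x\<bar> ^ 3) \<le> m i"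
    and "\<And>i. cube_mean n (\<lambda>x. \<bar>b i x\<bar> ^ 3) \<le> m i"
  shows "cube_mean n (\<lambda>x. (\<Sum>i\<in>UNIV. \<bar>a i x\<bar>) * (\<Sum>j\<in>UNIV. \<bar>b j x\<bar>)\<^sup>2) \<le> (real CARD('d))\<^sup>2 * (\<Sum>i\<in>UNIV. m i)"
proof -
  let ?d = "real CARD('d)"
  have 1: "(\<Sum>i\<in>UNIV. \<bar>a i x\<bar>) * (\<Sum>j\<in>UNIV. \<bar>b j x\<bar>)\<^sup>2 \<le>
      (\<Sum>i\<in>UNIV. \<Sum>j\<in>UNIV. \<Sum>l\<in>UNIV. (\<bar>a i x\<bar> ^ 3 + \<bar>b j x\<bar> ^ 3 + \<bar>b l x\<bar> ^ 3) / 3)" for x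
  proof -
    have "(\<Sum>i\<in>UNIV. \<bar>a i x\<bar>) * (\<Sum>j\<in>UNIV. \<bar>b j x\<bar>)\<^sup>2 =
       (\<Sum>i\<in>UNIV. \<Sum>j\<in>UNIV. \<Sum>l\<in>UNIV. \<bar>a i x\<bar> * \<bar>b j x\<bar> * \<bar>b l x\<bar>)"
      by (simp only: power2_eq_square sum_product sum_distrib_right) (simp only: sum_distrib_left mult.assoc)
    also have "\<dots> \<le> (\<Sum>i\<in>UNIV. \<Sum>j\<in>UNIV. \<Sum>l\<in>UNIV. (\<bar>a i x\<bar> ^ 3 + \<bar>b j x\<bar> ^ 3 + \<bar>b l x\<bar> ^ 3) / 3)"
      by (intro sum_mono young3) auto
    finally show ?thesis .
  qed
  have "cube_mean n (\<lambda>x. (\<Sum>i\<in>UNIV. \<bar>a i x\<bar>) * (\<Sum>j\<in>UNIV. \<bar>b j x\<bar>)\<^sup>2) \<le>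
     cube_mean n (\<lambda>x. \<Sum>i\<in>UNIV. \<Sum>j\<in>UNIV. \<Sum>l\<in>UNIV. (1/3) * (\<bar>a i x\<bar> ^ 3 + \<bar>b j x\<bar> ^ 3 + \<bar>b l x\<bar> ^ 3))"
    using 1 by (intro cube_mean_mono) simp
  also have "\<dots> = (\<Sum>i\<in>UNIV. \<Sum>j\<in>UNIV. \<Sum>l\<in>UNIV. (1/3) * (cube_mean n (\<lambda>x. \<bar>a i x\<bar> ^ 3) +
       cube_mean n (\<lambda>x. \<bar>b j x\<bar> ^ 3) + cube_mean n (\<lambda>x. \<bar>b l x\<bar> ^ 3)))"
    by (simp only: cube_mean_sum cube_mean_cmult cube_mean_add)
  also have "\<dots> \<le> (\<Sum>i\<in>UNIV. \<Sum>j\<in>UNIV. \<Sum>l\<in>(UNIV::'d set). (1/3) * (m i + m j + m l))"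
    by (intro sum_mono mult_left_mono add_mono assms) auto
  also have "\<dots> = ?d\<^sup>2 * (\<Sum>i\<in>UNIV. m i)"
    by (simp add: sum.distrib power2_eq_square field_simps
             flip: sum_divide_distrib sum_distrib_left sum_distrib_right)
  finally show ?thesis .
qed

section \<open>Rademacher functionals as functions on the cube\<close>

locale rademacher = prob_space +
  fixes n :: nat and X :: "nat \<Rightarrow> 'a \<Rightarrow> real"
  assumes iid: "iid_rademacher M n X" and n_pos: "n \<ge> 1"
begin

definition signs :: "'a \<Rightarrow> nat \<Rightarrow> real" where "signs \<omega> = (\<lambda>l\<in>{1..n}. X l \<omega>)"

lemma X_measurable [measurable]: "k \<in> {1..n} \<Longrightarrow> X k \<in> borel_measurable M"
  using iid by (auto simp: iid_rademacher_def indep_vars_def)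

lemma signs_measurable [measurable]: "signs \<in> measurable M (Pi\<^sub>M {1..n} (\<lambda>_. borel))"
  unfolding signs_def by (rule measurable_restrict) simp

lemma prob_X:
  assumes "k \<in> {1..n}" "a = 1 \<or> a = -1"
  shows "prob (X k -` {a} \<inter> space M) = 1 / 2"
proof -
  have "X k -` {a} \<inter> space M = {\<omega> \<in> space M. X k \<omega> = a}" by auto
  then show ?thesis using iid assms by (auto simp: iid_rademacher_def)
qed

lemma prob_signs:
  assumes "x \<in> cube n"
  shows "prob {\<omega> \<in> space M. signs \<omega> = x} = 1 / 2 ^ n"
proof -
  have "{\<omega> \<in> space M. signs \<omega> = x} = (\<Inter>i\<in>{1..n}. X i -` {x i} \<inter> space M)"
    using assms n_pos by (auto simp: signs_def cube_def PiE_def extensional_def fun_eq_iff restrict_def)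
  also have "prob \<dots> = (\<Prod>i\<in>{1..n}. prob (X i -` {x i} \<inter> space M))"
    using iid n_pos by (intro indep_varsD_finite[where M' = "\<lambda>_. borel"]) (auto simp: iid_rademacher_def)
  also have "\<dots> = (\<Prod>i\<in>{1..n}. 1 / 2)"
    using assms by (intro prod.cong prob_X) (auto dest: cube_coord)
  finally show ?thesis by (simp add: power_one_over)
qed

text \<open>\<open>measure\<close> is zero on nonmeasurable sets, so the positive value found above
  certifies measurability.\<close>

lemma sets_signs [measurable]: "x \<in> cube n \<Longrightarrow> {\<omega> \<in> space M. signs \<omega> = x} \<in> sets M"
  using prob_signs[of x] measure_notin_sets[of "{\<omega> \<in> space M. signs \<omega> = x}" M] by fastforce

lemma AE_signs_cube: "AE \<omega> in M. signs \<omega> \<in> cube n"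
proof -
  have "prob (\<Union>x\<in>cube n. {\<omega> \<in> space M. signs \<omega> = x}) = (\<Sum>x\<in>cube n. prob {\<omega> \<in> space M. signs \<omega> = x})"
    by (rule finite_measure_finite_Union) (auto simp: finite_cube disjoint_family_on_def)
  also have "\<dots> = 1" by (simp add: prob_signs card_cube)
  finally have "prob (\<Union>x\<in>cube n. {\<omega> \<in> space M. signs \<omega> = x}) = 1" .
  then have "AE \<omega> in M. \<omega> \<in> (\<Union>x\<in>cube n. {\<omega> \<in> space M. signs \<omega> = x})"
    by (subst prob_eq_1[symmetric]) (auto intro: finite_cube sets.finite_UN)
  then show ?thesis by eventually_elim auto
qed

text \<open>The bridge from \<open>M\<close> to finite sums: almost surely \<open>f\<close> is a
  combination of indicators of the \<open>2 ^ n\<close> sign patterns. The hypothesis on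
  \<open>f\<close> is an almost sure equality because conditional expectations will be inserted for
  it.\<close>

lemma has_bochner_integral_signs:
  assumes [measurable]: "f \<in> borel_measurable M" and f: "AE \<omega> in M. f \<omega> = U (signs \<omega>)"
  shows "has_bochner_integral M f (cube_mean n U)"
proof -
  have "has_bochner_integral M (\<lambda>\<omega>. \<Sum>x\<in>cube n. indicator {\<omega> \<in> space M. signs \<omega> = x} \<omega> * U x) 
      (\<Sum>x\<in>cube n. prob {\<omega> \<in> space M. signs \<omega> = x} * U x)"
    by (intro has_bochner_integral_sum has_bochner_integral_mult_left has_bochner_integral_real_indicator)
       (auto simp: emeasure_eq_measure)
  also have "(\<Sum>x\<in>cube n. prob {\<omega> \<in> space M. signs \<omega> = x} * U x) = cube_mean n U"
    by (simp add: cube_mean_def prob_signs sum_divide_distrib)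
  finally show ?thesis
  proof (rule has_bochner_integral_cong_AE[THEN iffD1, rotated -1])
    show "AE \<omega> in M. (\<Sum>x\<in>cube n. indicator {\<omega> \<in> space M. signs \<omega> = x} \<omega> * U x) = f \<omega>"
      using f AE_signs_cube AE_space
    proof eventually_elim
      case (elim \<omega>)
      have "(\<Sum>x\<in>cube n. indicator {\<omega> \<in> space M. signs \<omega> = x} \<omega> * U x) =
          (\<Sum>x\<in>cube n. if signs \<omega> = x then U x else 0)"
        using elim by (intro sum.cong) (auto simp: indicator_def)
      then show ?case using elim by (simp add: sum.delta' finite_cube)
    qed
  qed auto
qed

lemmas integral_signs = has_bochner_integral_signs[THEN has_bochner_integral_integral_eq]
lemmas integrable_signs = has_bochner_integral_signs[THEN integrable.intros]

section \<open>Generated fields and conditional expectations as coordinate averages\<close>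

lemma space_generated_field [simp]: "space (generated_field M X I) = space M"
  by (simp add: generated_field_def space_measure_of_conv)

lemma sets_generated_field:
  "sets (generated_field M X I) = sigma_sets (space M) {X l -` A \<inter> space M | l A. l \<in> I \<and> A \<in> sets borel}"
  unfolding generated_field_def by (rule sets_measure_of) auto

lemma subalgebra_generated_field:
  assumes "I \<subseteq> {1..n}" shows "subalgebra M (generated_field M X I)"
  unfolding subalgebra_def sets_generated_field
  using assms by (auto intro!: sets.sigma_sets_subset)

lemma X_measurable_generated_field: "l \<in> I \<Longrightarrow> X l \<in> borel_measurable (generated_field M X I)"
  by (rule measurableI) (auto simp: sets_generated_field)

text \<open>Induction over the generated field. What matters is that \<open>B\<close> depends on the
  coordinates in \<open>I\<close> only: its indicator can then be taken out of an average over the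
  other coordinates.\<close>

lemma generated_field_vimage:
  assumes "A \<in> sets (generated_field M X I)" "I \<subseteq> {1..n}"
  shows "\<exists>B. A = {\<omega> \<in> space M. signs \<omega> \<in> B} \<and> (\<forall>x y. (\<forall>l\<in>I. x l = y l) \<longrightarrow> x \<in> B \<longleftrightarrow> y \<in> B)"
proof -
  have "A \<in> sigma_sets (space M) {X l -` A \<inter> space M | l A. l \<in> I \<and> A \<in> sets borel}"
    using assms(1) by (simp add: sets_generated_field)
  then show ?thesis
  proof induction
    case (Basic A)
    then obtain l A' where "l \<in> I" "A = X l -` A' \<inter> space M" by auto
    then show ?case using assms(2) by (intro exI[of _ "{x. x l \<in> A'}"]) (auto simp: signs_def)
  next
    case Empty
    then show ?case by (intro exI[of _ "{}"]) auto
  next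
    case (Compl A)
    then obtain B where B: "A = {\<omega> \<in> space M. signs \<omega> \<in> B}" "\<forall>x y. (\<forall>l\<in>I. x l = y l) \<longrightarrow> x \<in> B \<longleftrightarrow> y \<in> B"
      by auto
    then have "space M - A = {\<omega> \<in> space M. signs \<omega> \<in> - B}" by auto
    moreover have "\<forall>x y. (\<forall>l\<in>I. x l = y l) \<longrightarrow> x \<in> - B \<longleftrightarrow> y \<in> - B" using B(2) by auto
    ultimately show ?case by blast
  next
    case (Union A)
    then have "\<forall>i. \<exists>B. A i = {\<omega> \<in> space M. signs \<omega> \<in> B} \<and> (\<forall>x y. (\<forall>l\<in>I. x l = y l) \<longrightarrow> x \<in> B \<longleftrightarrow> y \<in> B)"
      by simp
    from choice[OF this] obtain B where B: "\<And>i. A i = {\<omega> \<in> space M. signs \<omega> \<in> B i}"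
        "\<And>i. \<forall>x y. (\<forall>l\<in>I. x l = y l) \<longrightarrow> x \<in> B i \<longleftrightarrow> y \<in> B i"
      by auto
    have "(\<Union>i. A i) = {\<omega> \<in> space M. signs \<omega> \<in> (\<Union>i. B i)}" using B(1) by auto
    moreover have "\<forall>x y. (\<forall>l\<in>I. x l = y l) \<longrightarrow> x \<in> (\<Union>i. B i) \<longleftrightarrow> y \<in> (\<Union>i. B i)"
    proof (intro allI impI)
      fix x y :: "nat \<Rightarrow> real" assume "\<forall>l\<in>I. x l = y l"
      then have "x \<in> B i \<longleftrightarrow> y \<in> B i" for i using B(2)[of i] by simp
      then show "x \<in> (\<Union>i. B i) \<longleftrightarrow> y \<in> (\<Union>i. B i)" by simp
    qed
    ultimately show ?case by blast
  qed
qed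

lemma measurable_fun_upd_PiM:
  assumes "U \<in> borel_measurable (Pi\<^sub>M {1..n} (\<lambda>_. borel :: real measure))" "k \<in> {1..n}"
  shows "(\<lambda>x. U (x(k := a))) \<in> borel_measurable (Pi\<^sub>M {1..n} (\<lambda>_. borel :: real measure))"
proof (rule measurable_compose[OF _ assms(1)])
  show "(\<lambda>x. x(k := a)) \<in> measurable (Pi\<^sub>M {1..n} (\<lambda>_. borel :: real measure)) (Pi\<^sub>M {1..n} (\<lambda>_. borel))"
    by (rule measurable_fun_upd[where J = "{1..n}"]) (use assms(2) in auto)
qed

lemma coord_diff_measurable:
  assumes "U \<in> borel_measurable (Pi\<^sub>M {1..n} (\<lambda>_. borel))" "k \<in> {1..n}"
  shows "coord_diff k U \<in> borel_measurable (Pi\<^sub>M {1..n} (\<lambda>_. borel))"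
  using measurable_fun_upd_PiM[OF assms] unfolding coord_diff_def by simp

lemma partial_mean_measurable:
  assumes U: "U \<in> borel_measurable (Pi\<^sub>M {1..n} (\<lambda>_. borel))" and "finite S" "S \<subseteq> {1..n}"
  shows "partial_mean S U \<in> borel_measurable (Pi\<^sub>M {1..n} (\<lambda>_. borel))"
  using assms(2,3)
proof (induction S rule: finite_induct)
  case (insert k S)
  then have "partial_mean S U \<in> borel_measurable (Pi\<^sub>M {1..n} (\<lambda>_. borel))" "k \<in> {1..n}" by auto
  from measurable_fun_upd_PiM[OF this] show ?case using insert
    by (simp add: partial_mean_insert coord_mean_def[abs_def])
qed (use U in simp)

text \<open>Checks the characterization of conditional expectation: on events of the field the
  integrals agree because averaging preserves \<open>cube_mean\<close>, once the indicator has been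
  pulled out of the average.\<close>

lemma real_cond_exp_generated_field:
  assumes U: "U \<in> borel_measurable (Pi\<^sub>M {1..n} (\<lambda>_. borel))" and S: "S \<subseteq> {1..n}"
  shows "AE \<omega> in M. real_cond_exp M (generated_field M X ({1..n} - S)) (\<lambda>\<omega>. U (signs \<omega>)) \<omega> =
    partial_mean S U (signs \<omega>)"
proof -
  let ?I = "{1..n} - S"
  let ?G = "generated_field M X ?I"
  have fin: "finite S" using S finite_subset by auto
  interpret G: finite_measure_subalgebra M ?G
    by standard (auto intro: subalgebra_generated_field)
  note PM = partial_mean_measurable[OF U fin S]
  have [measurable]: "(\<lambda>\<omega>. U (signs \<omega>)) \<in> borel_measurable M" "(\<lambda>\<omega>. partial_mean S U (signs \<omega>)) \<in> borel_measurable M"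
    by (auto intro: measurable_compose[OF signs_measurable] U PM)
  show ?thesis
  proof (rule G.real_cond_exp_charact)
    fix A assume A: "A \<in> sets ?G"
    obtain B where B: "A = {\<omega> \<in> space M. signs \<omega> \<in> B}" "\<forall>x y. (\<forall>l\<in>?I. x l = y l) \<longrightarrow> x \<in> B \<longleftrightarrow> y \<in> B"
      using generated_field_vimage[OF A Diff_subset] by (elim exE conjE)
    have [measurable]: "A \<in> sets M" using A G.subalg by (auto simp: subalgebra_def)
    \<comment> \<open>Overwriting coordinates in \<open>S\<close> does not affect membership in
      \<open>B\<close>, so the indicator passes through the averages like a scalar.\<close>
    have pull: "partial_mean R (\<lambda>x. indicator B x * U x) x = indicator B x * partial_mean R U x"
      if "finite R" "R \<subseteq> S" for R x
      using that
    proof (induction R arbitrary: x rule: finite_induct)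
      case (insert k R)
      have "x(k := a) \<in> B \<longleftrightarrow> x \<in> B" for a by (rule B(2)[rule_format]) (use insert.prems in auto)
      then have "indicator B (x(k := a)) = (indicator B x :: real)" for a by (simp add: indicator_def)
      then show ?case using insert by (simp add: partial_mean_insert coord_mean_def algebra_simps del: fun_upd_apply)
    qed simp
    have ind: "AE \<omega> in M. indicator A \<omega> *\<^sub>R V (signs \<omega>) = indicator B (signs \<omega>) * V (signs \<omega>)" for V :: "_ \<Rightarrow> real"
      by (rule AE_I2) (simp add: B(1) indicator_def)
    have "(\<integral>\<omega>\<in>A. U (signs \<omega>) \<partial>M) = cube_mean n (\<lambda>x. indicator B x * U x)"
      unfolding set_lebesgue_integral_def
      by (rule integral_signs[OF _ ind]) measurable
    also have "\<dots> = cube_mean n (\<lambda>x. indicator B x * partial_mean S U x)"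
      by (subst cube_mean_partial_mean[OF fin S, symmetric]) (intro cube_mean_cong, simp add: pull fin)
    also have "\<dots> = (\<integral>\<omega>\<in>A. partial_mean S U (signs \<omega>) \<partial>M)"
      unfolding set_lebesgue_integral_def
      by (rule integral_signs[OF _ ind, symmetric]) measurable
    finally show "(\<integral>\<omega>\<in>A. U (signs \<omega>) \<partial>M) = (\<integral>\<omega>\<in>A. partial_mean S U (signs \<omega>) \<partial>M)" .
  next
    show "integrable M (\<lambda>\<omega>. U (signs \<omega>))" "integrable M (\<lambda>\<omega>. partial_mean S U (signs \<omega>))"
      by (auto intro!: integrable_signs)
    \<comment> \<open>The default 1 fills the averaged coordinates. This leaves the value unchanged
      and makes it a function of the remaining coordinates alone, hence measurable for the smaller
      field.\<close>
    have "(\<lambda>\<omega>. \<lambda>l\<in>{1..n}. if l \<in> S then 1 else X l \<omega>) \<in> measurable ?G (Pi\<^sub>M {1..n} (\<lambda>_. borel))"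
    proof (rule measurable_restrict)
      show "(\<lambda>\<omega>. if l \<in> S then 1 else X l \<omega>) \<in> borel_measurable ?G" if "l \<in> {1..n}" for l
        using that X_measurable_generated_field[of l ?I] by (cases "l \<in> S") auto
    qed
    then have "(\<lambda>\<omega>. partial_mean S U (\<lambda>l\<in>{1..n}. if l \<in> S then 1 else X l \<omega>)) \<in> borel_measurable ?G"
      by (rule measurable_compose[OF _ PM])
    moreover have "partial_mean S U (\<lambda>l\<in>{1..n}. if l \<in> S then 1 else X l \<omega>) = partial_mean S U (signs \<omega>)" for \<omega>
      by (rule partial_mean_agree[OF fin]) (auto simp: signs_def)
    ultimately show "(\<lambda>\<omega>. partial_mean S U (signs \<omega>)) \<in> borel_measurable ?G" by simp
  qed
qed

lemma functional_eq: "functional n X U \<omega> = U (signs \<omega>)"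
  by (simp add: functional_def signs_def)

lemma malliavin_eq: "malliavin n X k U \<omega> = coord_diff k U (signs \<omega>)"
  by (simp add: malliavin_def signs_def coord_diff_def)

text \<open>By \<open>real_cond_exp_generated_field\<close> the two averages are \<open>E[D\<^sub>k U | \<F>\<^sub>k\<^sub>-\<^sub>1]\<close> and
  \<open>E[D\<^sub>k U | \<G>\<^sub>k\<^sub>+\<^sub>1]\<close>; the coordinate \<open>k\<close> itself need not be averaged, as \<open>D\<^sub>k U\<close> does not depend on it.\<close>

definition clark_weight :: "real \<Rightarrow> nat \<Rightarrow> ((nat \<Rightarrow> real) \<Rightarrow> real) \<Rightarrow> (nat \<Rightarrow> real) \<Rightarrow> real" where
  "clark_weight \<alpha> k U x = \<alpha> * partial_mean {k+1..n} (coord_diff k U) x + (1 - \<alpha>) * partial_mean {1..<k} (coord_diff k U) x"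

lemma T_alpha_eq:
  assumes F: "\<And>i. F i \<in> borel_measurable (Pi\<^sub>M {1..n} (\<lambda>_. borel))"
  shows "AE \<omega> in M. T_alpha M n X F \<alpha> i j \<omega> = (\<Sum>k=1..n. coord_diff k (F i) (signs \<omega>) * clark_weight \<alpha> k (F j) (signs \<omega>))"
proof -
  have "AE \<omega> in M. \<forall>k\<in>{1..n}.
      real_cond_exp M (past_field M X (k - 1)) (malliavin n X k (F j)) \<omega> =
        partial_mean {k+1..n} (coord_diff k (F j)) (signs \<omega>) \<and>
      real_cond_exp M (future_field M X n (k + 1)) (malliavin n X k (F j)) \<omega> =
        partial_mean {1..<k} (coord_diff k (F j)) (signs \<omega>)"
  proof (intro AE_ball_countable[THEN iffD2] ballI AE_conjI)
    fix k assume k: "k \<in> {1..n}"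
    have m: "coord_diff k (F j) \<in> borel_measurable (Pi\<^sub>M {1..n} (\<lambda>_. borel))"
      using k by (intro coord_diff_measurable F)
    have M: "malliavin n X k (F j) = (\<lambda>\<omega>. coord_diff k (F j) (signs \<omega>))" by (simp add: fun_eq_iff malliavin_eq)
    \<comment> \<open>Both fields omit coordinate \<open>k\<close> itself, so the averaged sets are
      \<open>{k..n}\<close> and \<open>{1..k}\<close>; the extra average over \<open>k\<close> is
      then removed by \<open>partial_mean_insert2\<close>.\<close>
    have 1: "{1..n} - insert k {k+1..n} = {1..k - 1}" "{1..n} - insert k {1..<k} = {k+1..n}" using k by auto
    show "AE \<omega> in M. real_cond_exp M (past_field M X (k - 1)) (malliavin n X k (F j)) \<omega> =
        partial_mean {k+1..n} (coord_diff k (F j)) (signs \<omega>)"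
      using real_cond_exp_generated_field[OF m, of "insert k {k+1..n}"] k
      unfolding M past_field_def 1 by (simp add: partial_mean_insert2)
    show "AE \<omega> in M. real_cond_exp M (future_field M X n (k + 1)) (malliavin n X k (F j)) \<omega> =
        partial_mean {1..<k} (coord_diff k (F j)) (signs \<omega>)"
      using real_cond_exp_generated_field[OF m, of "insert k {1..<k}"] k
      unfolding M future_field_def 1 by (auto simp: partial_mean_insert2 subset_iff)
  qed auto
  then show ?thesis
    by eventually_elim (simp add: T_alpha_def clark_weight_def malliavin_eq)
qed

text \<open>Both Clark formulas represent the same mean, hence so does their combination with
  weights \<open>\<alpha>\<close> and \<open>1 - \<alpha>\<close>.\<close>

lemma cube_mean_ibp:
  assumes "cube_mean n V = 0"
  shows "cube_mean n (\<lambda>x. V x * U x) = (\<Sum>k=1..n. cube_mean n (\<lambda>x. coord_diff k U x * clark_weight \<alpha> k V x))"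
proof -
  have "cube_mean n (\<lambda>x. V x * U x) = \<alpha> * cube_mean n (\<lambda>x. U x * V x) + (1 - \<alpha>) * cube_mean n (\<lambda>x. U x * V x)"
    by (simp add: algebra_simps)
  also have "\<dots> = (\<Sum>k=1..n. cube_mean n (\<lambda>x. coord_diff k U x * clark_weight \<alpha> k V x))"
    by (subst cube_mean_ibp_past[OF assms], subst cube_mean_ibp_future[OF assms])
       (simp add: sum_distrib_left clark_weight_def algebra_simps
             flip: sum.distrib cube_mean_cmult cube_mean_add)
  finally show ?thesis .
qed

text \<open>Convexity in \<open>\<alpha>\<close>, then conditional Jensen, then invariance of the
  mean under averaging. This is where \<open>\<alpha>\<close> has to lie between 0 and 1.\<close>

lemma cube_mean_clark_weight_le:
  assumes "\<alpha> \<in> {0..1}" "k \<in> {1..n}"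
  shows "cube_mean n (\<lambda>x. \<bar>clark_weight \<alpha> k U x\<bar> ^ 3) \<le> cube_mean n (\<lambda>x. \<bar>coord_diff k U x\<bar> ^ 3)"
proof -
  let ?D = "coord_diff k U"
  let ?P = "partial_mean {k+1..n}" and ?Q = "partial_mean {1..<k}"
  have "cube_mean n (\<lambda>x. \<bar>clark_weight \<alpha> k U x\<bar> ^ 3) \<le>
      cube_mean n (\<lambda>x. \<alpha> * ?P (\<lambda>x. \<bar>?D x\<bar> ^ 3) x + (1 - \<alpha>) * ?Q (\<lambda>x. \<bar>?D x\<bar> ^ 3) x)"
  proof (rule cube_mean_mono)
    fix x
    have "\<bar>clark_weight \<alpha> k U x\<bar> ^ 3 \<le> \<alpha> * \<bar>?P ?D x\<bar> ^ 3 + (1 - \<alpha>) * \<bar>?Q ?D x\<bar> ^ 3"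
      unfolding clark_weight_def by (rule abs_cube_convex) (use assms in auto)
    also have "\<dots> \<le> \<alpha> * ?P (\<lambda>x. \<bar>?D x\<bar> ^ 3) x + (1 - \<alpha>) * ?Q (\<lambda>x. \<bar>?D x\<bar> ^ 3) x"
      using assms by (intro add_mono mult_left_mono partial_mean_abs_cube) auto
    finally show "\<bar>clark_weight \<alpha> k U x\<bar> ^ 3 \<le> \<alpha> * ?P (\<lambda>x. \<bar>?D x\<bar> ^ 3) x + (1 - \<alpha>) * ?Q (\<lambda>x. \<bar>?D x\<bar> ^ 3) x" .
  qed
  also have "\<dots> = \<alpha> * cube_mean n (?P (\<lambda>x. \<bar>?D x\<bar> ^ 3)) + (1 - \<alpha>) * cube_mean n (?Q (\<lambda>x. \<bar>?D x\<bar> ^ 3))"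
    by (simp only: cube_mean_add cube_mean_cmult)
  also have "cube_mean n (?P (\<lambda>x. \<bar>?D x\<bar> ^ 3)) = cube_mean n (\<lambda>x. \<bar>?D x\<bar> ^ 3)"
    by (rule cube_mean_partial_mean) auto
  also have "cube_mean n (?Q (\<lambda>x. \<bar>?D x\<bar> ^ 3)) = cube_mean n (\<lambda>x. \<bar>?D x\<bar> ^ 3)"
    by (rule cube_mean_partial_mean) (use assms in auto)
  finally show ?thesis by (simp add: algebra_simps)
qed

end

section \<open>Uniqueness of characteristic functions of random vectors\<close>

text \<open>Dividing the weight by its mass \<open>m\<close> gives a probability measure, to which
  one-dimensional uniqueness can be applied; the conclusions translate its characteristic function
  and its probabilities back into weighted integrals.\<close>

lemma char_weighted_distr:
  fixes w X :: "'a \<Rightarrow> real"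
  assumes [measurable]: "w \<in> borel_measurable M" "X \<in> borel_measurable M"
    and w: "\<And>x. 0 \<le> w x" "integrable M w" "(\<integral>x. w x \<partial>M) = m" "m > 0"
  shows "real_distribution (distr (density M (\<lambda>x. ennreal (w x / m))) borel X)"
    and "char (distr (density M (\<lambda>x. ennreal (w x / m))) borel X) s =
       Complex ((\<integral>x. w x * cos (s * X x) \<partial>M) / m) ((\<integral>x. w x * sin (s * X x) \<partial>M) / m)"
    and "A \<in> sets borel \<Longrightarrow> measure (distr (density M (\<lambda>x. ennreal (w x / m))) borel X) A =
       (\<integral>x. w x * indicator A (X x) \<partial>M) / m"
proof -
  let ?D = "density M (\<lambda>x. ennreal (w x / m))"
  have pD: "prob_space ?D"
  proof
    have "emeasure ?D (space ?D) = (\<integral>\<^sup>+x. ennreal (w x / m) \<partial>M)"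
      by (simp add: emeasure_density cong: nn_integral_cong)
    also have "\<dots> = ennreal (\<integral>x. w x / m \<partial>M)"
      using w by (intro nn_integral_eq_integral) auto
    finally show "emeasure ?D (space ?D) = 1" using w by simp
  qed
  interpret D: prob_space ?D by (rule pD)
  show "real_distribution (distr ?D borel X)" by simp
  have sD: "integrable ?D f \<Longrightarrow> (\<integral>x. f x \<partial>?D) = (\<integral>x. w x * f x \<partial>M) / m" for f :: "'a \<Rightarrow> real"
    by (subst integral_density) (use w in \<open>auto dest!: borel_measurable_integrable\<close>)
  have ie: "integrable ?D (\<lambda>x. iexp (s * X x))" by (rule D.integrable_iexp) auto
  have "char (distr ?D borel X) s = (CLINT x|?D. iexp (s * X x))"
    by (simp add: char_def integral_distr)
  also have "\<dots> = Complex (\<integral>x. cos (s * X x) \<partial>?D) (\<integral>x. sin (s * X x) \<partial>?D)"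
    using integral_Re[OF ie] integral_Im[OF ie] by (intro complex_eqI) (auto simp: Re_exp Im_exp)
  also have "(\<integral>x. cos (s * X x) \<partial>?D) = (\<integral>x. w x * cos (s * X x) \<partial>M) / m"
    by (intro sD D.integrable_const_bound[where B = 1]) auto
  also have "(\<integral>x. sin (s * X x) \<partial>?D) = (\<integral>x. w x * sin (s * X x) \<partial>M) / m"
    by (intro sD D.integrable_const_bound[where B = 1]) auto
  finally show "char (distr ?D borel X) s =
       Complex ((\<integral>x. w x * cos (s * X x) \<partial>M) / m) ((\<integral>x. w x * sin (s * X x) \<partial>M) / m)" .
  assume A[measurable]: "A \<in> sets borel"
  have "measure (distr ?D borel X) A = (\<integral>x. indicator A x \<partial>distr ?D borel X)"
    by (simp add: measure_def)
  also have "\<dots> = (\<integral>x. indicator A (X x) \<partial>?D)"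
    by (rule integral_distr) auto
  also have "\<dots> = (\<integral>x. w x * indicator A (X x) \<partial>M) / m"
    by (intro sD D.integrable_const_bound[where B = 1]) (auto simp: indicator_def)
  finally show "measure (distr ?D borel X) A = (\<integral>x. w x * indicator A (X x) \<partial>M) / m" .
qed

text \<open>A free phase \<open>c\<close> in the cosine encodes the real and imaginary parts of the
  characteristic function together, so that a single real hypothesis can be carried through the
  induction over coordinates.\<close>

lemma weighted_Levy_uniqueness:
  fixes w X :: "'a \<Rightarrow> real"
  assumes sets: "sets M = sets N"
    and [measurable]: "w \<in> borel_measurable M" "X \<in> borel_measurable M" "A \<in> sets borel"
    and w: "\<And>x. 0 \<le> w x" "integrable M w" "integrable N w"
    and cos: "\<And>s c. (\<integral>x. w x * cos (s * X x + c) \<partial>M) = (\<integral>x. w x * cos (s * X x + c) \<partial>N)"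
  shows "(\<integral>x. w x * indicator A (X x) \<partial>M) = (\<integral>x. w x * indicator A (X x) \<partial>N)"
proof -
  have [measurable]: "w \<in> borel_measurable N" "X \<in> borel_measurable N"
    using assms(2,3) by (simp_all add: measurable_cong_sets[OF sets refl])
  define m where "m = (\<integral>x. w x \<partial>M)"
  have mN: "(\<integral>x. w x \<partial>N) = m" using cos[of 0 0] by (simp add: m_def)
  have "m \<ge> 0" unfolding m_def using w by simp
  have sin: "(\<integral>x. w x * sin (s * X x) \<partial>M) = (\<integral>x. w x * sin (s * X x) \<partial>N)" for s
    using cos[of s "- pi / 2"] by (simp add: cos_diff)
  show ?thesis
  proof (cases "m = 0")
    \<comment> \<open>A weight of mass zero cannot be normalized, but it vanishes almost everywhere
      under both measures.\<close>
    case True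
    have "(\<integral>x. w x * indicator A (X x) \<partial>K) = 0"
      if "integrable K w" "(\<integral>x. w x \<partial>K) = 0" for K
    proof -
      have "AE x in K. w x = 0" using that w(1) by (simp add: integral_nonneg_eq_0_iff_AE)
      then show ?thesis by (intro integral_eq_zero_AE) (auto elim: eventually_mono)
    qed
    then show ?thesis using w mN True by (simp add: m_def)
  next
    case False
    with \<open>m \<ge> 0\<close> have "m > 0" by simp
    note M = char_weighted_distr[OF _ _ w(1,2) m_def[symmetric] \<open>m > 0\<close>, of X]
    note N = char_weighted_distr[OF _ _ w(1,3) mN \<open>m > 0\<close>, of X]
    have "distr (density M (\<lambda>x. ennreal (w x / m))) borel X = distr (density N (\<lambda>x. ennreal (w x / m))) borel X"
    proof (rule Levy_uniqueness)
      show "char (distr (density M (\<lambda>x. ennreal (w x / m))) borel X) =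
          char (distr (density N (\<lambda>x. ennreal (w x / m))) borel X)"
        by (rule ext, subst M(2), simp, simp, subst N(2), simp, simp)
           (use cos[of _ 0] sin in simp)
    qed (use M(1) N(1) in auto)
    then have "(\<integral>x. w x * indicator A (X x) \<partial>M) / m = (\<integral>x. w x * indicator A (X x) \<partial>N) / m"
      using M(3) N(3) by (metis (no_types, lifting) assms(2-4) \<open>w \<in> borel_measurable N\<close> \<open>X \<in> borel_measurable N\<close>)
    then show ?thesis using \<open>m > 0\<close> by simp
  qed
qed

text \<open>The coordinates are passed from characters to indicators one at a time, by applying the
  one-dimensional uniqueness theorem under the nonnegative weight \<open>p x * (1 + cos (u \<bullet> x + b))\<close>.\<close>

lemma char_vector_coordinatewise:
  fixes M N :: "(real ^ 'd) measure"
  assumes M: "prob_space M" "sets M = sets borel" and N: "prob_space N" "sets N = sets borel"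
    and cos: "\<And>u. (\<integral>x. cos (u \<bullet> x) \<partial>M) = (\<integral>x. cos (u \<bullet> x) \<partial>N)"
    and sin: "\<And>u. (\<integral>x. sin (u \<bullet> x) \<partial>M) = (\<integral>x. sin (u \<bullet> x) \<partial>N)"
    and J: "finite J" and A: "\<And>j. A j \<in> sets (borel :: real measure)"
  shows "(\<integral>x. (\<Prod>j\<in>J. indicator (A j) (x $ j)) * cos (u \<bullet> x + b) \<partial>M) =
         (\<integral>x. (\<Prod>j\<in>J. indicator (A j) (x $ j)) * cos (u \<bullet> x + b) \<partial>N)"
  using J
proof (induction J arbitrary: u b rule: finite_induct)
  case empty
  have "(\<integral>x. cos (u \<bullet> x + b) \<partial>K) = cos b * (\<integral>x. cos (u \<bullet> x) \<partial>K) - sin b * (\<integral>x. sin (u \<bullet> x) \<partial>K)"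
    if K: "prob_space K" "sets K = sets borel" for K
  proof -
    interpret prob_space K by fact
    note K(2)[measurable_cong]
    have "integrable K (\<lambda>x. cos (u \<bullet> x))" "integrable K (\<lambda>x. sin (u \<bullet> x))"
      by (auto intro!: integrable_const_bound[where B = 1])
    then show ?thesis by (simp add: cos_add algebra_simps)
  qed
  then show ?case using assms(1-6) by simp
next
  case (insert k J)
  define p where "p x = (\<Prod>j\<in>J. indicator (A j) (x $ j) :: real)" for x :: "real ^ 'd"
  note M(2)[measurable_cong] N(2)[measurable_cong] A[measurable]
  have [measurable]: "(\<lambda>x. x $ j) \<in> borel_measurable borel" for j :: 'd
    by (intro borel_measurable_continuous_onI continuous_intros)
  have p[measurable]: "p \<in> borel_measurable borel" unfolding p_def by measurable
  have p01: "0 \<le> p x" "p x \<le> 1" for x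
    unfolding p_def by (auto intro!: prod_nonneg prod_le_1)
  have int: "integrable K (\<lambda>x. p x * f x)"
    if K: "K = M \<or> K = N" and f[measurable]: "f \<in> borel_measurable borel" and "\<And>x. \<bar>f x\<bar> \<le> B" for f B K
  proof -
    interpret prob_space K using K M N by auto
    have "B \<ge> 0" using that(3)[of 0] by linarith
    have "\<bar>p x * f x\<bar> \<le> B" for x
      using mult_mono[of "\<bar>p x\<bar>" 1 "\<bar>f x\<bar>" B] p01[of x] that(3)[of x] by (simp add: abs_mult)
    then show ?thesis using K
      by (intro integrable_const_bound[where B = B]) auto
  qed
  have IH: "(\<integral>x. p x * cos (u \<bullet> x + b) \<partial>M) = (\<integral>x. p x * cos (u \<bullet> x + b) \<partial>N)" for u b
    unfolding p_def using insert.IH .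
  \<comment> \<open>A cosine is signed and cannot be a weight. It is the difference of the
    nonnegative weights for \<open>t = 1\<close> and \<open>t = 0\<close>, and both cases are
    combined at the end.\<close>
  have step: "(\<integral>x. p x * (1 + t * cos (u \<bullet> x + b)) * indicator (A k) (x $ k) \<partial>M) =
        (\<integral>x. p x * (1 + t * cos (u \<bullet> x + b)) * indicator (A k) (x $ k) \<partial>N)" if t: "t = 0 \<or> t = 1" for t
  proof (rule weighted_Levy_uniqueness[where X = "\<lambda>x. x $ k" and w = "\<lambda>x. p x * (1 + t * cos (u \<bullet> x + b))"])
    show "0 \<le> p x * (1 + t * cos (u \<bullet> x + b))" for x
    proof -
      have "0 \<le> 1 + t * cos (u \<bullet> x + b)"
        using t cos_ge_minus_one[of "u \<bullet> x + b"] by (elim disjE; simp only: mult_1 mult_zero_left; linarith)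
      then show ?thesis using p01(1)[of x] by simp
    qed
    have b: "\<bar>1 + t * cos (u \<bullet> x + b)\<bar> \<le> 2" for x
    proof -
      have "\<bar>t * cos (u \<bullet> x + b)\<bar> \<le> 1" using t by auto
      then show ?thesis by linarith
    qed
    show "integrable M (\<lambda>x. p x * (1 + t * cos (u \<bullet> x + b)))" "integrable N (\<lambda>x. p x * (1 + t * cos (u \<bullet> x + b)))"
      by (auto intro!: int[OF _ _ b])
    fix s c
    \<comment> \<open>Product-to-sum: the new character at frequency \<open>s\<close> shifts
      \<open>u\<close> by a multiple of the axis \<open>k\<close>. The induction hypothesis is
      quantified over \<open>u\<close> and \<open>b\<close> exactly to absorb these shifts.\<close>
    have expand: "p x * (1 + t * cos (u \<bullet> x + b)) * cos (s * x $ k + c) =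
       p x * cos ((s *\<^sub>R axis k 1) \<bullet> x + c) + (t/2) * (p x * cos ((u + s *\<^sub>R axis k 1) \<bullet> x + (b + c)))
       + (t/2) * (p x * cos ((u - s *\<^sub>R axis k 1) \<bullet> x + (b - c)))" for x
    proof -
      have "cos (u \<bullet> x + b) * cos (s * x $ k + c) =
          (cos ((u \<bullet> x + b) - (s * x $ k + c)) + cos ((u \<bullet> x + b) + (s * x $ k + c))) / 2"
        by (rule cos_times_cos)
      then have E: "cos (u \<bullet> x + b) * cos (s * x $ k + c) =
          (cos ((u - s *\<^sub>R axis k 1) \<bullet> x + (b - c)) + cos ((u + s *\<^sub>R axis k 1) \<bullet> x + (b + c))) / 2"
        by (simp add: inner_add_left inner_diff_left inner_axis' algebra_simps)
      have "p x * (1 + t * cos (u \<bullet> x + b)) * cos (s * x $ k + c) =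
          p x * cos (s * x $ k + c) + t * (p x * (cos (u \<bullet> x + b) * cos (s * x $ k + c)))"
        by (simp add: algebra_simps)
      also have "\<dots> = p x * cos ((s *\<^sub>R axis k 1) \<bullet> x + c) + (t/2) * (p x * cos ((u + s *\<^sub>R axis k 1) \<bullet> x + (b + c)))
          + (t/2) * (p x * cos ((u - s *\<^sub>R axis k 1) \<bullet> x + (b - c)))"
        unfolding E by (simp add: inner_axis' ring_distribs add_divide_distrib)
      finally show ?thesis .
    qed
    have ic: "integrable K (\<lambda>x. p x * cos (v \<bullet> x + d))" if "K = M \<or> K = N" for K v d
      using that by (intro int[OF _ _ abs_cos_le_one]) auto
    have lin: "(\<integral>x. f1 x + (t/2) * f2 x + (t/2) * f3 x \<partial>K) =
        (\<integral>x. f1 x \<partial>K) + (t/2) * (\<integral>x. f2 x \<partial>K) + (t/2) * (\<integral>x. f3 x \<partial>K)"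
      if "integrable K f1" "integrable K f2" "integrable K f3" for K and f1 f2 f3 :: "real ^ 'd \<Rightarrow> real"
      using that by simp
    note icM = ic[OF disjI1[OF refl]] and icN = ic[OF disjI2[OF refl]]
    show "(\<integral>x. p x * (1 + t * cos (u \<bullet> x + b)) * cos (s * x $ k + c) \<partial>M) =
        (\<integral>x. p x * (1 + t * cos (u \<bullet> x + b)) * cos (s * x $ k + c) \<partial>N)"
      unfolding expand lin[OF icM icM icM] lin[OF icN icN icN] IH ..
  qed (use M N in auto)
  have i: "integrable K (\<lambda>x. p x * (cos (u \<bullet> x + b) * indicator (A k) (x $ k)))"
     "integrable K (\<lambda>x. p x * indicator (A k) (x $ k))" if "K = M \<or> K = N" for K
  proof -
    have 1: "\<bar>cos (u \<bullet> x + b) * indicator (A k) (x $ k)\<bar> \<le> 1" for x by (auto simp: indicator_def)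
    show "integrable K (\<lambda>x. p x * (cos (u \<bullet> x + b) * indicator (A k) (x $ k)))"
      by (rule int[OF that _ 1]) auto
    have 1: "\<bar>indicator (A k) (x $ k) :: real\<bar> \<le> 1" for x :: "real ^ 'd" by (auto simp: indicator_def)
    show "integrable K (\<lambda>x. p x * indicator (A k) (x $ k))"
      by (rule int[OF that _ 1]) auto
  qed
  have eq: "(\<Prod>j\<in>insert k J. indicator (A j) (x $ j)) * cos (u \<bullet> x + b) =
      p x * (cos (u \<bullet> x + b) * indicator (A k) (x $ k))" for x
    using insert.hyps by (simp add: p_def)
  have "(\<integral>x. p x * (1 + 1 * cos (u \<bullet> x + b)) * indicator (A k) (x $ k) \<partial>K) =
     (\<integral>x. p x * (1 + 0 * cos (u \<bullet> x + b)) * indicator (A k) (x $ k) \<partial>K) +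
     (\<integral>x. p x * (cos (u \<bullet> x + b) * indicator (A k) (x $ k)) \<partial>K)" if "K = M \<or> K = N" for K
    using i[OF that] by (subst Bochner_Integration.integral_add[symmetric]) (auto simp: algebra_simps)
  from this[of M] this[of N] show ?case
    unfolding eq using step[of 0] step[of 1] by simp
qed

text \<open>Lower orthants form an intersection-stable generator, and the indicator of an orthant is
  a product of coordinate indicators. The coordinatewise statement is used with all coordinates,
  frequency 0 and phase 0.\<close>

theorem char_vector_uniqueness:
  fixes M N :: "(real ^ 'd) measure"
  assumes M: "prob_space M" "sets M = sets borel" and N: "prob_space N" "sets N = sets borel"
    and cos: "\<And>u. (\<integral>x. cos (u \<bullet> x) \<partial>M) = (\<integral>x. cos (u \<bullet> x) \<partial>N)"
    and sin: "\<And>u. (\<integral>x. sin (u \<bullet> x) \<partial>M) = (\<integral>x. sin (u \<bullet> x) \<partial>N)"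
  shows "M = N"
proof (rule measure_eqI_generator_eq[where E = "range (\<lambda>a. {..a :: real ^ 'd})" and \<Omega> = UNIV
      and A = "\<lambda>i. {..\<chi> j. real i}"])
  interpret M: prob_space M by fact
  interpret N: prob_space N by fact
  have "{..a} \<inter> {..b} = {..inf a b}" for a b :: "real ^ 'd" by auto
  then show "Int_stable (range (\<lambda>a. {..a :: real ^ 'd}))"
    unfolding Int_stable_def by auto
  show "sets M = sigma_sets UNIV (range (\<lambda>a. {..a :: real ^ 'd}))" "sets N = sigma_sets UNIV (range (\<lambda>a. {..a :: real ^ 'd}))"
    unfolding M(2) N(2) by (subst borel_eq_atMost, simp)+
  show "(\<Union>i. {..\<chi> j. real i}) = (UNIV :: (real ^ 'd) set)"
  proof (intro equalityI subset_UNIV subsetI)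
    fix x :: "real ^ 'd"
    obtain i :: nat where "norm x \<le> real i" using real_arch_simple by blast
    then have "x $ j \<le> real i" for j using component_le_norm_cart[of x j] by linarith
    then show "x \<in> (\<Union>i. {..\<chi> j. real i})" by (auto simp: less_eq_vec_def)
  qed
  fix B assume "B \<in> range (\<lambda>a. {..a :: real ^ 'd})"
  then obtain a where B: "B = {..a}" by auto
  have ind: "indicator B x = (\<Prod>j\<in>UNIV. indicator {..a $ j} (x $ j) :: real)" for x
    unfolding B by (auto simp: indicator_def less_eq_vec_def)
  have "measure K B = (\<integral>x. (\<Prod>j\<in>UNIV. indicator {..a $ j} (x $ j)) * cos (0 \<bullet> x + 0) \<partial>K)"
    if "sets K = sets borel" for K
  proof -
    have "space K = UNIV" using sets_eq_imp_space_eq[OF that] by simp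
    then show ?thesis using that by (simp flip: ind)
  qed
  then have "measure M B = measure N B"
    using M(2) N(2) char_vector_coordinatewise[OF M N cos sin, of UNIV "\<lambda>j. {..a $ j}" 0 0] by simp
  then show "emeasure M B = emeasure N B" by (simp add: M.emeasure_eq_measure N.emeasure_eq_measure)
qed (use M N in \<open>auto simp: prob_space_def finite_measure.emeasure_finite\<close>)

section \<open>Gaussian vectors\<close>

abbreviation std_normal :: "real measure" where "std_normal \<equiv> std_normal_distribution"

lemma prob_space_std_normal: "prob_space std_normal"
  by (rule prob_space_normal_density) simp

lemma sets_std_normal [measurable_cong]: "sets std_normal = sets borel"
  by simp

lemma integral_std_normal_eq:
  fixes f :: "real \<Rightarrow> real"
  assumes "f \<in> borel_measurable borel"
  shows "(\<integral>x. f x \<partial>std_normal) = (\<integral>x. std_normal_density x * f x \<partial>lborel)"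
  using assms by (subst integral_density) auto

lemma integrable_std_normal_eq:
  fixes f :: "real \<Rightarrow> real"
  assumes "f \<in> borel_measurable borel"
  shows "integrable std_normal f \<longleftrightarrow> integrable lborel (\<lambda>x. std_normal_density x * f x)"
  using assms by (subst integrable_density) auto

text \<open>The source of the constant \<open>sqrt (2 / pi)\<close>, and through it of
  \<open>sqrt (2 * pi) / 4\<close> in the second bound.\<close>

lemma std_normal_abs: "integrable std_normal (\<lambda>x. \<bar>x\<bar>)" "(\<integral>x. \<bar>x\<bar> \<partial>std_normal) = sqrt (2 / pi)"
  using integrable_std_normal_moment_abs[of 1] integral_std_normal_moment_abs_odd[of 0]
  by (simp_all add: integral_std_normal_eq integrable_std_normal_eq)

lemma std_normal_density_tendsto: "(std_normal_density \<longlongrightarrow> 0) at_top" "(std_normal_density \<longlongrightarrow> 0) at_bot"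
  unfolding std_normal_density_def by real_asymp+

lemma std_normal_density_deriv:
  "(std_normal_density has_real_derivative (- x * std_normal_density x)) (at x)"
proof -
  have "((\<lambda>x. c * exp (- x\<^sup>2 / 2)) has_real_derivative (- x * (c * exp (- x\<^sup>2 / 2)))) (at x)" for c
    by (auto intro!: derivative_eq_intros simp: power2_eq_square)
  then show ?thesis unfolding std_normal_density_def .
qed

text \<open>Stein's identity: the density times \<open>f\<close> has derivative \<open>g\<close>,
  since the density has derivative \<open>- x\<close> times itself. Boundedness of \<open>f\<close>
  kills the boundary terms and gives integrability.\<close>

lemma std_normal_ibp:
  fixes f f' :: "real \<Rightarrow> real"
  assumes deriv: "\<And>x. (f has_real_derivative f' x) (at x)"
    and cont: "continuous_on UNIV f'" and A: "\<And>x. \<bar>f x\<bar> \<le> A" and B: "\<And>x. \<bar>f' x\<bar> \<le> B"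
  shows "(\<integral>x. x * f x \<partial>std_normal) = (\<integral>x. f' x \<partial>std_normal)"
    and "integrable std_normal (\<lambda>x. x * f x)" "integrable std_normal f'"
proof -
  interpret prob_space std_normal by (rule prob_space_std_normal)
  have cf: "continuous_on UNIV f" using deriv by (meson DERIV_isCont continuous_at_imp_continuous_on)
  note [measurable] = borel_measurable_continuous_onI[OF cf] borel_measurable_continuous_onI[OF cont]
  show i1: "integrable std_normal f'" by (rule integrable_const_bound[of _ B]) (use B in auto)
  show i2: "integrable std_normal (\<lambda>x. x * f x)"
  proof (rule Bochner_Integration.integrable_bound)
    show "integrable std_normal (\<lambda>x. A * \<bar>x\<bar>)" using std_normal_abs(1) by simp
    have "A \<ge> 0" using A[of 0] by linarith
    then show "AE x in std_normal. norm (x * f x) \<le> norm (A * \<bar>x\<bar>)"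
      using A by (intro AE_I2) (auto simp: abs_mult mult.commute[of A] intro!: mult_left_mono)
  qed auto
  define g where "g x = std_normal_density x * f' x - std_normal_density x * (x * f x)" for x
  have j: "integrable lborel (\<lambda>x. std_normal_density x * f' x)" "integrable lborel (\<lambda>x. std_normal_density x * (x * f x))"
    using i1 i2 by (simp_all add: integrable_std_normal_eq)
  have lim: "((\<lambda>x. std_normal_density x * f x) \<longlongrightarrow> 0) F" if "(std_normal_density \<longlongrightarrow> 0) F" for F
  proof (rule Lim_null_comparison)
    show "\<forall>\<^sub>F x in F. norm (std_normal_density x * f x) \<le> std_normal_density x * A"
      using A by (intro always_eventually allI) (simp add: abs_mult mult_left_mono)
    show "((\<lambda>x. std_normal_density x * A) \<longlongrightarrow> 0) F" using tendsto_mult_right[OF that, of A] by simp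
  qed
  have "(LBINT x=-\<infinity>..\<infinity>. g x) = 0 - 0"
  proof (rule interval_integral_FTC_integrable[where F = "\<lambda>x. std_normal_density x * f x"])
    show "((\<lambda>x. std_normal_density x * f x) has_vector_derivative g x) (at x)" for x
      unfolding has_real_derivative_iff_has_vector_derivative[symmetric] g_def
      by (auto intro!: derivative_eq_intros std_normal_density_deriv deriv)
    show "isCont g x" for x
      unfolding g_def std_normal_density_def using cf cont
      by (intro continuous_intros) (auto simp: continuous_on_eq_continuous_at)
    show "set_integrable lborel (einterval (- \<infinity>) \<infinity>) g"
      using j by (simp add: g_def set_integrable_def)
    show "(((\<lambda>x. std_normal_density x * f x) \<circ> real_of_ereal) \<longlongrightarrow> 0) (at_right (- \<infinity>))"
      using lim[OF std_normal_density_tendsto(2)] by (simp add: ereal_tendsto_simps)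
    show "(((\<lambda>x. std_normal_density x * f x) \<circ> real_of_ereal) \<longlongrightarrow> 0) (at_left \<infinity>)"
      using lim[OF std_normal_density_tendsto(1)] by (simp add: ereal_tendsto_simps)
  qed auto
  then have "(\<integral>x. g x \<partial>lborel) = 0"
    by (simp add: interval_lebesgue_integral_def set_lebesgue_integral_def)
  then show "(\<integral>x. x * f x \<partial>std_normal) = (\<integral>x. f' x \<partial>std_normal)"
    using j by (simp add: g_def integral_std_normal_eq)
qed

text \<open>Integrating by parts against the primitive of \<open>k\<close> over a window of length \<open>a\<close>.\<close>

lemma std_normal_shift_bound_pos:
  fixes k :: "real \<Rightarrow> real"
  assumes cont: "continuous_on UNIV k" and k: "\<And>x. \<bar>k x\<bar> \<le> 1" and a: "0 \<le> a"
  shows "\<bar>(\<integral>z. k (z + a) \<partial>std_normal) - (\<integral>z. k z \<partial>std_normal)\<bar> \<le> a * sqrt (2 / pi)"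
proof -
  interpret prob_space std_normal by (rule prob_space_std_normal)
  note [measurable] = borel_measurable_continuous_onI[OF cont]
  define P where "P x = (LBINT t=0..x. k t)" for x
  have P': "(P has_real_derivative k x) (at x)" for x
  proof -
    \<comment> \<open>The interval contains 0 and exceeds both 0 and \<open>x\<close> by 1 on each
      side, so \<open>x\<close> is interior and the relative derivative is a full one.\<close>
    have "((\<lambda>u. LBINT t=ereal 0..ereal u. k t) has_vector_derivative k x) (at x within {min 0 x - 1..max 0 x + 1})"
      by (rule interval_integral_FTC2) (auto intro: continuous_on_subset[OF cont])
    then have "(P has_vector_derivative k x) (at x within {min 0 x - 1..max 0 x + 1})"
      by (simp add: P_def[abs_def] zero_ereal_def)
    moreover have "x \<in> interior {min 0 x - 1..max 0 x + 1}" by (simp add: interior_atLeastAtMost_real min_def max_def)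
    ultimately show ?thesis
      by (simp only: at_within_interior has_real_derivative_iff_has_vector_derivative)
  qed
  define K where "K z = P (z + a) - P z" for z
  have K': "(K has_real_derivative (k (z + a) - k z)) (at z)" for z
    unfolding K_def by (intro derivative_intros DERIV_chain2[OF P', THEN DERIV_cong] P') (auto intro!: derivative_eq_intros)
  have Kb: "\<bar>K z\<bar> \<le> a" for z
  proof -
    have "norm (P (z + a) - P z) \<le> 1 * norm (z + a - z)"
      by (rule field_differentiable_bound[of UNIV P k]) (use k P' in \<open>auto intro: has_field_derivative_at_within\<close>)
    then show ?thesis using a by (simp add: K_def)
  qed
  have "\<bar>k (z + a) - k z\<bar> \<le> 2" for z using k[of "z + a"] k[of z] by linarith
  note ibp = std_normal_ibp[OF K' _ Kb this]
  have c: "continuous_on UNIV (\<lambda>z. k (z + a) - k z)"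
    by (intro continuous_intros continuous_on_compose2[OF cont]) auto
  have "(\<integral>z. k (z + a) \<partial>std_normal) - (\<integral>z. k z \<partial>std_normal) = (\<integral>z. k (z + a) - k z \<partial>std_normal)"
    using k by (intro Bochner_Integration.integral_diff[symmetric] integrable_const_bound[of _ 1]) auto
  also have "\<dots> = (\<integral>z. z * K z \<partial>std_normal)" using ibp(1)[OF c] by simp
  also have "\<bar>\<dots>\<bar> \<le> (\<integral>z. a * \<bar>z\<bar> \<partial>std_normal)"
  proof (intro order_trans[OF integral_abs_bound] integral_mono)
    show "integrable std_normal (\<lambda>z. \<bar>z * K z\<bar>)" by (rule integrable_abs[OF ibp(2)[OF c]])
    show "integrable std_normal (\<lambda>z. a * \<bar>z\<bar>)" using std_normal_abs(1) by simp
    show "\<bar>z * K z\<bar> \<le> a * \<bar>z\<bar>" for z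
      using Kb[of z] by (simp add: abs_mult mult.commute[of a] mult_left_mono)
  qed
  finally show ?thesis by (simp add: std_normal_abs)
qed

lemma std_normal_shift_bound:
  fixes k :: "real \<Rightarrow> real"
  assumes cont: "continuous_on UNIV k" and k: "\<And>x. \<bar>k x\<bar> \<le> 1"
  shows "\<bar>(\<integral>z. k (z + a) \<partial>std_normal) - (\<integral>z. k z \<partial>std_normal)\<bar> \<le> \<bar>a\<bar> * sqrt (2 / pi)"
proof (cases "0 \<le> a")
  case True
  then show ?thesis using std_normal_shift_bound_pos[OF assms] by simp
next
  case False
  \<comment> \<open>For negative \<open>a\<close> the shifted function is taken as the base and
    moved back by \<open>- a\<close>.\<close>
  have c: "continuous_on UNIV (\<lambda>z. k (z + a))"
    by (intro continuous_on_compose2[OF cont] continuous_intros) auto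
  show ?thesis using std_normal_shift_bound_pos[OF c k, of "- a"] False
    by (simp add: abs_minus_commute add.assoc)
qed

lemma std_normal_cos: "(\<integral>z. cos (a + t * z) \<partial>std_normal) = cos a * exp (- t\<^sup>2 / 2)"
  and std_normal_sin: "(\<integral>z. sin (a + t * z) \<partial>std_normal) = sin a * exp (- t\<^sup>2 / 2)"
proof -
  interpret prob_space std_normal by (rule prob_space_std_normal)
  have i: "integrable std_normal (\<lambda>z. iexp (t * z))" by (rule integrable_iexp) auto
  have "(CLINT z|std_normal. iexp (t * z)) = complex_of_real (exp (- t\<^sup>2 / 2))"
    using fun_cong[OF char_std_normal_distribution, of t] by (simp add: char_def)
  then have c: "(\<integral>z. cos (t * z) \<partial>std_normal) = exp (- t\<^sup>2 / 2)" and s: "(\<integral>z. sin (t * z) \<partial>std_normal) = 0"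
    using integral_Re[OF i] integral_Im[OF i] by (simp_all add: Re_exp Im_exp)
  have int: "integrable std_normal (\<lambda>z. cos (t * z))" "integrable std_normal (\<lambda>z. sin (t * z))"
    by (auto intro!: integrable_const_bound[of _ 1])
  show "(\<integral>z. cos (a + t * z) \<partial>std_normal) = cos a * exp (- t\<^sup>2 / 2)"
    "(\<integral>z. sin (a + t * z) \<partial>std_normal) = sin a * exp (- t\<^sup>2 / 2)"
    unfolding cos_add sin_add using int c s by simp_all
qed

text \<open>Frequency one suffices for the characteristic function, because the law will be that of
  \<open>u \<bullet> Y\<close> with arbitrary \<open>u\<close>. The point mass is included: if
  centered, it sits at 0 and has variance 0.\<close>

lemma gaussian_law_moments:
  assumes "gaussian_law \<mu>"
  shows "sets \<mu> = sets borel" "integrable \<mu> (\<lambda>x. x)" "integrable \<mu> (\<lambda>x. x\<^sup>2)"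
    "(\<integral>x. x \<partial>\<mu>) = 0 \<Longrightarrow> (\<integral>x. cos x \<partial>\<mu>) = exp (- (\<integral>x. x\<^sup>2 \<partial>\<mu>) / 2)"
    "(\<integral>x. x \<partial>\<mu>) = 0 \<Longrightarrow> (\<integral>x. sin x \<partial>\<mu>) = 0"
proof -
  consider m where "\<mu> = return borel m" | m s where "s > 0" "\<mu> = density lborel (\<lambda>x. ennreal (normal_density m s x))"
    using assms by (auto simp: gaussian_law_def)
  then have "sets \<mu> = sets borel \<and> integrable \<mu> (\<lambda>x. x) \<and> integrable \<mu> (\<lambda>x. x\<^sup>2) \<and>
    ((\<integral>x. x \<partial>\<mu>) = 0 \<longrightarrow> (\<integral>x. cos x \<partial>\<mu>) = exp (- (\<integral>x. x\<^sup>2 \<partial>\<mu>) / 2) \<and> (\<integral>x. sin x \<partial>\<mu>) = 0)"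
  proof cases
    case 1
    have int: "integrable \<mu> f" if [measurable]: "f \<in> borel_measurable borel" for f :: "real \<Rightarrow> real"
      unfolding 1 integrable_iff_bounded by (subst nn_integral_return) auto
    have eq: "(\<integral>x. f x \<partial>\<mu>) = f m" if "f \<in> borel_measurable borel" for f :: "real \<Rightarrow> real"
      unfolding 1 using that by (intro integral_return) auto
    have "sets \<mu> = sets borel" by (simp add: 1)
    moreover have "(\<integral>x. x \<partial>\<mu>) = m" "(\<integral>x. x\<^sup>2 \<partial>\<mu>) = m\<^sup>2" "(\<integral>x. cos x \<partial>\<mu>) = cos m" "(\<integral>x. sin x \<partial>\<mu>) = sin m"
      by (rule eq; measurable)+
    moreover have "integrable \<mu> (\<lambda>x. x)" "integrable \<mu> (\<lambda>x. x\<^sup>2)" by (rule int; measurable)+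
    ultimately show ?thesis by auto
  next
    case 2
    have int: "integrable \<mu> f \<longleftrightarrow> integrable lborel (\<lambda>x. normal_density m s x * f x)"
         "(\<integral>x. f x \<partial>\<mu>) = (\<integral>x. normal_density m s x * f x \<partial>lborel)"
        if [measurable]: "f \<in> borel_measurable borel" for f :: "real \<Rightarrow> real"
      unfolding 2(2) by (subst integrable_density; simp) (subst integral_density; simp)
    have i1: "integrable lborel (\<lambda>x. normal_density m s x * x)" 
      using integrable_normal_moment_nz_1[OF 2(1)] .
    have "integrable lborel (\<lambda>x. normal_density m s x * (x - m)\<^sup>2 + 2 * m * (normal_density m s x * x) - m\<^sup>2 * normal_density m s x)"
      using i1 integrable_normal_moment[OF 2(1), of m 2] integrable_normal_density[OF 2(1)] by simp
    also have "(\<lambda>x. normal_density m s x * (x - m)\<^sup>2 + 2 * m * (normal_density m s x * x) - m\<^sup>2 * normal_density m s x)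
        = (\<lambda>x. normal_density m s x * x\<^sup>2)"
      by (simp add: fun_eq_iff power2_eq_square algebra_simps)
    finally have i2: "integrable lborel (\<lambda>x. normal_density m s x * x\<^sup>2)" .
    have affine: "(\<integral>x. f x \<partial>\<mu>) = (\<integral>z. f (s * z) \<partial>std_normal)"
      if m: "m = 0" and [measurable]: "f \<in> borel_measurable borel" for f :: "real \<Rightarrow> real"
    proof -
      have "normal_density 0 s (s * z) = std_normal_density z / s" for z
        using 2(1) by (simp add: normal_density_def real_sqrt_mult power_mult_distrib)
      moreover have "(\<integral>x. f x \<partial>\<mu>) = (\<integral>x. normal_density 0 s x * f x \<partial>lborel)" using m by (simp add: int(2))
      moreover have "\<dots> = \<bar>s\<bar> *\<^sub>R (\<integral>z. normal_density 0 s (0 + s * z) * f (0 + s * z) \<partial>lborel)"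
        using 2(1) by (intro lborel_integral_real_affine) simp
      ultimately show ?thesis using 2(1) by (simp add: integral_std_normal_eq)
    qed
    have "(\<integral>x. cos x \<partial>\<mu>) = exp (- (\<integral>x. x\<^sup>2 \<partial>\<mu>) / 2) \<and> (\<integral>x. sin x \<partial>\<mu>) = 0" if "(\<integral>x. x \<partial>\<mu>) = 0"
    proof -
      have m: "m = 0" using that integral_normal_moment_nz_1[OF 2(1), of m] by (simp add: int)
      have "(\<integral>x. x\<^sup>2 \<partial>\<mu>) = s\<^sup>2"
        using integral_normal_moment_even[OF 2(1), of 0 1] m by (simp add: int)
      then show ?thesis using std_normal_cos[of 0 s] std_normal_sin[of 0 s] by (simp add: affine m)
    qed
    then show ?thesis using i1 i2 by (simp add: int) (simp add: 2(2))
  qed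
  then show "sets \<mu> = sets borel" "integrable \<mu> (\<lambda>x. x)" "integrable \<mu> (\<lambda>x. x\<^sup>2)"
    "(\<integral>x. x \<partial>\<mu>) = 0 \<Longrightarrow> (\<integral>x. cos x \<partial>\<mu>) = exp (- (\<integral>x. x\<^sup>2 \<partial>\<mu>) / 2)"
    "(\<integral>x. x \<partial>\<mu>) = 0 \<Longrightarrow> (\<integral>x. sin x \<partial>\<mu>) = 0" by auto
qed

section \<open>Centered Gaussian vectors with a possibly singular covariance\<close>

locale centered_gaussian = prob_space N for N :: "'b measure" +
  fixes Y :: "'b \<Rightarrow> real ^ 'd" and C :: "real ^ 'd ^ 'd"
  assumes gaussian: "centered_gaussian_vector N Y C"
begin

lemma Y_measurable [measurable]: "Y \<in> borel_measurable N"
  using gaussian by (simp add: centered_gaussian_vector_def gaussian_vector_def)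

lemma gaussian_law_inner: "gaussian_law (distr N borel (\<lambda>\<omega>. u \<bullet> Y \<omega>))"
  using gaussian by (simp add: centered_gaussian_vector_def gaussian_vector_def)

lemma integrable_inner_Y: "integrable N (\<lambda>\<omega>. u \<bullet> Y \<omega>)"
  using gaussian_law_moments(2)[OF gaussian_law_inner[of u]] by (simp add: integrable_distr_eq)

lemma integrable_inner_Y_square: "integrable N (\<lambda>\<omega>. (u \<bullet> Y \<omega>)\<^sup>2)"
  using gaussian_law_moments(3)[OF gaussian_law_inner[of u]] by (simp add: integrable_distr_eq)

lemma integrable_inner_Y_mult: "integrable N (\<lambda>\<omega>. (u \<bullet> Y \<omega>) * (v \<bullet> Y \<omega>))"
proof -
  have "(u \<bullet> Y \<omega>) * (v \<bullet> Y \<omega>) = (((u + v) \<bullet> Y \<omega>)\<^sup>2 - (u \<bullet> Y \<omega>)\<^sup>2 - (v \<bullet> Y \<omega>)\<^sup>2) / 2" for \<omega>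
    by (simp add: inner_add_left power2_eq_square algebra_simps)
  then show ?thesis
    using integrable_inner_Y_square[of u] integrable_inner_Y_square[of v] integrable_inner_Y_square[of "u + v"]
    by (simp only:) simp
qed

lemma Y_nth: "Y \<omega> $ i = axis i 1 \<bullet> Y \<omega>"
  by (simp add: inner_axis')

lemma integrable_Y_nth: "integrable N (\<lambda>\<omega>. Y \<omega> $ i)"
  unfolding Y_nth by (rule integrable_inner_Y)

lemma integrable_Y_nth_mult: "integrable N (\<lambda>\<omega>. Y \<omega> $ i * Y \<omega> $ j)"
  unfolding Y_nth by (rule integrable_inner_Y_mult)

lemma expectation_Y_nth: "expectation (\<lambda>\<omega>. Y \<omega> $ i) = 0"
  using gaussian by (simp add: centered_gaussian_vector_def)

lemma covariance: "C $ i $ j = expectation (\<lambda>\<omega>. Y \<omega> $ i * Y \<omega> $ j)"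
  using gaussian expectation_Y_nth by (auto simp: centered_gaussian_vector_def covariance_matrix_def)

lemma expectation_inner_Y: "expectation (\<lambda>\<omega>. u \<bullet> Y \<omega>) = 0"
  by (simp add: inner_vec_def integrable_Y_nth expectation_Y_nth)

lemma expectation_inner_Y_mult: "expectation (\<lambda>\<omega>. (u \<bullet> Y \<omega>) * (v \<bullet> Y \<omega>)) = u \<bullet> (C *v v)"
proof -
  have "(u \<bullet> Y \<omega>) * (v \<bullet> Y \<omega>) = (\<Sum>i\<in>UNIV. \<Sum>j\<in>UNIV. (u $ i * v $ j) * (Y \<omega> $ i * Y \<omega> $ j))" for \<omega>
    by (simp add: inner_vec_def sum_product algebra_simps)
  then have "expectation (\<lambda>\<omega>. (u \<bullet> Y \<omega>) * (v \<bullet> Y \<omega>)) = (\<Sum>i\<in>UNIV. \<Sum>j\<in>UNIV. (u $ i * v $ j) * C $ i $ j)"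
    by (simp add: integrable_Y_nth_mult covariance)
  also have "\<dots> = u \<bullet> (C *v v)"
    by (simp add: inner_vec_def matrix_vector_mult_def sum_distrib_left mult_ac)
  finally show ?thesis .
qed

lemma covariance_inner_sym: "u \<bullet> (C *v v) = v \<bullet> (C *v u)"
  unfolding expectation_inner_Y_mult[symmetric] by (simp add: mult.commute)

lemma covariance_nonneg: "0 \<le> u \<bullet> (C *v u)"
  unfolding expectation_inner_Y_mult[symmetric] by simp

lemma expectation_cos: "expectation (\<lambda>\<omega>. cos (u \<bullet> Y \<omega>)) = exp (- (u \<bullet> (C *v u)) / 2)"
  and expectation_sin: "expectation (\<lambda>\<omega>. sin (u \<bullet> Y \<omega>)) = 0"
proof -
  have 0: "(\<integral>x. x \<partial>distr N borel (\<lambda>\<omega>. u \<bullet> Y \<omega>)) = 0"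
    by (subst integral_distr) (auto simp: expectation_inner_Y)
  have 1: "(\<integral>x. x\<^sup>2 \<partial>distr N borel (\<lambda>\<omega>. u \<bullet> Y \<omega>)) = u \<bullet> (C *v u)"
    by (subst integral_distr) (auto simp: power2_eq_square expectation_inner_Y_mult)
  have "(\<integral>x. cos x \<partial>distr N borel (\<lambda>\<omega>. u \<bullet> Y \<omega>)) = expectation (\<lambda>\<omega>. cos (u \<bullet> Y \<omega>))"
    "(\<integral>x. sin x \<partial>distr N borel (\<lambda>\<omega>. u \<bullet> Y \<omega>)) = expectation (\<lambda>\<omega>. sin (u \<bullet> Y \<omega>))"
    by (subst integral_distr; simp)+
  then show "expectation (\<lambda>\<omega>. cos (u \<bullet> Y \<omega>)) = exp (- (u \<bullet> (C *v u)) / 2)"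
    "expectation (\<lambda>\<omega>. sin (u \<bullet> Y \<omega>)) = 0"
    using gaussian_law_moments(4,5)[OF gaussian_law_inner[of u] 0] unfolding 1 by simp_all
qed

text \<open>A variable of mean zero and variance zero vanishes almost surely, hence so do its
  covariances with all \<open>u \<bullet> Y\<close>. This covers the case in which resampling would
  divide by zero.\<close>

lemma degenerate_direction:
  assumes "w \<bullet> (C *v w) = 0"
  shows "AE \<omega> in N. w \<bullet> Y \<omega> = 0" "C *v w = 0"
proof -
  have "expectation (\<lambda>\<omega>. (w \<bullet> Y \<omega>)\<^sup>2) = 0"
    using assms expectation_inner_Y_mult[of w w] by (simp add: power2_eq_square)
  then show ae: "AE \<omega> in N. w \<bullet> Y \<omega> = 0"
    using integral_nonneg_eq_0_iff_AE[OF integrable_inner_Y_square[of w]] by simp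
  have "u \<bullet> (C *v w) = 0" for u
    unfolding expectation_inner_Y_mult[symmetric]
    by (rule integral_eq_zero_AE) (use ae in eventually_elim, simp)
  then show "C *v w = 0" by (metis inner_eq_zero_iff)
qed

text \<open>\<open>w \<bullet> Y\<close> is uncorrelated with, hence independent of, the rest of \<open>Y\<close>.\<close>

lemma resample:
  assumes w: "w \<bullet> (C *v w) = \<sigma>\<^sup>2" "\<sigma> > 0"
  shows "distr N borel Y =
    distr (N \<Otimes>\<^sub>M std_normal) borel (\<lambda>(\<omega>, z). Y \<omega> + ((z - (w \<bullet> Y \<omega>) / \<sigma>) / \<sigma>) *\<^sub>R (C *v w))"
proof -
  interpret G: prob_space std_normal by (rule prob_space_std_normal)
  interpret P: pair_prob_space N std_normal ..
  let ?R = "\<lambda>(\<omega>, z). Y \<omega> + ((z - (w \<bullet> Y \<omega>) / \<sigma>) / \<sigma>) *\<^sub>R (C *v w)"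
  have R[measurable]: "?R \<in> borel_measurable (N \<Otimes>\<^sub>M std_normal)" by measurable
  \<comment> \<open>In direction \<open>u\<close>, the regression of \<open>u \<bullet> Y\<close> on
    the normalized variable \<open>w \<bullet> Y\<close> has slope \<open>t u\<close> and residual
    \<open>u' u \<bullet> Y\<close>; resampling keeps the residual and multiplies the slope by the
    fresh \<open>z\<close>.\<close>
  define t where "t u = (u \<bullet> (C *v w)) / \<sigma>" for u
  define u' where "u' u = u - (t u / \<sigma>) *\<^sub>R w" for u
  have R_eq: "u \<bullet> ?R (\<omega>, z) = u' u \<bullet> Y \<omega> + t u * z" for u \<omega> z
    using w(2) by (simp add: u'_def t_def inner_add_right inner_diff_left field_simps)
  \<comment> \<open>Pythagoras: residual variance plus explained variance is the full variance, so
    the product of the two characteristic functions is the right one.\<close>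
  have var: "u' u \<bullet> (C *v u' u) + (t u)\<^sup>2 = u \<bullet> (C *v u)" for u
  proof -
    have "u' u \<bullet> (C *v u' u) = u \<bullet> (C *v u) - 2 * (t u / \<sigma>) * (u \<bullet> (C *v w)) + (t u / \<sigma>)\<^sup>2 * \<sigma>\<^sup>2"
      unfolding u'_def
      by (simp add: matrix_vector_mult_diff_distrib matrix_vector_mult_scaleR inner_diff_left inner_diff_right
          covariance_inner_sym[of w u] w(1) power2_eq_square algebra_simps)
    moreover have "u \<bullet> (C *v w) = t u * \<sigma>" using w(2) by (simp add: t_def)
    ultimately show ?thesis using w(2) by (simp add: power2_eq_square field_simps)
  qed
  show ?thesis
  proof (rule char_vector_uniqueness)
    show "prob_space (distr N borel Y)" by (rule prob_space_distr) simp
    show "prob_space (distr (N \<Otimes>\<^sub>M std_normal) borel ?R)" by (rule P.prob_space_distr) (rule R)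
    fix u
    have "(\<integral>x. cos (u \<bullet> x) \<partial>distr (N \<Otimes>\<^sub>M std_normal) borel ?R) =
        (\<integral>x. cos (u \<bullet> ?R x) \<partial>(N \<Otimes>\<^sub>M std_normal))"
      by (rule integral_distr[OF R]) simp
    also have "\<dots> = (\<integral>\<omega>. \<integral>z. cos (u \<bullet> ?R (\<omega>, z)) \<partial>std_normal \<partial>N)"
      by (rule P.integral_fst'[symmetric]) (auto intro!: P.integrable_const_bound[of _ 1])
    also have "\<dots> = exp (- (t u)\<^sup>2 / 2) * exp (- (u' u \<bullet> (C *v u' u)) / 2)"
      unfolding R_eq by (simp add: std_normal_cos expectation_cos)
    also have "\<dots> = exp (- (u \<bullet> (C *v u)) / 2)"
      by (simp add: var[of u, symmetric] field_simps flip: exp_add)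
    also have "\<dots> = (\<integral>x. cos (u \<bullet> x) \<partial>distr N borel Y)"
      by (subst integral_distr) (auto simp: expectation_cos)
    finally show "(\<integral>x. cos (u \<bullet> x) \<partial>distr N borel Y) =
      (\<integral>x. cos (u \<bullet> x) \<partial>distr (N \<Otimes>\<^sub>M std_normal) borel ?R)" by simp
    have "(\<integral>x. sin (u \<bullet> x) \<partial>distr (N \<Otimes>\<^sub>M std_normal) borel ?R) =
        (\<integral>x. sin (u \<bullet> ?R x) \<partial>(N \<Otimes>\<^sub>M std_normal))"
      by (rule integral_distr[OF R]) simp
    also have "\<dots> = (\<integral>\<omega>. \<integral>z. sin (u \<bullet> ?R (\<omega>, z)) \<partial>std_normal \<partial>N)"
      by (rule P.integral_fst'[symmetric]) (auto intro!: P.integrable_const_bound[of _ 1])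
    also have "\<dots> = 0"
      unfolding R_eq by (simp add: std_normal_sin expectation_sin)
    also have "\<dots> = (\<integral>x. sin (u \<bullet> x) \<partial>distr N borel Y)"
      by (subst integral_distr) (auto simp: expectation_sin)
    finally show "(\<integral>x. sin (u \<bullet> x) \<partial>distr N borel Y) =
      (\<integral>x. sin (u \<bullet> x) \<partial>distr (N \<Otimes>\<^sub>M std_normal) borel ?R)" by simp
  qed auto
qed

lemma expectation_resample:
  assumes w: "w \<bullet> (C *v w) = \<sigma>\<^sup>2" "\<sigma> > 0"
    and [measurable]: "H \<in> borel_measurable borel" and int: "integrable N (\<lambda>\<omega>. H (Y \<omega>) :: real)"
  shows "expectation (\<lambda>\<omega>. H (Y \<omega>)) =
    (\<integral>\<omega>. \<integral>z. H (Y \<omega> + ((z - (w \<bullet> Y \<omega>) / \<sigma>) / \<sigma>) *\<^sub>R (C *v w)) \<partial>std_normal \<partial>N)"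
proof -
  interpret G: prob_space std_normal by (rule prob_space_std_normal)
  interpret P: pair_prob_space N std_normal ..
  let ?R = "\<lambda>(\<omega>, z). Y \<omega> + ((z - (w \<bullet> Y \<omega>) / \<sigma>) / \<sigma>) *\<^sub>R (C *v w)"
  have R[measurable]: "?R \<in> borel_measurable (N \<Otimes>\<^sub>M std_normal)" by measurable
  have "integrable (distr N borel Y) H" using int by (simp add: integrable_distr_eq)
  then have i: "integrable (N \<Otimes>\<^sub>M std_normal) (\<lambda>x. H (?R x))"
    unfolding resample[OF w] by (subst (asm) integrable_distr_eq[OF R]) simp_all
  have "expectation (\<lambda>\<omega>. H (Y \<omega>)) = (\<integral>x. H x \<partial>distr N borel Y)" by (subst integral_distr) auto
  also have "\<dots> = (\<integral>x. H (?R x) \<partial>(N \<Otimes>\<^sub>M std_normal))"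
    unfolding resample[OF w] by (rule integral_distr[OF R]) simp
  also have "\<dots> = (\<integral>\<omega>. \<integral>z. H (?R (\<omega>, z)) \<partial>std_normal \<partial>N)"
    by (rule P.integral_fst'[symmetric, OF i])
  finally show ?thesis by simp
qed

text \<open>Resampling \<open>w \<bullet> Y\<close> moves \<open>Y\<close> along
  \<open>C *v w\<close>, which is why \<open>h\<close> is differentiated in that direction. With the
  remaining part of \<open>Y\<close> fixed, Stein's identity in \<open>z\<close> applies; the factor
  \<open>\<sigma>\<close> from \<open>w \<bullet> Y\<close> cancels \<open>1 / \<sigma>\<close> from
  the chain rule.\<close>

lemma gaussian_ibp:
  assumes deriv: "\<And>x t. ((\<lambda>t. h (x + t *\<^sub>R (C *v w))) has_real_derivative dh (x + t *\<^sub>R (C *v w))) (at t)"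
    and cont: "continuous_on UNIV h" "continuous_on UNIV dh"
    and A: "\<And>x. \<bar>h x\<bar> \<le> A" and B: "\<And>x. \<bar>dh x\<bar> \<le> B"
  shows "expectation (\<lambda>\<omega>. (w \<bullet> Y \<omega>) * h (Y \<omega>)) = expectation (\<lambda>\<omega>. dh (Y \<omega>))"
    and "integrable N (\<lambda>\<omega>. (w \<bullet> Y \<omega>) * h (Y \<omega>))"
proof -
  note [measurable] = cont[THEN borel_measurable_continuous_onI]
  show int: "integrable N (\<lambda>\<omega>. (w \<bullet> Y \<omega>) * h (Y \<omega>))"
  proof (rule Bochner_Integration.integrable_bound)
    show "integrable N (\<lambda>\<omega>. A * \<bar>w \<bullet> Y \<omega>\<bar>)" using integrable_inner_Y[of w] by simp
    have "A \<ge> 0" using A[of 0] by linarith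
    then show "AE \<omega> in N. norm ((w \<bullet> Y \<omega>) * h (Y \<omega>)) \<le> norm (A * \<bar>w \<bullet> Y \<omega>\<bar>)"
      using A by (intro AE_I2) (simp add: abs_mult mult.commute[of A] mult_left_mono)
  qed auto
  show "expectation (\<lambda>\<omega>. (w \<bullet> Y \<omega>) * h (Y \<omega>)) = expectation (\<lambda>\<omega>. dh (Y \<omega>))"
  proof (cases "w \<bullet> (C *v w) = 0")
    case True
    note deg = degenerate_direction[OF this]
    \<comment> \<open>Here \<open>C *v w = 0\<close>, so the hypothesis differentiates a constant,
      and the other side vanishes because \<open>w \<bullet> Y\<close> does.\<close>
    have "dh x = 0" for x
      using DERIV_unique[OF deriv[of x 0], of 0] deg(2) by simp
    moreover have "expectation (\<lambda>\<omega>. (w \<bullet> Y \<omega>) * h (Y \<omega>)) = 0"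
      by (rule integral_eq_zero_AE) (use deg(1) in eventually_elim, simp)
    ultimately show ?thesis by simp
  next
    case False
    define \<sigma> where "\<sigma> = sqrt (w \<bullet> (C *v w))"
    have w: "w \<bullet> (C *v w) = \<sigma>\<^sup>2" "\<sigma> > 0"
      using False covariance_nonneg[of w] by (auto simp: \<sigma>_def less_le)
    define y where "y \<omega> = Y \<omega> - ((w \<bullet> Y \<omega>) / \<sigma> / \<sigma>) *\<^sub>R (C *v w)" for \<omega>
    have y: "Y \<omega> + ((z - (w \<bullet> Y \<omega>) / \<sigma>) / \<sigma>) *\<^sub>R (C *v w) = y \<omega> + (z / \<sigma>) *\<^sub>R (C *v w)" for \<omega> z
      by (simp add: y_def diff_divide_distrib scaleR_diff_left)
    have wy: "w \<bullet> (y \<omega> + (z / \<sigma>) *\<^sub>R (C *v w)) = \<sigma> * z" for \<omega> z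
      using w by (simp add: y_def inner_add_right inner_diff_right power2_eq_square)
    have inner: "(\<integral>z. (\<sigma> * z) * h (y \<omega> + (z / \<sigma>) *\<^sub>R (C *v w)) \<partial>std_normal) =
        (\<integral>z. dh (y \<omega> + (z / \<sigma>) *\<^sub>R (C *v w)) \<partial>std_normal)" for \<omega>
    proof -
      let ?k = "\<lambda>z. \<sigma> * h (y \<omega> + (z / \<sigma>) *\<^sub>R (C *v w))"
      have "(?k has_real_derivative \<sigma> * (dh (y \<omega> + (z / \<sigma>) *\<^sub>R (C *v w)) * (1 / \<sigma>))) (at z)" for z
        by (intro DERIV_cmult DERIV_chain2[OF deriv]) (use w(2) in \<open>auto intro!: derivative_eq_intros\<close>)
      then have "(?k has_real_derivative dh (y \<omega> + (z / \<sigma>) *\<^sub>R (C *v w))) (at z)" for z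
        using w(2) by simp
      moreover have "continuous_on UNIV (\<lambda>z. dh (y \<omega> + (z / \<sigma>) *\<^sub>R (C *v w)))"
        by (intro continuous_on_compose2[OF cont(2)] continuous_intros) (use w(2) in auto)
      moreover have "\<bar>?k z\<bar> \<le> \<sigma> * A" for z using A w(2) by (simp add: abs_mult)
      ultimately have "(\<integral>z. z * ?k z \<partial>std_normal) = (\<integral>z. dh (y \<omega> + (z / \<sigma>) *\<^sub>R (C *v w)) \<partial>std_normal)"
        using B by (rule std_normal_ibp(1))
      then show ?thesis by (simp add: mult_ac)
    qed
    have "expectation (\<lambda>\<omega>. (w \<bullet> Y \<omega>) * h (Y \<omega>)) =
        (\<integral>\<omega>. \<integral>z. (\<sigma> * z) * h (y \<omega> + (z / \<sigma>) *\<^sub>R (C *v w)) \<partial>std_normal \<partial>N)"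
      using expectation_resample[OF w, of "\<lambda>x. (w \<bullet> x) * h x"] int unfolding y wy by simp
    also have "\<dots> = (\<integral>\<omega>. \<integral>z. dh (y \<omega> + (z / \<sigma>) *\<^sub>R (C *v w)) \<partial>std_normal \<partial>N)"
      unfolding inner ..
    also have "\<dots> = expectation (\<lambda>\<omega>. dh (Y \<omega>))"
      using expectation_resample[OF w, of dh] B unfolding y by (simp add: integrable_const_bound[of _ B])
    finally show ?thesis .
  qed
qed

text \<open>After resampling, a shift by \<open>C *v w\<close> is a shift of \<open>z\<close> by the
  standard deviation \<open>\<sigma>\<close> of \<open>w \<bullet> Y\<close>, and the
  one-dimensional window bound applies. Only continuity of \<open>h\<close> enters: this is the
  substitute for a third derivative of the test function.\<close>

lemma gaussian_shift_bound:
  assumes cont: "continuous_on UNIV h" and h: "\<And>x. \<bar>h x\<bar> \<le> 1"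
  shows "\<bar>expectation (\<lambda>\<omega>. h (Y \<omega> + C *v w)) - expectation (\<lambda>\<omega>. h (Y \<omega>))\<bar> \<le> sqrt (w \<bullet> (C *v w)) * sqrt (2 / pi)"
proof (cases "w \<bullet> (C *v w) = 0")
  case True
  then show ?thesis using degenerate_direction(2)[OF True] by simp
next
  case False
  note [measurable] = cont[THEN borel_measurable_continuous_onI]
  interpret G: prob_space std_normal by (rule prob_space_std_normal)
  define \<sigma> where "\<sigma> = sqrt (w \<bullet> (C *v w))"
  have w: "w \<bullet> (C *v w) = \<sigma>\<^sup>2" "\<sigma> > 0"
    using False covariance_nonneg[of w] by (auto simp: \<sigma>_def less_le)
  define y where "y \<omega> = Y \<omega> - ((w \<bullet> Y \<omega>) / \<sigma> / \<sigma>) *\<^sub>R (C *v w)" for \<omega>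
  have [measurable]: "y \<in> borel_measurable N" unfolding y_def by measurable
  have y: "Y \<omega> + ((z - (w \<bullet> Y \<omega>) / \<sigma>) / \<sigma>) *\<^sub>R (C *v w) = y \<omega> + (z / \<sigma>) *\<^sub>R (C *v w)" for \<omega> z
    by (simp add: y_def diff_divide_distrib scaleR_diff_left)
  define k where "k \<omega> z = h (y \<omega> + (z / \<sigma>) *\<^sub>R (C *v w))" for \<omega> z
  have k_cont: "continuous_on UNIV (k \<omega>)" for \<omega>
    unfolding k_def by (intro continuous_on_compose2[OF cont] continuous_intros) (use w(2) in auto)
  have k1: "\<bar>k \<omega> z\<bar> \<le> 1" for \<omega> z using h by (simp add: k_def)
  have "h (y \<omega> + (z / \<sigma>) *\<^sub>R (C *v w) + C *v w) = k \<omega> (z + \<sigma>)" for \<omega> z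
    using w(2) by (simp add: k_def add_divide_distrib scaleR_add_left add.assoc)
  then have 1: "expectation (\<lambda>\<omega>. h (Y \<omega> + C *v w)) = (\<integral>\<omega>. \<integral>z. k \<omega> (z + \<sigma>) \<partial>std_normal \<partial>N)"
    using expectation_resample[OF w, of "\<lambda>x. h (x + C *v w)"] h
    unfolding y by (simp add: integrable_const_bound[of _ 1])
  have 2: "expectation (\<lambda>\<omega>. h (Y \<omega>)) = (\<integral>\<omega>. \<integral>z. k \<omega> z \<partial>std_normal \<partial>N)"
    using expectation_resample[OF w, of h] h
    unfolding y k_def by (simp add: integrable_const_bound[of _ 1])
  have b: "\<bar>\<integral>z. k \<omega> (z + a) \<partial>std_normal\<bar> \<le> 1" for \<omega> a
    using k1 by (intro order_trans[OF integral_abs_bound] G.integral_le_const G.integrable_const_bound[of _ 1])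
      (auto simp: k_def)
  have i: "integrable N (\<lambda>\<omega>. \<integral>z. k \<omega> (z + a) \<partial>std_normal)" for a
    by (rule integrable_const_bound[of _ 1]) (use b in \<open>auto simp: k_def\<close>)
  have "expectation (\<lambda>\<omega>. h (Y \<omega> + C *v w)) - expectation (\<lambda>\<omega>. h (Y \<omega>)) =
      (\<integral>\<omega>. (\<integral>z. k \<omega> (z + \<sigma>) \<partial>std_normal) - (\<integral>z. k \<omega> z \<partial>std_normal) \<partial>N)"
    unfolding 1 2 using i[of \<sigma>] i[of 0] by simp
  also have "\<bar>\<dots>\<bar> \<le> (\<integral>\<omega>. \<sigma> * sqrt (2 / pi) \<partial>N)"
    using std_normal_shift_bound[OF k_cont k1, where a = \<sigma>] w(2) i[of \<sigma>] i[of 0]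
    by (intro order_trans[OF integral_abs_bound] integral_mono) auto
  finally show ?thesis by (simp add: \<sigma>_def prob_space)
qed

end

section \<open>Calculus for the test functions\<close>

lemma (in prob_space) expectation_has_real_derivative:
  fixes f f' :: "real \<Rightarrow> 'a \<Rightarrow> real"
  assumes deriv: "\<And>t \<omega>. ((\<lambda>t. f t \<omega>) has_real_derivative f' t \<omega>) (at t)"
    and f: "\<And>t. integrable M (f t)" and f'[measurable]: "\<And>t. f' t \<in> borel_measurable M"
    and bound: "\<And>t \<omega>. \<bar>f' t \<omega>\<bar> \<le> B \<omega>" and B: "integrable M B"
  shows "((\<lambda>t. expectation (f t)) has_real_derivative expectation (f' t)) (at t)"
  unfolding has_field_derivative_iff tendsto_at_iff_sequentially
proof (intro allI impI)
  fix x :: "nat \<Rightarrow> real"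
  assume x: "\<forall>i. x i \<in> UNIV - {t}" and lim: "x \<longlonglongrightarrow> t"
  note [measurable] = f[THEN borel_measurable_integrable]
  have "(\<lambda>i. expectation (\<lambda>\<omega>. (f (x i) \<omega> - f t \<omega>) / (x i - t))) \<longlonglongrightarrow> expectation (f' t)"
  proof (rule integral_dominated_convergence[OF _ _ B])
    show "AE \<omega> in M. (\<lambda>i. (f (x i) \<omega> - f t \<omega>) / (x i - t)) \<longlonglongrightarrow> f' t \<omega>"
    proof (rule AE_I2)
      fix \<omega>
      have "((\<lambda>y. (f y \<omega> - f t \<omega>) / (y - t)) \<longlongrightarrow> f' t \<omega>) (at t)"
        using deriv[of \<omega> t] by (simp add: has_field_derivative_iff)
      then show "(\<lambda>i. (f (x i) \<omega> - f t \<omega>) / (x i - t)) \<longlonglongrightarrow> f' t \<omega>"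
        using x lim unfolding tendsto_at_iff_sequentially by (auto simp: comp_def)
    qed
    show "AE \<omega> in M. norm ((f (x i) \<omega> - f t \<omega>) / (x i - t)) \<le> B \<omega>" for i
    proof (rule AE_I2)
      fix \<omega>
      have "norm (f (x i) \<omega> - f t \<omega>) \<le> B \<omega> * norm (x i - t)"
        by (rule field_differentiable_bound[of UNIV "\<lambda>t. f t \<omega>" "\<lambda>t. f' t \<omega>"])
           (use deriv bound in \<open>auto intro: has_field_derivative_at_within\<close>)
      then show "norm ((f (x i) \<omega> - f t \<omega>) / (x i - t)) \<le> B \<omega>"
        using x by (simp add: divide_simps)
    qed
  qed auto
  then show "((\<lambda>y. (expectation (f y) - expectation (f t)) / (y - t)) \<circ> x) \<longlonglongrightarrow> expectation (f' t)"
    using f by (simp add: comp_def)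
qed

lemma has_real_derivative_along:
  fixes g :: "real ^ 'd \<Rightarrow> real"
  assumes g: "g differentiable_on UNIV" and p: "(p has_vector_derivative p') (at t)"
  shows "((\<lambda>t. g (p t)) has_real_derivative (\<Sum>i\<in>UNIV. p' $ i * partial_derivative i g (p t))) (at t)"
proof -
  have gd: "(g has_derivative frechet_derivative g (at x)) (at x)" for x
    using g by (simp add: differentiable_on_def frechet_derivative_works)
  have "((\<lambda>t. g (p t)) has_derivative (\<lambda>h. frechet_derivative g (at (p t)) (h *\<^sub>R p'))) (at t)"
    using has_derivative_compose[OF p[unfolded has_vector_derivative_def] gd] by simp
  moreover have "frechet_derivative g (at (p t)) (h *\<^sub>R p') =
      (\<Sum>i\<in>UNIV. p' $ i * partial_derivative i g (p t)) * h" for h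
  proof -
    interpret linear "frechet_derivative g (at (p t))" using gd has_derivative_linear by blast
    have "p' = (\<Sum>i\<in>UNIV. (p' $ i) *\<^sub>R axis i 1)"
      using basis_expansion[of p'] by (simp add: scalar_mult_eq_scaleR)
    then have "frechet_derivative g (at (p t)) p' = frechet_derivative g (at (p t)) (\<Sum>i\<in>UNIV. (p' $ i) *\<^sub>R axis i 1)"
      by (rule arg_cong)
    also have "\<dots> = (\<Sum>i\<in>UNIV. p' $ i * partial_derivative i g (p t))"
      by (simp add: sum scaleR partial_derivative_def)
    finally show ?thesis by (simp add: scaleR)
  qed
  ultimately show ?thesis by (simp add: has_field_derivative_def mult_commute_abs)
qed

lemma has_real_derivative_line:
  fixes g :: "real ^ 'd \<Rightarrow> real"
  assumes "g differentiable_on UNIV"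
  shows "((\<lambda>t. g (x + t *\<^sub>R v)) has_real_derivative (\<Sum>i\<in>UNIV. v $ i * partial_derivative i g (x + t *\<^sub>R v))) (at t)"
  by (rule has_real_derivative_along[OF assms])
     (auto simp: has_vector_derivative_def intro!: derivative_eq_intros)

lemma has_real_derivative_axis:
  fixes g :: "real ^ 'd \<Rightarrow> real"
  assumes "g differentiable_on UNIV"
  shows "((\<lambda>t. g (x + t *\<^sub>R axis i 1)) has_real_derivative partial_derivative i g (x + t *\<^sub>R axis i 1)) (at t)"
proof -
  have "(\<Sum>j\<in>UNIV. axis i 1 $ j * f j) = f i" for f :: "'d \<Rightarrow> real"
  proof -
    have "axis i 1 $ j * f j = (if j = i then f j else 0)" for j by (simp add: axis_def)
    then show ?thesis by simp
  qed
  then show ?thesis using has_real_derivative_line[OF assms, of x "axis i 1" t] by simp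
qed

text \<open>Both mixed partials are values of the second difference quotient at nearby points.\<close>

lemma second_difference_mean_value:
  fixes g :: "real ^ 'd \<Rightarrow> real"
  assumes g: "C_k 2 g" and h: "h > 0"
  shows "\<exists>y. norm (y - x) \<le> 2 * h \<and>
    g (x + h *\<^sub>R axis i 1 + h *\<^sub>R axis j 1) - g (x + h *\<^sub>R axis i 1) - g (x + h *\<^sub>R axis j 1) + g x =
      h\<^sup>2 * partial_derivative j (partial_derivative i g) y"
proof -
  have d: "g differentiable_on UNIV" "partial_derivative i g differentiable_on UNIV"
    using g by (auto simp: numeral_2_eq_2)
  \<comment> \<open>The increment along \<open>j\<close>, followed in direction \<open>i\<close>:
    the mean value theorem is applied to it in \<open>i\<close> and then to the resulting first
    partial in \<open>j\<close>.\<close>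
  define f where "f s = g (x + h *\<^sub>R axis j 1 + s *\<^sub>R axis i 1) - g (x + s *\<^sub>R axis i 1)" for s
  have f': "(f has_real_derivative (partial_derivative i g (x + h *\<^sub>R axis j 1 + s *\<^sub>R axis i 1) -
      partial_derivative i g (x + s *\<^sub>R axis i 1))) (at s)" for s
    unfolding f_def by (intro derivative_intros has_real_derivative_axis d)
  obtain s where s: "0 < s" "s < h" "f h - f 0 = (h - 0) *
     (partial_derivative i g (x + h *\<^sub>R axis j 1 + s *\<^sub>R axis i 1) - partial_derivative i g (x + s *\<^sub>R axis i 1))"
    using MVT2[OF h, of f, OF f'] by blast
  obtain r where r: "0 < r" "r < h"
    "partial_derivative i g (x + s *\<^sub>R axis i 1 + h *\<^sub>R axis j 1) - partial_derivative i g (x + s *\<^sub>R axis i 1 + 0 *\<^sub>R axis j 1) =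
      (h - 0) * partial_derivative j (partial_derivative i g) (x + s *\<^sub>R axis i 1 + r *\<^sub>R axis j 1)"
    using MVT2[OF h has_real_derivative_axis[OF d(2), of "x + s *\<^sub>R axis i 1" j]] by blast
  let ?y = "x + s *\<^sub>R axis i 1 + r *\<^sub>R axis j 1"
  have "norm (?y - x) \<le> norm (s *\<^sub>R axis i (1::real) :: real ^ 'd) + norm (r *\<^sub>R axis j (1::real) :: real ^ 'd)"
    by (metis add.assoc add_diff_cancel_left' norm_triangle_ineq)
  also have "\<dots> \<le> 2 * h" using s r by simp
  finally have "norm (?y - x) \<le> 2 * h" .
  moreover have "g (x + h *\<^sub>R axis i 1 + h *\<^sub>R axis j 1) - g (x + h *\<^sub>R axis i 1) - g (x + h *\<^sub>R axis j 1) + g x = f h - f 0"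
    by (simp add: f_def algebra_simps)
  moreover have "f h - f 0 = h\<^sup>2 * partial_derivative j (partial_derivative i g) ?y"
    using s(3) r(3) by (simp add: algebra_simps power2_eq_square)
  ultimately show ?thesis by metis
qed

text \<open>The second difference is symmetric in \<open>i\<close> and \<open>j\<close>, so the
  mixed partials agree at two points within \<open>2 * h\<close> of \<open>x\<close>, and continuity
  brings both to \<open>x\<close>. Symmetry is required since \<open>deriv_sup_norm\<close> ranges
  over sorted index lists only.\<close>

lemma partial_derivative_commute:
  fixes g :: "real ^ 'd \<Rightarrow> real"
  assumes g: "C_k 2 g"
  shows "partial_derivative j (partial_derivative i g) = partial_derivative i (partial_derivative j g)"
proof (rule ext, rule ccontr)
  fix x
  define a b where "a = partial_derivative j (partial_derivative i g)" and "b = partial_derivative i (partial_derivative j g)"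
  assume "partial_derivative j (partial_derivative i g) x \<noteq> partial_derivative i (partial_derivative j g) x"
  then have e: "\<bar>a x - b x\<bar> / 2 > 0" by (simp add: a_def b_def)
  have cont: "isCont a x" "isCont b x"
    using g by (auto simp: numeral_2_eq_2 a_def b_def continuous_on_eq_continuous_at)
  obtain d1 where d1: "d1 > 0" "\<And>y. dist y x < d1 \<Longrightarrow> dist (a y) (a x) < \<bar>a x - b x\<bar> / 2"
    using cont(1) e unfolding continuous_at_eps_delta by metis
  obtain d2 where d2: "d2 > 0" "\<And>y. dist y x < d2 \<Longrightarrow> dist (b y) (b x) < \<bar>a x - b x\<bar> / 2"
    using cont(2) e unfolding continuous_at_eps_delta by metis
  define h where "h = min d1 d2 / 3"
  have h: "h > 0" "2 * h < d1" "2 * h < d2" using d1(1) d2(1) by (auto simp: h_def min_def)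
  obtain y where y: "norm (y - x) \<le> 2 * h" 
    "g (x + h *\<^sub>R axis i 1 + h *\<^sub>R axis j 1) - g (x + h *\<^sub>R axis i 1) - g (x + h *\<^sub>R axis j 1) + g x = h\<^sup>2 * a y"
    using second_difference_mean_value[OF g h(1), of x i j] unfolding a_def by blast
  obtain z where z: "norm (z - x) \<le> 2 * h" 
    "g (x + h *\<^sub>R axis j 1 + h *\<^sub>R axis i 1) - g (x + h *\<^sub>R axis j 1) - g (x + h *\<^sub>R axis i 1) + g x = h\<^sup>2 * b z"
    using second_difference_mean_value[OF g h(1), of x j i] unfolding b_def by blast
  have "x + h *\<^sub>R axis j 1 + h *\<^sub>R axis i 1 = x + h *\<^sub>R axis i 1 + h *\<^sub>R axis j 1" by (simp add: algebra_simps)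
  then have "h\<^sup>2 * a y = h\<^sup>2 * b z" using y(2) z(2) by (simp only:)
  then have "a y = b z" using h(1) by simp
  moreover have "\<bar>a y - a x\<bar> < \<bar>a x - b x\<bar> / 2" "\<bar>b z - b x\<bar> < \<bar>a x - b x\<bar> / 2"
    using d1(2)[of y] d2(2)[of z] y(1) z(1) h by (auto simp: dist_norm)
  moreover have "\<bar>a x - b x\<bar> \<le> \<bar>a y - a x\<bar> + \<bar>b z - b x\<bar>"
    using abs_triangle_ineq[of "a x - a y" "b z - b x"] \<open>a y = b z\<close> by (simp add: abs_minus_commute)
  ultimately show False by simp
qed

section \<open>Derivative bounds for the two classes of test functions\<close>

lemma deriv_sup_norm_le_1:
  assumes "deriv_sup_norm k g \<le> 1" "length is = k" "sorted is"
  shows "\<bar>foldr partial_derivative is g x\<bar> \<le> 1"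
proof -
  have "ereal \<bar>foldr partial_derivative is g x\<bar> \<le> (SUP x. ereal \<bar>foldr partial_derivative is g x\<bar>)"
    by (rule SUP_upper) simp
  also have "\<dots> \<le> deriv_sup_norm k g"
    unfolding deriv_sup_norm_def by (rule SUP_upper) (use assms in auto)
  finally show ?thesis using assms(1) by (metis ereal_less_eq(3) one_ereal_def order_trans)
qed

text \<open>Commuting partials extend the bounds from sorted to arbitrary indices. A bound 1 on all
  third derivatives makes the second ones Lipschitz in the l1 norm by the mean value inequality
  along the segment.\<close>

lemma d3_test_function:
  fixes g :: "real ^ 'd::{finite,linorder} \<Rightarrow> real"
  assumes g: "C_k 3 g" and bd: "\<And>k. k \<in> {1,2,3} \<Longrightarrow> deriv_sup_norm k g \<le> 1"
  shows "C_k 2 g" and "\<bar>partial_derivative i g x\<bar> \<le> 1"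
    and "\<bar>partial_derivative i (partial_derivative j g) x\<bar> \<le> 1"
    and "\<bar>partial_derivative i (partial_derivative j g) x - partial_derivative i (partial_derivative j g) y\<bar>
        \<le> (\<Sum>l\<in>UNIV. \<bar>x $ l - y $ l\<bar>)"
proof -
  have C2: "C_k 2 (partial_derivative i g)" for i using g by (simp add: eval_nat_numeral)
  show g2: "C_k 2 g"
    using g by (auto simp: eval_nat_numeral intro: differentiable_imp_continuous_on)
  show "\<bar>partial_derivative i g x\<bar> \<le> 1"
    using deriv_sup_norm_le_1[of 1 g "[i]" x] bd by simp
  show "\<bar>partial_derivative i (partial_derivative j g) x\<bar> \<le> 1"
  proof (cases "i \<le> j")
    case True
    then show ?thesis using deriv_sup_norm_le_1[of 2 g "[i, j]" x] bd by simp
  next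
    case False
    then show ?thesis using deriv_sup_norm_le_1[of 2 g "[j, i]" x] bd
      by (simp add: partial_derivative_commute[OF g2, of i j])
  qed
  have third_sorted: "\<bar>partial_derivative a (partial_derivative b (partial_derivative c g)) x\<bar> \<le> 1"
    if "a \<le> b" "b \<le> c" for a b c x
    using deriv_sup_norm_le_1[of 3 g "[a, b, c]" x] bd that by simp
  have swap1: "partial_derivative a (partial_derivative b (partial_derivative c g)) =
      partial_derivative b (partial_derivative a (partial_derivative c g))" for a b c
    by (rule partial_derivative_commute[OF C2])
  have swap2: "partial_derivative a (partial_derivative b (partial_derivative c g)) =
      partial_derivative a (partial_derivative c (partial_derivative b g))" for a b c
    using partial_derivative_commute[OF g2, of b c] by simp
  have third: "\<bar>partial_derivative a (partial_derivative b (partial_derivative c g)) x\<bar> \<le> 1" for a b c x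
  proof -
    \<comment> \<open>Each of the six orders is reached from the sorted one by the adjacent
      transpositions \<open>swap1\<close> and \<open>swap2\<close>.\<close>
    consider "a \<le> b" "b \<le> c" | "a \<le> c" "c \<le> b" | "b \<le> a" "a \<le> c" | "b \<le> c" "c \<le> a" | "c \<le> a" "a \<le> b" | "c \<le> b" "b \<le> a"
      by (meson linear)
    then show ?thesis by cases (metis third_sorted swap1 swap2)+
  qed
  let ?h = "partial_derivative i (partial_derivative j g)"
  have dh: "?h differentiable_on UNIV" using g by (simp add: eval_nat_numeral)
  have "norm (?h (y + 1 *\<^sub>R (x - y)) - ?h (y + 0 *\<^sub>R (x - y))) \<le> (\<Sum>l\<in>UNIV. \<bar>x $ l - y $ l\<bar>) * norm (1 - 0 :: real)"
  proof (rule field_differentiable_bound[of UNIV "\<lambda>t. ?h (y + t *\<^sub>R (x - y))"])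
    show "((\<lambda>t. ?h (y + t *\<^sub>R (x - y))) has_real_derivative
       (\<Sum>l\<in>UNIV. (x - y) $ l * partial_derivative l ?h (y + t *\<^sub>R (x - y)))) (at t within UNIV)" for t
      by (rule has_real_derivative_line[OF dh])
    show "norm (\<Sum>l\<in>UNIV. (x - y) $ l * partial_derivative l ?h (y + t *\<^sub>R (x - y))) \<le> (\<Sum>l\<in>UNIV. \<bar>x $ l - y $ l\<bar>)" for t
      unfolding real_norm_def
      by (intro order_trans[OF sum_abs] sum_mono) (simp add: abs_mult mult_left_le third)
  qed auto
  then show "\<bar>?h x - ?h y\<bar> \<le> (\<Sum>l\<in>UNIV. \<bar>x $ l - y $ l\<bar>)" by simp
qed

lemma has_real_derivative_abs_le:
  assumes deriv: "(f has_real_derivative D) (at t)" and lip: "\<And>s. \<bar>f s - f t\<bar> \<le> K * \<bar>s - t\<bar>"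
  shows "\<bar>D\<bar> \<le> K"
proof -
  have "((\<lambda>s. \<bar>(f s - f t) / (s - t)\<bar>) \<longlongrightarrow> \<bar>D\<bar>) (at t)"
    using deriv by (intro tendsto_rabs) (simp add: has_field_derivative_iff)
  then show ?thesis
  proof (rule tendsto_upperbound)
    show "\<forall>\<^sub>F s in at t. \<bar>(f s - f t) / (s - t)\<bar> \<le> K"
      unfolding eventually_at using lip by (intro exI[of _ 1]) (auto simp: divide_simps)
  qed simp
qed

text \<open>Derivatives inherit the bounds on difference quotients. The Euclidean gradient bound,
  sharper than the entrywise one, is what the Hilbert-Schmidt estimate needs; the bound on second
  derivatives feeds the Gaussian shift estimate.\<close>

lemma d2_test_function:
  fixes g :: "real ^ 'd \<Rightarrow> real"
  assumes g: "C_k 2 g" and lip: "lip_norm g \<le> 1" and M2: "M2 g \<le> 1"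
  shows "norm (gradient g x) \<le> 1" and "\<bar>partial_derivative i g x\<bar> \<le> 1"
    and "\<bar>partial_derivative i (partial_derivative j g) x\<bar> \<le> 1"
proof -
  have d: "g differentiable_on UNIV" "\<And>i. partial_derivative i g differentiable_on UNIV"
    using g by (auto simp: numeral_2_eq_2)
  have L: "\<bar>g x - g y\<bar> \<le> norm (x - y)" for x y
  proof (cases "x = y")
    case False
    then have "ereal (\<bar>g x - g y\<bar> / norm (x - y)) \<le> lip_norm g"
      unfolding lip_norm_def by (intro SUP_upper2[of "(x, y)"]) auto
    then have "ereal (\<bar>g x - g y\<bar> / norm (x - y)) \<le> ereal 1" using lip unfolding one_ereal_def by (rule order_trans)
    then show ?thesis using False by (simp add: divide_simps)
  qed simp
  have L2: "norm (gradient g x - gradient g y) \<le> norm (x - y)" for x y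
  proof (cases "x = y")
    case False
    then have "ereal (norm (gradient g x - gradient g y) / norm (x - y)) \<le> M2 g"
      unfolding M2_def by (intro SUP_upper2[of "(x, y)"]) auto
    then have "ereal (norm (gradient g x - gradient g y) / norm (x - y)) \<le> ereal 1" using M2 unfolding one_ereal_def by (rule order_trans)
    then show ?thesis using False by (simp add: divide_simps)
  qed simp
  show n: "norm (gradient g x) \<le> 1" for x
  proof -
    \<comment> \<open>The direction is the gradient itself: the derivative there is its squared
      norm, while the Lipschitz bound allows only its norm.\<close>
    have "((\<lambda>t. g (x + t *\<^sub>R gradient g x)) has_real_derivative
        (\<Sum>i\<in>UNIV. gradient g x $ i * partial_derivative i g (x + 0 *\<^sub>R gradient g x))) (at 0)"
      by (rule has_real_derivative_line[OF d(1)])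
    then have "\<bar>\<Sum>i\<in>UNIV. gradient g x $ i * partial_derivative i g (x + 0 *\<^sub>R gradient g x)\<bar> \<le> norm (gradient g x)"
    proof (rule has_real_derivative_abs_le)
      show "\<bar>g (x + s *\<^sub>R gradient g x) - g (x + 0 *\<^sub>R gradient g x)\<bar> \<le> norm (gradient g x) * \<bar>s - 0\<bar>" for s
        using L[of "x + s *\<^sub>R gradient g x" x] by (simp add: mult.commute)
    qed
    moreover have "(\<Sum>i\<in>UNIV. gradient g x $ i * partial_derivative i g (x + 0 *\<^sub>R gradient g x)) = (norm (gradient g x))\<^sup>2"
      by (simp add: power2_norm_eq_inner inner_vec_def gradient_def)
    ultimately have "norm (gradient g x) * norm (gradient g x) \<le> norm (gradient g x) * 1"
      by (simp add: power2_eq_square)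
    then show ?thesis
      using mult_left_le_imp_le[of "norm (gradient g x)" "norm (gradient g x)" 1] by (cases "gradient g x = 0") auto
  qed
  show "\<bar>partial_derivative i g x\<bar> \<le> 1"
    using component_le_norm_cart[of "gradient g x" i] n[of x] by (simp add: gradient_def)
  show "\<bar>partial_derivative i (partial_derivative j g) x\<bar> \<le> 1"
  proof -
    have "((\<lambda>t. partial_derivative j g (x + t *\<^sub>R axis i 1)) has_real_derivative
        partial_derivative i (partial_derivative j g) (x + 0 *\<^sub>R axis i 1)) (at 0)"
      by (rule has_real_derivative_axis[OF d(2)])
    then have "\<bar>partial_derivative i (partial_derivative j g) (x + 0 *\<^sub>R axis i 1)\<bar> \<le> 1"
    proof (rule has_real_derivative_abs_le)
      fix s :: real
      let ?v = "s *\<^sub>R axis i 1 :: real ^ 'd"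
      have "\<bar>partial_derivative j g (x + ?v) - partial_derivative j g x\<bar> \<le> norm (gradient g (x + ?v) - gradient g x)"
        using component_le_norm_cart[of "gradient g (x + ?v) - gradient g x" j] by (simp add: gradient_def)
      also have "\<dots> \<le> \<bar>s\<bar>" using L2[of "x + ?v" x] by simp
      finally show "\<bar>partial_derivative j g (x + ?v) - partial_derivative j g (x + 0 *\<^sub>R axis i 1)\<bar> \<le> 1 * \<bar>s - 0\<bar>"
        by simp
    qed
    then show ?thesis by simp
  qed
qed

section \<open>Taylor remainder and the discrete chain rule\<close>

lemma taylor1_lipschitz:
  fixes f f' :: "real \<Rightarrow> real"
  assumes deriv: "\<And>r. (f has_real_derivative f' r) (at r)"
    and lip: "\<And>r. 0 < r \<Longrightarrow> r < 1 \<Longrightarrow> \<bar>f' r - f' 0\<bar> \<le> K * r"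
  shows "\<bar>f 1 - f 0 - f' 0\<bar> \<le> K / 2"
proof -
  have cont: "continuous_on A f" for A
    using deriv by (meson DERIV_isCont continuous_at_imp_continuous_on)
  \<comment> \<open>Without the linear term the derivative is at most \<open>K * r\<close>, whose
    primitive yields \<open>K / 2\<close> at 1.\<close>
  have "norm ((\<lambda>r. f r - r * f' 0) 1 - (\<lambda>r. f r - r * f' 0) 0) \<le> (\<lambda>r. K * r\<^sup>2 / 2) 1 - (\<lambda>r. K * r\<^sup>2 / 2) 0"
  proof (rule differentiable_bound_general[where f' = "\<lambda>r. f' r - f' 0" and \<phi>' = "\<lambda>r. K * r"])
    show "((\<lambda>r. f r - r * f' 0) has_vector_derivative f' r - f' 0) (at r)" for r
      unfolding has_real_derivative_iff_has_vector_derivative[symmetric]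
      by (auto intro!: derivative_eq_intros deriv)
    show "((\<lambda>r. K * r\<^sup>2 / 2) has_vector_derivative K * r) (at r)" for r
      unfolding has_real_derivative_iff_has_vector_derivative[symmetric]
      by (auto intro!: derivative_eq_intros)
    show "norm (f' r - f' 0) \<le> K * r" if "0 < r" "r < 1" for r using lip[OF that] by simp
  qed (auto intro!: continuous_intros cont)
  then show ?thesis by (simp add: algebra_simps)
qed

text \<open>The two values entering the difference are the ends of a segment from \<open>F x\<close>
  to \<open>F\<close> at the flipped point, so a Taylor expansion along it gives the chain rule with
  a quadratic remainder.\<close>

lemma coord_diff_chain_rule:
  fixes F :: "(nat \<Rightarrow> real) \<Rightarrow> real ^ 'd" and G :: "real ^ 'd \<Rightarrow> real"
  assumes deriv: "\<And>x v t. ((\<lambda>t. G (x + t *\<^sub>R v)) has_real_derivative (\<Sum>j\<in>UNIV. v $ j * DG j (x + t *\<^sub>R v))) (at t)"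
    and lip: "\<And>j x y. \<bar>DG j x - DG j y\<bar> \<le> L * (\<Sum>l\<in>UNIV. \<bar>x $ l - y $ l\<bar>)"
    and x: "x \<in> cube n" "k \<in> {1..n}"
  shows "\<bar>coord_diff k (\<lambda>x. G (F x)) x - (\<Sum>j\<in>UNIV. DG j (F x) * coord_diff k (\<lambda>x. F x $ j) x)\<bar>
     \<le> L * (\<Sum>j\<in>UNIV. \<bar>coord_diff k (\<lambda>x. F x $ j) x\<bar>)\<^sup>2"
proof -
  define D where "D j = coord_diff k (\<lambda>x. F x $ j) x" for j
  \<comment> \<open>The displacement of \<open>F\<close> when coordinate \<open>k\<close> changes
    sign, whichever sign it has at \<open>x\<close>.\<close>
  define v where "v = (\<chi> j. - 2 * x k * D j)"
  have xk: "x k = 1 \<or> x k = - 1" using x by (rule cube_coord)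
  then have axk: "\<bar>x k\<bar> = 1" by auto
  define f where "f r = G (F x + r *\<^sub>R v)" for r
  define f' where "f' r = (\<Sum>j\<in>UNIV. v $ j * DG j (F x + r *\<^sub>R v))" for r
  have "\<bar>f 1 - f 0 - f' 0\<bar> \<le> (L * (\<Sum>j\<in>UNIV. \<bar>v $ j\<bar>)\<^sup>2) / 2"
  proof (rule taylor1_lipschitz)
    show "(f has_real_derivative f' r) (at r)" for r unfolding f_def f'_def by (rule deriv)
    fix r :: real assume r: "0 < r"
    have "f' r - f' 0 = (\<Sum>j\<in>UNIV. v $ j * (DG j (F x + r *\<^sub>R v) - DG j (F x)))"
      by (simp add: f'_def right_diff_distrib sum_subtractf)
    also have "\<bar>\<dots>\<bar> \<le> (\<Sum>j\<in>UNIV. \<bar>v $ j\<bar> * (L * (\<Sum>l\<in>UNIV. r * \<bar>v $ l\<bar>)))"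
    proof (intro order_trans[OF sum_abs] sum_mono)
      fix j
      have "\<bar>DG j (F x + r *\<^sub>R v) - DG j (F x)\<bar> \<le> L * (\<Sum>l\<in>UNIV. r * \<bar>v $ l\<bar>)"
        using lip[of j "F x + r *\<^sub>R v" "F x"] r by (simp add: abs_mult)
      then show "\<bar>v $ j * (DG j (F x + r *\<^sub>R v) - DG j (F x))\<bar> \<le> \<bar>v $ j\<bar> * (L * (\<Sum>l\<in>UNIV. r * \<bar>v $ l\<bar>))"
        by (simp add: abs_mult mult_left_mono)
    qed
    also have "\<dots> = L * (\<Sum>j\<in>UNIV. \<bar>v $ j\<bar>)\<^sup>2 * r"
      by (simp add: power2_eq_square mult_ac flip: sum_distrib_left sum_distrib_right)
    finally show "\<bar>f' r - f' 0\<bar> \<le> L * (\<Sum>j\<in>UNIV. \<bar>v $ j\<bar>)\<^sup>2 * r" .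
  qed
  \<comment> \<open>The factor 2 gives 4 when squared; Taylor's 1/2 and the 1/2 in
    \<open>coord_diff\<close> cancel it, leaving the constant \<open>L\<close>.\<close>
  moreover have "(\<Sum>j\<in>UNIV. \<bar>v $ j\<bar>) = 2 * (\<Sum>j\<in>UNIV. \<bar>D j\<bar>)"
    by (simp add: v_def abs_mult axk sum_distrib_left)
  ultimately have T: "\<bar>f 1 - f 0 - f' 0\<bar> \<le> 2 * (L * (\<Sum>j\<in>UNIV. \<bar>D j\<bar>)\<^sup>2)"
    by (simp add: power_mult_distrib)
  have f'0: "f' 0 = - 2 * x k * (\<Sum>j\<in>UNIV. DG j (F x) * D j)"
    by (simp add: f'_def v_def sum_distrib_left sum_negf mult_ac)
  have flip: "F (x(k := - x k)) = F x + v"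
  proof -
    have "F (x(k := - x k)) $ j = (F x + v) $ j" for j
      using xk by (auto simp: v_def D_def coord_diff_def fun_upd_idem)
    then show ?thesis by (simp add: vec_eq_iff)
  qed
  have "coord_diff k (\<lambda>x. G (F x)) x = - x k * (f 1 - f 0) / 2"
  proof -
    have "coord_diff k (\<lambda>x. G (F x)) x = - x k * (G (F (x(k := - x k))) - G (F x)) / 2"
      using xk by (auto simp: coord_diff_def fun_upd_idem)
    then show ?thesis by (simp add: flip f_def)
  qed
  then have "coord_diff k (\<lambda>x. G (F x)) x - (\<Sum>j\<in>UNIV. DG j (F x) * D j) = - x k * (f 1 - f 0 - f' 0) / 2"
    using xk by (elim disjE) (simp_all add: f'0 field_simps)
  then have "\<bar>coord_diff k (\<lambda>x. G (F x)) x - (\<Sum>j\<in>UNIV. DG j (F x) * D j)\<bar> = \<bar>f 1 - f 0 - f' 0\<bar> / 2"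
    by (simp add: abs_mult axk)
  then show ?thesis using T unfolding D_def by simp
qed

context rademacher
begin

definition T :: "real \<Rightarrow> ('d \<Rightarrow> (nat \<Rightarrow> real) \<Rightarrow> real) \<Rightarrow> 'd \<Rightarrow> 'd \<Rightarrow> (nat \<Rightarrow> real) \<Rightarrow> real" where
  "T \<alpha> F i j x = (\<Sum>k=1..n. coord_diff k (F i) x * clark_weight \<alpha> k (F j) x)"

text \<open>The Clark formula is applied to each \<open>F i\<close> against \<open>G i\<close>
  evaluated at the whole vector. The linear part of the chain rule reassembles into
  \<open>T\<close>, and its quadratic remainder times a Clark weight is a triple product controlled
  by third moments.\<close>

lemma rademacher_ibp_bound:
  fixes F :: "'d::finite \<Rightarrow> (nat \<Rightarrow> real) \<Rightarrow> real" and G :: "'d \<Rightarrow> real ^ 'd \<Rightarrow> real"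
  assumes deriv: "\<And>i x v t. ((\<lambda>t. G i (x + t *\<^sub>R v)) has_real_derivative (\<Sum>j\<in>UNIV. v $ j * DG i j (x + t *\<^sub>R v))) (at t)"
    and lip: "\<And>i j x y. \<bar>DG i j x - DG i j y\<bar> \<le> L * (\<Sum>l\<in>UNIV. \<bar>x $ l - y $ l\<bar>)"
    and F: "\<And>i. cube_mean n (F i) = 0" and \<alpha>: "\<alpha> \<in> {0..1}"
  shows "\<bar>cube_mean n (\<lambda>x. \<Sum>i\<in>UNIV. F i x * G i (\<chi> i. F i x)) -
      cube_mean n (\<lambda>x. \<Sum>i\<in>UNIV. \<Sum>j\<in>UNIV. DG i j (\<chi> i. F i x) * T \<alpha> F j i x)\<bar>
    \<le> L * (real CARD('d))\<^sup>2 * (\<Sum>i\<in>UNIV. \<Sum>k=1..n. cube_mean n (\<lambda>x. \<bar>coord_diff k (F i) x\<bar> ^ 3))"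
proof -
  define V where "V x = (\<chi> i. F i x)" for x
  define R where "R k i x = coord_diff k (\<lambda>x. G i (V x)) x - (\<Sum>j\<in>UNIV. DG i j (V x) * coord_diff k (F j) x)" for k i x
  have V: "(\<lambda>x. V x $ j) = F j" for j by (simp add: V_def)
  have R: "\<bar>R k i x\<bar> \<le> L * (\<Sum>j\<in>UNIV. \<bar>coord_diff k (F j) x\<bar>)\<^sup>2" if "x \<in> cube n" "k \<in> {1..n}" for k i x
    using coord_diff_chain_rule[OF deriv lip that, of i V] by (simp add: R_def V)
  \<comment> \<open>The sign of \<open>L\<close> is read off from the Lipschitz hypothesis at the
    all-ones vector and 0.\<close>
  have L: "L \<ge> 0"
  proof -
    have "0 \<le> L * (\<Sum>l\<in>UNIV. \<bar>(1::real ^ 'd) $ l - 0 $ l\<bar>)"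
      by (rule order_trans[OF abs_ge_zero lip])
    then show ?thesis by (simp add: zero_le_mult_iff)
  qed
  have 1: "cube_mean n (\<lambda>x. \<Sum>i\<in>UNIV. F i x * G i (V x)) =
      (\<Sum>i\<in>UNIV. \<Sum>k=1..n. cube_mean n (\<lambda>x. coord_diff k (\<lambda>x. G i (V x)) x * clark_weight \<alpha> k (F i) x))"
    unfolding cube_mean_sum by (intro sum.cong refl cube_mean_ibp F)
  have 2: "cube_mean n (\<lambda>x. \<Sum>i\<in>UNIV. \<Sum>j\<in>UNIV. DG i j (V x) * T \<alpha> F j i x) =
      (\<Sum>i\<in>UNIV. \<Sum>k=1..n. cube_mean n (\<lambda>x. (\<Sum>j\<in>UNIV. DG i j (V x) * coord_diff k (F j) x) * clark_weight \<alpha> k (F i) x))"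
  proof -
    \<comment> \<open>The derivative index \<open>j\<close> sits on the difference and the component
      index \<open>i\<close> on the Clark weight, hence the order \<open>j i\<close> in
      \<open>T\<close>.\<close>
    have "(\<Sum>j\<in>UNIV. DG i j (V x) * T \<alpha> F j i x) =
        (\<Sum>k=1..n. (\<Sum>j\<in>UNIV. DG i j (V x) * coord_diff k (F j) x) * clark_weight \<alpha> k (F i) x)" for i x
      unfolding T_def sum_distrib_left sum_distrib_right
      by (subst sum.swap) (simp add: mult.assoc)
    then show ?thesis by (simp only: cube_mean_sum)
  qed
  have "cube_mean n (\<lambda>x. \<Sum>i\<in>UNIV. F i x * G i (V x)) -
      cube_mean n (\<lambda>x. \<Sum>i\<in>UNIV. \<Sum>j\<in>UNIV. DG i j (V x) * T \<alpha> F j i x) =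
      (\<Sum>i\<in>UNIV. \<Sum>k=1..n. cube_mean n (\<lambda>x. R k i x * clark_weight \<alpha> k (F i) x))"
    unfolding 1 2 R_def by (simp only: sum_subtractf[symmetric] cube_mean_diff[symmetric] left_diff_distrib)
  also have "\<dots> = (\<Sum>k=1..n. cube_mean n (\<lambda>x. \<Sum>i\<in>UNIV. R k i x * clark_weight \<alpha> k (F i) x))"
    by (subst sum.swap) (simp only: cube_mean_sum)
  also have "\<bar>\<dots>\<bar> \<le> (\<Sum>k=1..n. L * ((real CARD('d))\<^sup>2 * (\<Sum>i\<in>UNIV. cube_mean n (\<lambda>x. \<bar>coord_diff k (F i) x\<bar> ^ 3))))"
  proof (intro order_trans[OF sum_abs] sum_mono)
    fix k assume k: "k \<in> {1..n}"
    have "\<bar>cube_mean n (\<lambda>x. \<Sum>i\<in>UNIV. R k i x * clark_weight \<alpha> k (F i) x)\<bar> \<le>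
        cube_mean n (\<lambda>x. L * ((\<Sum>i\<in>UNIV. \<bar>clark_weight \<alpha> k (F i) x\<bar>) * (\<Sum>j\<in>UNIV. \<bar>coord_diff k (F j) x\<bar>)\<^sup>2))"
    proof (rule order_trans[OF cube_mean_abs cube_mean_mono])
      fix x assume x: "x \<in> cube n"
      have "\<bar>\<Sum>i\<in>UNIV. R k i x * clark_weight \<alpha> k (F i) x\<bar> \<le>
          (\<Sum>i\<in>UNIV. (L * (\<Sum>j\<in>UNIV. \<bar>coord_diff k (F j) x\<bar>)\<^sup>2) * \<bar>clark_weight \<alpha> k (F i) x\<bar>)"
        by (intro order_trans[OF sum_abs] sum_mono) (simp add: abs_mult mult_right_mono R[OF x k])
      then show "\<bar>\<Sum>i\<in>UNIV. R k i x * clark_weight \<alpha> k (F i) x\<bar> \<le>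
          L * ((\<Sum>i\<in>UNIV. \<bar>clark_weight \<alpha> k (F i) x\<bar>) * (\<Sum>j\<in>UNIV. \<bar>coord_diff k (F j) x\<bar>)\<^sup>2)"
        by (simp only: sum_distrib_left[symmetric]) (simp add: mult_ac)
    qed
    also have "\<dots> \<le> L * ((real CARD('d))\<^sup>2 * (\<Sum>i\<in>UNIV. cube_mean n (\<lambda>x. \<bar>coord_diff k (F i) x\<bar> ^ 3)))"
      unfolding cube_mean_cmult
      by (intro mult_left_mono[OF cube_mean_triple_le L] cube_mean_clark_weight_le \<alpha> k order_refl)
    finally show "\<bar>cube_mean n (\<lambda>x. \<Sum>i\<in>UNIV. R k i x * clark_weight \<alpha> k (F i) x)\<bar> \<le>
        L * ((real CARD('d))\<^sup>2 * (\<Sum>i\<in>UNIV. cube_mean n (\<lambda>x. \<bar>coord_diff k (F i) x\<bar> ^ 3)))" .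
  qed
  also have "\<dots> = L * (real CARD('d))\<^sup>2 * (\<Sum>i\<in>UNIV. \<Sum>k=1..n. cube_mean n (\<lambda>x. \<bar>coord_diff k (F i) x\<bar> ^ 3))"
    by (subst sum.swap) (simp add: mult_ac sum_distrib_left)
  finally show ?thesis unfolding V_def .
qed

end

section \<open>The interpolation\<close>

lemma (in prob_space) expectation_square_le:
  fixes f :: "'a \<Rightarrow> real"
  assumes "integrable M f" "integrable M (\<lambda>x. (f x)\<^sup>2)"
  shows "(expectation f)\<^sup>2 \<le> expectation (\<lambda>x. (f x)\<^sup>2)"
  using variance_eq[OF assms] variance_positive[of f] by simp

text \<open>The variance of \<open>sqrt (q x)\<close> is nonnegative. This moves the mean inside the
  root, where the error term has it.\<close>

lemma cube_mean_sqrt_le: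
  assumes "\<And>x. 0 \<le> q x"
  shows "cube_mean n (\<lambda>x. sqrt (q x)) \<le> sqrt (cube_mean n q)"
proof (rule real_le_rsqrt)
  let ?m = "cube_mean n (\<lambda>x. sqrt (q x))"
  have "0 \<le> cube_mean n (\<lambda>x. (sqrt (q x) - ?m)\<^sup>2)" by (rule cube_mean_nonneg) simp
  also have "(\<lambda>x. (sqrt (q x) - ?m)\<^sup>2) = (\<lambda>x. q x - (2 * ?m) * sqrt (q x) + ?m\<^sup>2)"
    using assms by (simp add: fun_eq_iff power2_diff)
  also have "cube_mean n \<dots> = cube_mean n q - ?m\<^sup>2"
    unfolding cube_mean_add cube_mean_diff cube_mean_cmult by (simp add: power2_eq_square)
  finally show "?m\<^sup>2 \<le> cube_mean n q" by simp
qed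

text \<open>Cauchy-Schwarz against the constant 1 on the index pairs; this produces the factor d in
  the first bound.\<close>

lemma sum_sum_abs_le_sqrt:
  fixes A :: "'d::finite \<Rightarrow> 'd \<Rightarrow> real"
  shows "(\<Sum>i\<in>UNIV. \<Sum>j\<in>UNIV. \<bar>A i j\<bar>) \<le> real CARD('d) * sqrt (\<Sum>i\<in>UNIV. \<Sum>j\<in>UNIV. (A i j)\<^sup>2)"
proof -
  have "(\<Sum>p\<in>UNIV \<times> UNIV. \<bar>1::real\<bar> * \<bar>A (fst p) (snd p)\<bar>) \<le>
      L2_set (\<lambda>_. 1) (UNIV \<times> UNIV :: ('d \<times> 'd) set) * L2_set (\<lambda>p. A (fst p) (snd p)) (UNIV \<times> UNIV)"
    by (rule L2_set_mult_ineq)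
  moreover have "(\<Sum>i\<in>UNIV. \<Sum>j\<in>UNIV. f i j) = (\<Sum>p\<in>UNIV \<times> UNIV. f (fst p) (snd p))" for f :: "'d \<Rightarrow> 'd \<Rightarrow> real"
    by (simp add: sum.cartesian_product case_prod_unfold)
  ultimately show ?thesis
    by (simp add: L2_set_def real_sqrt_mult)
qed

text \<open>Collects what test functions for \<open>d3\<close> and for \<open>d2\<close> have in
  common, so that the path argument is made once; \<open>C\<close> may still be singular.\<close>

locale interpolation = R: rademacher M n X + G: centered_gaussian N Y C
  for M :: "'a measure" and n X and N :: "'b measure" and Y :: "'b \<Rightarrow> real ^ 'd" and C +
  fixes F :: "'d \<Rightarrow> (nat \<Rightarrow> real) \<Rightarrow> real" and \<alpha> :: real and g :: "real ^ 'd \<Rightarrow> real"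
  assumes F_mean: "\<And>i. cube_mean n (F i) = 0" and \<alpha>: "\<alpha> \<in> {0..1}"
    and g: "C_k 2 g" and g1: "\<And>i x. \<bar>partial_derivative i g x\<bar> \<le> 1"
    and g2: "\<And>i j x. \<bar>partial_derivative i (partial_derivative j g) x\<bar> \<le> 1"
begin

definition V :: "(nat \<Rightarrow> real) \<Rightarrow> real ^ 'd" where "V x = (\<chi> i. F i x)"

text \<open>Here \<open>s\<close> and \<open>c\<close> stand for sin t and cos t. The partial
  derivative of \<open>g\<close> itself is averaged, not that of an average in \<open>x\<close>, so
  each further derivative in \<open>x\<close> brings a factor \<open>s\<close>.\<close>

definition smooth1 :: "real \<Rightarrow> real \<Rightarrow> 'd \<Rightarrow> real ^ 'd \<Rightarrow> real" where
  "smooth1 s c i x = G.expectation (\<lambda>\<omega>. partial_derivative i g (s *\<^sub>R x + c *\<^sub>R Y \<omega>))"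

definition smooth2 :: "real \<Rightarrow> real \<Rightarrow> 'd \<Rightarrow> 'd \<Rightarrow> real ^ 'd \<Rightarrow> real" where
  "smooth2 s c i j x = G.expectation (\<lambda>\<omega>. partial_derivative i (partial_derivative j g) (s *\<^sub>R x + c *\<^sub>R Y \<omega>))"

definition err :: "real" where
  "err = (\<Sum>i\<in>UNIV. \<Sum>j\<in>UNIV. cube_mean n (\<lambda>x. (C $ i $ j - R.T \<alpha> F i j x)\<^sup>2))"

definition rem :: "real" where
  "rem = (\<Sum>i\<in>UNIV. \<Sum>k=1..n. cube_mean n (\<lambda>x. \<bar>coord_diff k (F i) x\<bar> ^ 3))"

lemma g_diff: "g differentiable_on UNIV" "partial_derivative i g differentiable_on UNIV"
  using g by (auto simp: numeral_2_eq_2)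

lemma g_cont: "continuous_on UNIV g" "continuous_on UNIV (partial_derivative i g)"
    "continuous_on UNIV (partial_derivative i (partial_derivative j g))"
  using g g_diff by (auto simp: numeral_2_eq_2 intro: differentiable_imp_continuous_on)

lemmas g_measurable [measurable] = g_cont[THEN borel_measurable_continuous_onI]

lemmas Y_nth_measurable [measurable] = G.integrable_Y_nth[THEN borel_measurable_integrable]

lemma integrable_d1: "integrable N (\<lambda>\<omega>. partial_derivative i g (s *\<^sub>R x + c *\<^sub>R Y \<omega>))"
  by (rule G.integrable_const_bound[of _ 1]) (use g1 in auto)

lemma integrable_d2: "integrable N (\<lambda>\<omega>. partial_derivative i (partial_derivative j g) (s *\<^sub>R x + c *\<^sub>R Y \<omega>))"
  by (rule G.integrable_const_bound[of _ 1]) (use g2 in auto)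

lemma abs_smooth2_le: "\<bar>smooth2 s c i j x\<bar> \<le> 1"
  unfolding smooth2_def
  by (intro order_trans[OF integral_abs_bound] G.integral_le_const integrable_abs integrable_d2) (simp add: g2)

text \<open>Test functions may be unbounded; bounded first partials give linear growth, which the
  first moments of \<open>Y\<close> integrate.\<close>

lemma g_growth: "\<bar>g x\<bar> \<le> \<bar>g 0\<bar> + (\<Sum>i\<in>UNIV. \<bar>x $ i\<bar>)"
proof -
  have "norm (g (0 + 1 *\<^sub>R x) - g (0 + 0 *\<^sub>R x)) \<le> (\<Sum>i\<in>UNIV. \<bar>x $ i\<bar>) * norm (1 - 0 :: real)"
  proof (rule field_differentiable_bound[of UNIV "\<lambda>t. g (0 + t *\<^sub>R x)"])
    show "((\<lambda>t. g (0 + t *\<^sub>R x)) has_real_derivative (\<Sum>i\<in>UNIV. x $ i * partial_derivative i g (0 + t *\<^sub>R x)))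
        (at t within UNIV)" for t
      by (rule has_real_derivative_line[OF g_diff(1)])
    show "norm (\<Sum>i\<in>UNIV. x $ i * partial_derivative i g (0 + t *\<^sub>R x)) \<le> (\<Sum>i\<in>UNIV. \<bar>x $ i\<bar>)" for t
      unfolding real_norm_def
      by (intro order_trans[OF sum_abs] sum_mono) (simp add: abs_mult mult_left_le g1)
  qed auto
  then show ?thesis by simp
qed

lemma integrable_g: "integrable N (\<lambda>\<omega>. g (s *\<^sub>R x + c *\<^sub>R Y \<omega>))"
proof (rule Bochner_Integration.integrable_bound)
  let ?B = "\<lambda>\<omega>. \<bar>g 0\<bar> + (\<Sum>i\<in>UNIV. \<bar>s * x $ i\<bar> + \<bar>c\<bar> * \<bar>Y \<omega> $ i\<bar>)"
  show "integrable N ?B" using G.integrable_Y_nth by simp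
  show "AE \<omega> in N. norm (g (s *\<^sub>R x + c *\<^sub>R Y \<omega>)) \<le> norm (?B \<omega>)"
  proof (rule AE_I2)
    fix \<omega>
    have "\<bar>g (s *\<^sub>R x + c *\<^sub>R Y \<omega>)\<bar> \<le> \<bar>g 0\<bar> + (\<Sum>i\<in>UNIV. \<bar>(s *\<^sub>R x + c *\<^sub>R Y \<omega>) $ i\<bar>)" by (rule g_growth)
    also have "\<dots> \<le> ?B \<omega>"
      by (intro add_left_mono sum_mono) (auto simp: abs_mult[symmetric] intro: abs_triangle_ineq)
    finally show "norm (g (s *\<^sub>R x + c *\<^sub>R Y \<omega>)) \<le> norm (?B \<omega>)" by simp
  qed
qed auto

text \<open>The trigonometric path has velocity coefficients bounded by 1 for all \<open>t\<close>,
  endpoints included, so one integrable function dominates all derivatives. Square-root weights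
  would be singular at an endpoint.\<close>

lemma path_derivative:
  "((\<lambda>t. G.expectation (\<lambda>\<omega>. g (sin t *\<^sub>R x + cos t *\<^sub>R Y \<omega>))) has_real_derivative
    G.expectation (\<lambda>\<omega>. \<Sum>i\<in>UNIV. (cos t * x $ i - sin t * Y \<omega> $ i) * partial_derivative i g (sin t *\<^sub>R x + cos t *\<^sub>R Y \<omega>)))
   (at t)"
proof (rule G.expectation_has_real_derivative[where B = "\<lambda>\<omega>. \<Sum>i\<in>UNIV. \<bar>x $ i\<bar> + \<bar>Y \<omega> $ i\<bar>"])
  fix t \<omega>
  have "((\<lambda>t. sin t *\<^sub>R x + cos t *\<^sub>R Y \<omega>) has_vector_derivative (cos t *\<^sub>R x - sin t *\<^sub>R Y \<omega>)) (at t)"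
    by (auto intro!: derivative_eq_intros)
  from has_real_derivative_along[OF g_diff(1) this]
  show "((\<lambda>t. g (sin t *\<^sub>R x + cos t *\<^sub>R Y \<omega>)) has_real_derivative
      (\<Sum>i\<in>UNIV. (cos t * x $ i - sin t * Y \<omega> $ i) * partial_derivative i g (sin t *\<^sub>R x + cos t *\<^sub>R Y \<omega>))) (at t)"
    by simp
  have le: "\<bar>cos t * x $ i - sin t * Y \<omega> $ i\<bar> \<le> \<bar>x $ i\<bar> + \<bar>Y \<omega> $ i\<bar>" for i
  proof -
    have "\<bar>cos t * x $ i\<bar> \<le> \<bar>x $ i\<bar>" "\<bar>sin t * Y \<omega> $ i\<bar> \<le> \<bar>Y \<omega> $ i\<bar>"
      by (auto simp: abs_mult intro: mult_left_le_one_le)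
    then show ?thesis by linarith
  qed
  show "\<bar>\<Sum>i\<in>UNIV. (cos t * x $ i - sin t * Y \<omega> $ i) * partial_derivative i g (sin t *\<^sub>R x + cos t *\<^sub>R Y \<omega>)\<bar>
      \<le> (\<Sum>i\<in>UNIV. \<bar>x $ i\<bar> + \<bar>Y \<omega> $ i\<bar>)"
    by (intro order_trans[OF sum_abs] sum_mono)
       (simp only: abs_mult, rule order_trans[OF mult_left_le[OF g1 abs_ge_zero] le])
  show "\<And>t. integrable N (\<lambda>\<omega>. g (sin t *\<^sub>R x + cos t *\<^sub>R Y \<omega>))" by (rule integrable_g)
  show "integrable N (\<lambda>\<omega>. \<Sum>i\<in>UNIV. \<bar>x $ i\<bar> + \<bar>Y \<omega> $ i\<bar>)" using G.integrable_Y_nth by simp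
  show "\<And>t. (\<lambda>\<omega>. \<Sum>i\<in>UNIV. (cos t * x $ i - sin t * Y \<omega> $ i) * partial_derivative i g (sin t *\<^sub>R x + cos t *\<^sub>R Y \<omega>)) \<in> borel_measurable N"
    by measurable
qed

text \<open>The factor \<open>c\<close> is the chain rule for \<open>Y\<close> entering as
  \<open>c *\<^sub>R Y\<close>. Unit vectors for \<open>w\<close> serve the path derivative;
  directions chosen through the inverse of \<open>C\<close> serve the Hilbert-Schmidt bound.\<close>

lemma gaussian_ibp_partial:
  "G.expectation (\<lambda>\<omega>. (w \<bullet> Y \<omega>) * partial_derivative j g (s *\<^sub>R x + c *\<^sub>R Y \<omega>)) =
     c * (\<Sum>l\<in>UNIV. (C *v w) $ l * smooth2 s c l j x)"
  "integrable N (\<lambda>\<omega>. (w \<bullet> Y \<omega>) * partial_derivative j g (s *\<^sub>R x + c *\<^sub>R Y \<omega>))"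
proof -
  let ?h = "\<lambda>y. partial_derivative j g (s *\<^sub>R x + c *\<^sub>R y)"
  let ?dh = "\<lambda>y. \<Sum>l\<in>UNIV. (c * (C *v w) $ l) * partial_derivative l (partial_derivative j g) (s *\<^sub>R x + c *\<^sub>R y)"
  have d: "((\<lambda>t. ?h (y + t *\<^sub>R (C *v w))) has_real_derivative ?dh (y + t *\<^sub>R (C *v w))) (at t)" for y t
  proof -
    have "((\<lambda>t. s *\<^sub>R x + c *\<^sub>R (y + t *\<^sub>R (C *v w))) has_vector_derivative c *\<^sub>R (C *v w)) (at t)"
      by (auto intro!: derivative_eq_intros simp: has_vector_derivative_def)
    from has_real_derivative_along[OF g_diff(2) this] show ?thesis by simp
  qed
  have c1: "continuous_on UNIV ?h" by (intro continuous_on_compose2[OF g_cont(2)] continuous_intros) auto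
  have c2: "continuous_on UNIV ?dh" by (intro continuous_on_compose2[OF g_cont(3)] continuous_intros) auto
  have b: "\<bar>?dh y\<bar> \<le> (\<Sum>l\<in>UNIV. \<bar>c * (C *v w) $ l\<bar>)" for y
    by (intro order_trans[OF sum_abs] sum_mono) (metis abs_ge_zero abs_mult g2 mult.right_neutral mult_left_mono)
  note ibp = G.gaussian_ibp[OF d c1 c2 g1 b]
  show "integrable N (\<lambda>\<omega>. (w \<bullet> Y \<omega>) * partial_derivative j g (s *\<^sub>R x + c *\<^sub>R Y \<omega>))" by (rule ibp(2))
  show "G.expectation (\<lambda>\<omega>. (w \<bullet> Y \<omega>) * partial_derivative j g (s *\<^sub>R x + c *\<^sub>R Y \<omega>)) =
     c * (\<Sum>l\<in>UNIV. (C *v w) $ l * smooth2 s c l j x)"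
    unfolding ibp(1) by (simp add: integrable_d2 smooth2_def sum_distrib_left mult.assoc)
qed

lemma path_derivative_split:
  "G.expectation (\<lambda>\<omega>. \<Sum>i\<in>UNIV. (c * x $ i - s * Y \<omega> $ i) * partial_derivative i g (s *\<^sub>R x + c *\<^sub>R Y \<omega>)) =
     c * (\<Sum>i\<in>UNIV. x $ i * smooth1 s c i x) - s * c * (\<Sum>i\<in>UNIV. \<Sum>j\<in>UNIV. C $ j $ i * smooth2 s c j i x)"
proof -
  have 1: "integrable N (\<lambda>\<omega>. Y \<omega> $ i * partial_derivative i g (s *\<^sub>R x + c *\<^sub>R Y \<omega>))" for i
    using gaussian_ibp_partial(2)[of "axis i 1" i s x c] by (simp add: inner_axis')
  have 2: "G.expectation (\<lambda>\<omega>. Y \<omega> $ i * partial_derivative i g (s *\<^sub>R x + c *\<^sub>R Y \<omega>)) =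
      c * (\<Sum>j\<in>UNIV. C $ j $ i * smooth2 s c j i x)" for i
    using gaussian_ibp_partial(1)[of "axis i 1" i s x c]
    by (simp add: inner_axis' matrix_vector_mult_basis column_def)
  have "(\<lambda>\<omega>. \<Sum>i\<in>UNIV. (c * x $ i - s * Y \<omega> $ i) * partial_derivative i g (s *\<^sub>R x + c *\<^sub>R Y \<omega>)) =
      (\<lambda>\<omega>. \<Sum>i\<in>UNIV. (c * x $ i) * partial_derivative i g (s *\<^sub>R x + c *\<^sub>R Y \<omega>) -
         s * (Y \<omega> $ i * partial_derivative i g (s *\<^sub>R x + c *\<^sub>R Y \<omega>)))"
    by (simp add: algebra_simps)
  then have "G.expectation (\<lambda>\<omega>. \<Sum>i\<in>UNIV. (c * x $ i - s * Y \<omega> $ i) * partial_derivative i g (s *\<^sub>R x + c *\<^sub>R Y \<omega>)) =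
      (\<Sum>i\<in>UNIV. (c * x $ i) * smooth1 s c i x - s * (c * (\<Sum>j\<in>UNIV. C $ j $ i * smooth2 s c j i x)))"
    by (simp add: 1 2 integrable_d1 smooth1_def)
  then show ?thesis by (simp add: sum_subtractf sum_distrib_left mult.assoc)
qed

lemma smooth1_derivative:
  "((\<lambda>t. smooth1 s c i (x + t *\<^sub>R v)) has_real_derivative
     (\<Sum>j\<in>UNIV. v $ j * (s * smooth2 s c j i (x + t *\<^sub>R v)))) (at t)"
proof -
  let ?f' = "\<lambda>t \<omega>. \<Sum>j\<in>UNIV. (s * v $ j) * partial_derivative j (partial_derivative i g) (s *\<^sub>R (x + t *\<^sub>R v) + c *\<^sub>R Y \<omega>)"
  have "((\<lambda>t. smooth1 s c i (x + t *\<^sub>R v)) has_real_derivative G.expectation (?f' t)) (at t)"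
    unfolding smooth1_def
  proof (rule G.expectation_has_real_derivative[where B = "\<lambda>_. \<Sum>j\<in>UNIV. \<bar>s * v $ j\<bar>"])
    fix t \<omega>
    have "((\<lambda>t. s *\<^sub>R (x + t *\<^sub>R v) + c *\<^sub>R Y \<omega>) has_vector_derivative s *\<^sub>R v) (at t)"
      by (auto intro!: derivative_eq_intros simp: has_vector_derivative_def)
    from has_real_derivative_along[OF g_diff(2) this]
    show "((\<lambda>t. partial_derivative i g (s *\<^sub>R (x + t *\<^sub>R v) + c *\<^sub>R Y \<omega>)) has_real_derivative ?f' t \<omega>) (at t)" by simp
    show "\<bar>?f' t \<omega>\<bar> \<le> (\<Sum>j\<in>UNIV. \<bar>s * v $ j\<bar>)"
      by (intro order_trans[OF sum_abs] sum_mono) (metis abs_ge_zero abs_mult g2 mult.right_neutral mult_left_mono)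
  qed (auto intro: integrable_d1)
  moreover have "G.expectation (?f' t) = (\<Sum>j\<in>UNIV. v $ j * (s * smooth2 s c j i (x + t *\<^sub>R v)))"
    by (simp add: smooth2_def integrable_d2 mult_ac)
  ultimately show ?thesis by simp
qed

definition dpath :: "real \<Rightarrow> real" where
  "dpath t = cube_mean n (\<lambda>x. G.expectation (\<lambda>\<omega>.
     \<Sum>i\<in>UNIV. (cos t * V x $ i - sin t * Y \<omega> $ i) * partial_derivative i g (sin t *\<^sub>R V x + cos t *\<^sub>R Y \<omega>)))"

lemma path_has_derivative:
  "((\<lambda>t. cube_mean n (\<lambda>x. G.expectation (\<lambda>\<omega>. g (sin t *\<^sub>R V x + cos t *\<^sub>R Y \<omega>)))) has_real_derivative dpath t) (at t)"
  unfolding cube_mean_def dpath_def by (rule DERIV_cdivide, rule DERIV_sum, rule path_derivative)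

text \<open>Isolates the two constants in which the distances differ: \<open>L\<close>, the
  Lipschitz constant of the averaged Hessian, and \<open>K\<close>, the norm of its pairing with
  matrices in Hilbert-Schmidt norm.\<close>

lemma abs_dpath_le:
  assumes s: "0 \<le> sin t" and c: "0 \<le> cos t"
    and lip: "\<And>i j x y. \<bar>smooth2 (sin t) (cos t) i j x - smooth2 (sin t) (cos t) i j y\<bar> \<le> L * (\<Sum>l\<in>UNIV. \<bar>x $ l - y $ l\<bar>)"
    and HS: "\<And>x A. \<bar>\<Sum>i\<in>UNIV. \<Sum>j\<in>UNIV. smooth2 (sin t) (cos t) i j x * A i j\<bar> \<le> K * sqrt (\<Sum>i\<in>UNIV. \<Sum>j\<in>UNIV. (A i j)\<^sup>2)"
    and K: "0 \<le> K"
  shows "\<bar>dpath t\<bar> \<le> sin t * cos t * (K * sqrt err) + cos t * (sin t * L * (real CARD('d))\<^sup>2 * rem)"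
proof -
  let ?s = "sin t" and ?c = "cos t"
  let ?H = "smooth2 ?s ?c"
  let ?A = "\<lambda>i j x. R.T \<alpha> F i j x - C $ i $ j"
  let ?g = "cube_mean n (\<lambda>x. \<Sum>i\<in>UNIV. F i x * smooth1 ?s ?c i (\<chi> i. F i x))"
  let ?t = "cube_mean n (\<lambda>x. \<Sum>i\<in>UNIV. \<Sum>j\<in>UNIV. (?s * ?H j i (\<chi> i. F i x)) * R.T \<alpha> F j i x)"
  let ?q = "cube_mean n (\<lambda>x. \<Sum>i\<in>UNIV. \<Sum>j\<in>UNIV. C $ j $ i * ?H j i (\<chi> i. F i x))"
  have "dpath t = ?c * ?g - ?s * ?c * ?q"
    unfolding dpath_def path_derivative_split cube_mean_diff cube_mean_cmult by (simp add: V_def)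
  \<comment> \<open>Adding and subtracting \<open>?t\<close> separates the Clark remainder from the
    pairing of the Hessian with the difference of \<open>T\<close> and \<open>C\<close>.\<close>
  also have "\<dots> = ?c * (?g - ?t) + ?s * ?c * cube_mean n (\<lambda>x. \<Sum>i\<in>UNIV. \<Sum>j\<in>UNIV. ?H i j (\<chi> i. F i x) * ?A i j x)"
  proof -
    have "?t - ?s * ?q = cube_mean n (\<lambda>x. ?s * (\<Sum>i\<in>UNIV. \<Sum>j\<in>UNIV. ?H j i (\<chi> i. F i x) * ?A j i x))"
      unfolding cube_mean_cmult[symmetric] cube_mean_diff[symmetric]
    proof (rule cube_mean_cong)
      fix x
      show "(\<Sum>i\<in>UNIV. \<Sum>j\<in>UNIV. (?s * ?H j i (\<chi> i. F i x)) * R.T \<alpha> F j i x) -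
          ?s * (\<Sum>i\<in>UNIV. \<Sum>j\<in>UNIV. C $ j $ i * ?H j i (\<chi> i. F i x)) =
          ?s * (\<Sum>i\<in>UNIV. \<Sum>j\<in>UNIV. ?H j i (\<chi> i. F i x) * ?A j i x)"
        unfolding sum_distrib_left sum_subtractf[symmetric]
        by (intro sum.cong refl) (simp add: algebra_simps)
    qed
    also have "\<dots> = ?s * cube_mean n (\<lambda>x. \<Sum>i\<in>UNIV. \<Sum>j\<in>UNIV. ?H i j (\<chi> i. F i x) * ?A i j x)"
      unfolding cube_mean_cmult by (subst sum.swap) simp
    finally have "?s * cube_mean n (\<lambda>x. \<Sum>i\<in>UNIV. \<Sum>j\<in>UNIV. ?H i j (\<chi> i. F i x) * ?A i j x) = ?t - ?s * ?q" by simp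
    moreover have "c * g - s * c * q = c * (g - t) + s * c * z" if "s * z = t - s * q" for s c g q t z :: real
      using arg_cong[OF that, of "\<lambda>x. c * x"] by (simp add: algebra_simps)
    ultimately show ?thesis by blast
  qed
  finally have dpath: "dpath t = ?c * (?g - ?t) +
      ?s * ?c * cube_mean n (\<lambda>x. \<Sum>i\<in>UNIV. \<Sum>j\<in>UNIV. ?H i j (\<chi> i. F i x) * ?A i j x)" .
  have "\<bar>dpath t\<bar> \<le> ?c * (?s * L * (real CARD('d))\<^sup>2 * rem) + ?s * ?c * (K * sqrt err)"
    unfolding dpath
  proof (rule order_trans[OF abs_triangle_ineq add_mono])
    have "\<bar>?g - ?t\<bar> \<le> ?s * L * (real CARD('d))\<^sup>2 * rem"
      unfolding rem_def
    proof (rule R.rademacher_ibp_bound[OF smooth1_derivative _ F_mean \<alpha>])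
      fix i j :: 'd and x y
      have "?s * \<bar>?H j i x - ?H j i y\<bar> \<le> ?s * (L * (\<Sum>l\<in>UNIV. \<bar>x $ l - y $ l\<bar>))"
        by (rule mult_left_mono[OF lip s])
      then show "\<bar>?s * ?H j i x - ?s * ?H j i y\<bar> \<le> ?s * L * (\<Sum>l\<in>UNIV. \<bar>x $ l - y $ l\<bar>)"
        using s by (simp add: abs_mult mult.assoc flip: right_diff_distrib)
    qed
    then show "\<bar>?c * (?g - ?t)\<bar> \<le> ?c * (?s * L * (real CARD('d))\<^sup>2 * rem)"
      using c by (simp only: abs_mult abs_of_nonneg mult_left_mono)
    have "\<bar>cube_mean n (\<lambda>x. \<Sum>i\<in>UNIV. \<Sum>j\<in>UNIV. ?H i j (\<chi> i. F i x) * ?A i j x)\<bar> \<le>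
        cube_mean n (\<lambda>x. K * sqrt (\<Sum>i\<in>UNIV. \<Sum>j\<in>UNIV. (?A i j x)\<^sup>2))"
      by (rule order_trans[OF cube_mean_abs cube_mean_mono]) (rule HS)
    also have "\<dots> \<le> K * sqrt (cube_mean n (\<lambda>x. \<Sum>i\<in>UNIV. \<Sum>j\<in>UNIV. (?A i j x)\<^sup>2))"
      unfolding cube_mean_cmult by (intro mult_left_mono K cube_mean_sqrt_le sum_nonneg) auto
    also have "cube_mean n (\<lambda>x. \<Sum>i\<in>UNIV. \<Sum>j\<in>UNIV. (?A i j x)\<^sup>2) = err"
      by (simp only: cube_mean_sum err_def power2_commute[of "C $ i $ j" for i j])
    finally show "\<bar>?s * ?c * cube_mean n (\<lambda>x. \<Sum>i\<in>UNIV. \<Sum>j\<in>UNIV. ?H i j (\<chi> i. F i x) * ?A i j x)\<bar> \<le> ?s * ?c * (K * sqrt err)"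
      using s c by (simp only: abs_mult abs_of_nonneg mult_nonneg_nonneg mult_left_mono)
  qed
  also have "\<dots> = ?s * ?c * (K * sqrt err) + ?c * (?s * L * (real CARD('d))\<^sup>2 * rem)"
    by (rule add.commute)
  finally show ?thesis .
qed

text \<open>The path joins \<open>g (Y)\<close> at 0 to \<open>g (F)\<close> at pi/2. Supplying a
  primitive \<open>B\<close> of the bound replaces the integral over \<open>t\<close> by a mean
  value inequality, and the bound is asked only on the open interval, where cos t is
  positive.\<close>

lemma distance_le:
  assumes B: "\<And>t. (B has_real_derivative B' t) (at t)"
    and bound: "\<And>t. 0 < t \<Longrightarrow> t < pi / 2 \<Longrightarrow> \<bar>dpath t\<bar> \<le> B' t"
  shows "\<bar>cube_mean n (\<lambda>x. g (V x)) - G.expectation (\<lambda>\<omega>. g (Y \<omega>))\<bar> \<le> B (pi / 2) - B 0"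
proof -
  let ?f = "\<lambda>t. cube_mean n (\<lambda>x. G.expectation (\<lambda>\<omega>. g (sin t *\<^sub>R V x + cos t *\<^sub>R Y \<omega>)))"
  have "norm (?f (pi / 2) - ?f 0) \<le> B (pi / 2) - B 0"
  proof (rule differentiable_bound_general)
    show "continuous_on {0..pi / 2} ?f" "continuous_on {0..pi / 2} B"
      using path_has_derivative B by (meson DERIV_isCont continuous_at_imp_continuous_on)+
    show "(?f has_vector_derivative dpath t) (at t)" "(B has_vector_derivative B' t) (at t)" for t
      using path_has_derivative B by (simp_all flip: has_real_derivative_iff_has_vector_derivative)
  qed (use bound in auto)
  then show ?thesis by (simp add: G.prob_space)
qed

lemma d3_distance_le:
  assumes lip: "\<And>i j x y. \<bar>partial_derivative i (partial_derivative j g) x - partial_derivative i (partial_derivative j g) y\<bar>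
        \<le> (\<Sum>l\<in>UNIV. \<bar>x $ l - y $ l\<bar>)"
  shows "\<bar>cube_mean n (\<lambda>x. g (V x)) - G.expectation (\<lambda>\<omega>. g (Y \<omega>))\<bar> \<le>
    real CARD('d) / 2 * sqrt err + (real CARD('d))\<^sup>2 / 3 * rem"
proof -
  let ?d = "real CARD('d)"
  \<comment> \<open>Here \<open>L = sin t\<close> and \<open>K\<close> is the dimension, so the
    primitives of sin t cos t and sin^2 t cos t appear, with increments 1/2 and 1/3.\<close>
  define B where "B t = ?d * sqrt err * ((sin t)\<^sup>2 / 2) + ?d\<^sup>2 * rem * (sin t ^ 3 / 3)" for t
  have "\<bar>cube_mean n (\<lambda>x. g (V x)) - G.expectation (\<lambda>\<omega>. g (Y \<omega>))\<bar> \<le> B (pi / 2) - B 0"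
  proof (rule distance_le)
    show "(B has_real_derivative sin t * cos t * (?d * sqrt err) + cos t * (sin t * sin t * ?d\<^sup>2 * rem)) (at t)" for t
      unfolding B_def by (auto intro!: derivative_eq_intros simp: power2_eq_square)
    fix t :: real assume "0 < t" "t < pi / 2"
    then have s: "0 \<le> sin t" and c: "0 \<le> cos t" by (auto intro!: sin_ge_zero cos_ge_zero)
    show "\<bar>dpath t\<bar> \<le> sin t * cos t * (?d * sqrt err) + cos t * (sin t * sin t * ?d\<^sup>2 * rem)"
    proof (rule abs_dpath_le[OF s c])
      fix i j x y
      let ?h = "partial_derivative i (partial_derivative j g)"
      have "\<bar>smooth2 (sin t) (cos t) i j x - smooth2 (sin t) (cos t) i j y\<bar> =
          \<bar>G.expectation (\<lambda>\<omega>. ?h (sin t *\<^sub>R x + cos t *\<^sub>R Y \<omega>) - ?h (sin t *\<^sub>R y + cos t *\<^sub>R Y \<omega>))\<bar>"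
        unfolding smooth2_def by (simp add: integrable_d2)
      also have "\<dots> \<le> sin t * (\<Sum>l\<in>UNIV. \<bar>x $ l - y $ l\<bar>)"
      proof (intro order_trans[OF integral_abs_bound] G.integral_le_const)
        show "integrable N (\<lambda>\<omega>. \<bar>?h (sin t *\<^sub>R x + cos t *\<^sub>R Y \<omega>) - ?h (sin t *\<^sub>R y + cos t *\<^sub>R Y \<omega>)\<bar>)"
          by (intro integrable_abs Bochner_Integration.integrable_diff integrable_d2)
        show "AE \<omega> in N. \<bar>?h (sin t *\<^sub>R x + cos t *\<^sub>R Y \<omega>) - ?h (sin t *\<^sub>R y + cos t *\<^sub>R Y \<omega>)\<bar> \<le> sin t * (\<Sum>l\<in>UNIV. \<bar>x $ l - y $ l\<bar>)"
        proof (rule AE_I2)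
          fix \<omega>
          have "(\<Sum>l\<in>UNIV. \<bar>(sin t *\<^sub>R x + cos t *\<^sub>R Y \<omega>) $ l - (sin t *\<^sub>R y + cos t *\<^sub>R Y \<omega>) $ l\<bar>) =
              sin t * (\<Sum>l\<in>UNIV. \<bar>x $ l - y $ l\<bar>)"
            using s by (simp add: sum_distrib_left abs_mult flip: right_diff_distrib)
          then show "\<bar>?h (sin t *\<^sub>R x + cos t *\<^sub>R Y \<omega>) - ?h (sin t *\<^sub>R y + cos t *\<^sub>R Y \<omega>)\<bar> \<le> sin t * (\<Sum>l\<in>UNIV. \<bar>x $ l - y $ l\<bar>)"
            using lip by metis
        qed
      qed
      finally show "\<bar>smooth2 (sin t) (cos t) i j x - smooth2 (sin t) (cos t) i j y\<bar> \<le> sin t * (\<Sum>l\<in>UNIV. \<bar>x $ l - y $ l\<bar>)" .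
    next
      fix x and A :: "'d \<Rightarrow> 'd \<Rightarrow> real"
      have "\<bar>\<Sum>i\<in>UNIV. \<Sum>j\<in>UNIV. smooth2 (sin t) (cos t) i j x * A i j\<bar> \<le> (\<Sum>i\<in>UNIV. \<Sum>j\<in>UNIV. \<bar>A i j\<bar>)"
        by (intro order_trans[OF sum_abs] sum_mono)
           (simp add: abs_mult mult_left_le_one_le abs_smooth2_le)
      also have "\<dots> \<le> ?d * sqrt (\<Sum>i\<in>UNIV. \<Sum>j\<in>UNIV. (A i j)\<^sup>2)" by (rule sum_sum_abs_le_sqrt)
      finally show "\<bar>\<Sum>i\<in>UNIV. \<Sum>j\<in>UNIV. smooth2 (sin t) (cos t) i j x * A i j\<bar> \<le> ?d * sqrt (\<Sum>i\<in>UNIV. \<Sum>j\<in>UNIV. (A i j)\<^sup>2)" .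
    qed simp
  qed
  then show ?thesis by (simp add: B_def)
qed

end

section \<open>Positive definite covariance: moving a derivative onto the Gaussian\<close>

lemma positive_definite_matrix_inv:
  assumes "positive_definite C"
  shows "C *v (matrix_inv C *v x) = x"
proof -
  have "C *v y = 0 \<longrightarrow> y = 0" for y
    using assms unfolding positive_definite_def by (metis inner_zero_right less_irrefl)
  then have "invertible C"
    by (simp add: invertible_left_inverse matrix_left_invertible_ker)
  then have "C ** matrix_inv C = mat 1"
    unfolding invertible_def matrix_inv_def by (rule someI2_ex) simp
  then show ?thesis by (simp add: matrix_vector_mul_assoc)
qed

lemma inner_matrix_le_onorm:
  fixes A :: "real ^ 'd ^ 'd"
  shows "x \<bullet> (A *v x) \<le> onorm ((*v) A) * (norm x)\<^sup>2"
proof -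
  have "x \<bullet> (A *v x) \<le> norm x * norm (A *v x)" by (rule norm_cauchy_schwarz)
  also have "\<dots> \<le> norm x * (onorm ((*v) A) * norm x)"
    by (intro mult_left_mono onorm matrix_vector_mul_bounded_linear) simp
  finally show ?thesis by (simp add: power2_eq_square mult_ac)
qed

text \<open>A unit vector is recovered by applying the inverse and then \<open>C\<close>. The
  inequality serves to pass from the constants that the argument gives to the stated ones.\<close>

lemma positive_definite_onorm_mult_ge_1:
  fixes C :: "real ^ 'd ^ 'd"
  assumes "positive_definite C"
  shows "1 \<le> onorm ((*v) (matrix_inv C)) * onorm ((*v) C)"
proof -
  let ?x = "axis undefined 1 :: real ^ 'd"
  have "norm (C *v (matrix_inv C *v ?x)) \<le> onorm ((*v) C) * norm (matrix_inv C *v ?x)"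
    by (intro onorm matrix_vector_mul_bounded_linear)
  also have "\<dots> \<le> onorm ((*v) C) * (onorm ((*v) (matrix_inv C)) * norm ?x)"
    by (intro mult_left_mono onorm onorm_pos_le matrix_vector_mul_bounded_linear)
  finally show ?thesis by (simp add: positive_definite_matrix_inv[OF assms] mult.commute)
qed

context interpolation
begin

text \<open>One Hessian derivative is moved onto the Gaussian for all columns of \<open>A\<close> at
  once, leaving \<open>u \<omega> \<bullet> gradient g\<close>. As the gradient has norm at most 1,
  only the mean norm of \<open>u\<close> matters; its second moment is a quadratic form of the
  inverse of \<open>C\<close> in the columns of \<open>A\<close>. Treating the matrix as a whole
  avoids any factor of the dimension.\<close>

lemma smooth2_HS_bound:
  assumes C: "positive_definite C" and grad: "\<And>x. norm (gradient g x) \<le> 1" and c: "c > 0"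
  shows "\<bar>\<Sum>i\<in>UNIV. \<Sum>j\<in>UNIV. smooth2 s c i j x * A i j\<bar> \<le>
    (sqrt (onorm ((*v) (matrix_inv C))) / c) * sqrt (\<Sum>i\<in>UNIV. \<Sum>j\<in>UNIV. (A i j)\<^sup>2)"
proof -
  let ?\<kappa> = "onorm ((*v) (matrix_inv C))"
  \<comment> \<open>Chosen so that \<open>C *v a j\<close> is column \<open>j\<close> of
    \<open>A\<close>: integration by parts in direction \<open>a j\<close> then returns this
    column.\<close>
  define a where "a j = matrix_inv C *v (\<chi> i. A i j)" for j
  have Ca: "C *v a j = (\<chi> i. A i j)" for j unfolding a_def by (rule positive_definite_matrix_inv[OF C])
  define u where "u \<omega> = (\<chi> j. a j \<bullet> Y \<omega>)" for \<omega>
  have u_meas[measurable]: "u \<in> borel_measurable N"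
    unfolding u_def
    by (subst borel_measurable_euclidean_space) (auto simp: Basis_vec_def inner_axis)
  have ug: "u \<omega> \<bullet> gradient g y = (\<Sum>j\<in>UNIV. (a j \<bullet> Y \<omega>) * partial_derivative j g y)" for \<omega> y
    by (simp add: u_def inner_vec_def gradient_def)
  have "c * (\<Sum>i\<in>UNIV. \<Sum>j\<in>UNIV. smooth2 s c i j x * A i j) = (\<Sum>j\<in>UNIV. c * (\<Sum>i\<in>UNIV. (C *v a j) $ i * smooth2 s c i j x))"
    unfolding Ca sum_distrib_left by (subst sum.swap) (simp add: mult_ac)
  also have "\<dots> = G.expectation (\<lambda>\<omega>. \<Sum>j\<in>UNIV. (a j \<bullet> Y \<omega>) * partial_derivative j g (s *\<^sub>R x + c *\<^sub>R Y \<omega>))"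
    by (simp add: gaussian_ibp_partial)
  also have "\<dots> = G.expectation (\<lambda>\<omega>. u \<omega> \<bullet> gradient g (s *\<^sub>R x + c *\<^sub>R Y \<omega>))"
    unfolding ug ..
  finally have eq: "c * (\<Sum>i\<in>UNIV. \<Sum>j\<in>UNIV. smooth2 s c i j x * A i j) =
      G.expectation (\<lambda>\<omega>. u \<omega> \<bullet> gradient g (s *\<^sub>R x + c *\<^sub>R Y \<omega>))" .
  have "\<bar>c * (\<Sum>i\<in>UNIV. \<Sum>j\<in>UNIV. smooth2 s c i j x * A i j)\<bar> \<le> G.expectation (\<lambda>\<omega>. norm (u \<omega>))"
    unfolding eq
  proof (intro order_trans[OF integral_abs_bound] integral_mono integrable_abs)
    show "integrable N (\<lambda>\<omega>. u \<omega> \<bullet> gradient g (s *\<^sub>R x + c *\<^sub>R Y \<omega>))"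
      unfolding ug by (simp add: gaussian_ibp_partial)
    show "integrable N (\<lambda>\<omega>. norm (u \<omega>))"
    proof (rule Bochner_Integration.integrable_bound)
      show "integrable N (\<lambda>\<omega>. \<Sum>j\<in>UNIV. \<bar>a j \<bullet> Y \<omega>\<bar>)" by (simp add: G.integrable_inner_Y)
      show "AE \<omega> in N. norm (norm (u \<omega>)) \<le> norm (\<Sum>j\<in>UNIV. \<bar>a j \<bullet> Y \<omega>\<bar>)"
        using norm_le_l1_cart[of "u _"] by (intro AE_I2) (simp add: u_def)
    qed auto
    show "\<bar>u \<omega> \<bullet> gradient g (s *\<^sub>R x + c *\<^sub>R Y \<omega>)\<bar> \<le> norm (u \<omega>)" for \<omega>
      using grad by (intro order_trans[OF Cauchy_Schwarz_ineq2]) (simp add: mult_left_le)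
  qed
  also have "\<dots> \<le> sqrt (?\<kappa> * (\<Sum>i\<in>UNIV. \<Sum>j\<in>UNIV. (A i j)\<^sup>2))"
  proof (rule real_le_rsqrt)
    have sq: "(norm (u \<omega>))\<^sup>2 = (\<Sum>j\<in>UNIV. (a j \<bullet> Y \<omega>) * (a j \<bullet> Y \<omega>))" for \<omega>
      by (simp add: power2_norm_eq_inner u_def inner_vec_def)
    have "(G.expectation (\<lambda>\<omega>. norm (u \<omega>)))\<^sup>2 \<le> G.expectation (\<lambda>\<omega>. (norm (u \<omega>))\<^sup>2)"
    proof (rule G.expectation_square_le)
      show i2: "integrable N (\<lambda>\<omega>. (norm (u \<omega>))\<^sup>2)" unfolding sq by (simp add: G.integrable_inner_Y_mult)
      show "integrable N (\<lambda>\<omega>. norm (u \<omega>))"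
        by (rule G.square_integrable_imp_integrable[OF _ i2]) simp
    qed
    also have "\<dots> = (\<Sum>j\<in>UNIV. a j \<bullet> (C *v a j))"
      unfolding sq by (simp add: G.integrable_inner_Y_mult G.expectation_inner_Y_mult)
    also have "\<dots> \<le> (\<Sum>j\<in>UNIV. ?\<kappa> * (norm (\<chi> i. A i j))\<^sup>2)"
    proof (rule sum_mono)
      fix j
      have "a j \<bullet> (C *v a j) = (\<chi> i. A i j) \<bullet> (matrix_inv C *v (\<chi> i. A i j))"
        unfolding Ca by (simp only: a_def inner_commute)
      then show "a j \<bullet> (C *v a j) \<le> ?\<kappa> * (norm (\<chi> i. A i j))\<^sup>2" by (simp add: inner_matrix_le_onorm)
    qed
    also have "\<dots> = ?\<kappa> * (\<Sum>i\<in>UNIV. \<Sum>j\<in>UNIV. (A i j)\<^sup>2)"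
    proof -
      have "(norm (\<chi> i. A i j))\<^sup>2 = (\<Sum>i\<in>UNIV. (A i j)\<^sup>2)" for j
        unfolding power2_norm_eq_inner by (simp add: inner_vec_def power2_eq_square)
      then show ?thesis unfolding sum_distrib_left by (simp only:) (subst sum.swap, simp add: sum_distrib_left)
    qed
    finally show "(G.expectation (\<lambda>\<omega>. norm (u \<omega>)))\<^sup>2 \<le> ?\<kappa> * (\<Sum>i\<in>UNIV. \<Sum>j\<in>UNIV. (A i j)\<^sup>2)" .
  qed
  finally show ?thesis using c by (simp add: abs_mult real_sqrt_mult field_simps)
qed

text \<open>Moving the argument from \<open>y\<close> to \<open>x\<close> equals shifting
  \<open>Y\<close> by \<open>(s / c) *\<^sub>R (x - y)\<close>, which the Gaussian shift bound pays
  for with a standard deviation. The Lipschitz constant thus comes from the bound on second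
  derivatives and their continuity.\<close>

lemma smooth2_lipschitz:
  assumes C: "positive_definite C" and s: "0 \<le> s" and c: "c > 0"
  shows "\<bar>smooth2 s c i j x - smooth2 s c i j y\<bar> \<le>
    (s / c * (sqrt (onorm ((*v) (matrix_inv C))) * sqrt (2 / pi))) * (\<Sum>l\<in>UNIV. \<bar>x $ l - y $ l\<bar>)"
proof -
  let ?\<kappa> = "onorm ((*v) (matrix_inv C))"
  define h where "h z = partial_derivative i (partial_derivative j g) (s *\<^sub>R y + c *\<^sub>R z)" for z
  \<comment> \<open>The direction whose image under \<open>C\<close> is the required shift of
    \<open>Y\<close>.\<close>
  define w where "w = matrix_inv C *v ((s / c) *\<^sub>R (x - y))"
  have Cw: "C *v w = (s / c) *\<^sub>R (x - y)" unfolding w_def by (rule positive_definite_matrix_inv[OF C])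
  have "smooth2 s c i j x = G.expectation (\<lambda>\<omega>. h (Y \<omega> + C *v w))"
    unfolding smooth2_def h_def Cw using c by (simp add: algebra_simps)
  moreover have "smooth2 s c i j y = G.expectation (\<lambda>\<omega>. h (Y \<omega>))"
    unfolding smooth2_def h_def ..
  moreover have "continuous_on UNIV h"
    unfolding h_def by (intro continuous_on_compose2[OF g_cont(3)] continuous_intros) auto
  ultimately have "\<bar>smooth2 s c i j x - smooth2 s c i j y\<bar> \<le> sqrt (w \<bullet> (C *v w)) * sqrt (2 / pi)"
    using G.gaussian_shift_bound[of h w] g2 by (simp add: h_def)
  also have "\<dots> \<le> (sqrt ?\<kappa> * (s / c * (\<Sum>l\<in>UNIV. \<bar>x $ l - y $ l\<bar>))) * sqrt (2 / pi)"
  proof (rule mult_right_mono)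
    let ?v = "(s / c) *\<^sub>R (x - y)"
    have "w \<bullet> (C *v w) = ?v \<bullet> (matrix_inv C *v ?v)" unfolding Cw by (simp only: w_def inner_commute)
    also have "\<dots> \<le> ?\<kappa> * (norm ?v)\<^sup>2" by (rule inner_matrix_le_onorm)
    finally have "sqrt (w \<bullet> (C *v w)) \<le> sqrt ?\<kappa> * norm ?v"
      by (metis real_sqrt_abs abs_norm_cancel real_sqrt_le_mono real_sqrt_mult)
    also have "norm ?v \<le> s / c * (\<Sum>l\<in>UNIV. \<bar>x $ l - y $ l\<bar>)"
      using norm_le_l1_cart[of "x - y"] s c by (simp add: divide_right_mono mult_left_mono)
    finally show "sqrt (w \<bullet> (C *v w)) \<le> sqrt ?\<kappa> * (s / c * (\<Sum>l\<in>UNIV. \<bar>x $ l - y $ l\<bar>))"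
      by (simp add: mult_left_mono onorm_pos_le matrix_vector_mul_bounded_linear)
  qed simp
  finally show ?thesis by (simp add: mult_ac)
qed

lemma d2_distance_le:
  assumes C: "positive_definite C" and grad: "\<And>x. norm (gradient g x) \<le> 1"
  shows "\<bar>cube_mean n (\<lambda>x. g (V x)) - G.expectation (\<lambda>\<omega>. g (Y \<omega>))\<bar> \<le>
    sqrt (onorm ((*v) (matrix_inv C))) * sqrt err +
    sqrt (2 * pi) / 4 * sqrt (onorm ((*v) (matrix_inv C))) * (real CARD('d))\<^sup>2 * rem"
proof -
  let ?d = "real CARD('d)" and ?k = "sqrt (onorm ((*v) (matrix_inv C)))"
  \<comment> \<open>The factors \<open>1 / cos t\<close> in both estimates cancel the outer cos t,
    leaving sin t and sin^2 t; their primitives increase by 1 and pi/4.\<close>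
  define B where "B t = ?k * sqrt err * (- cos t) + ?k * sqrt (2 / pi) * ?d\<^sup>2 * rem * ((t - sin t * cos t) / 2)" for t
  have "\<bar>cube_mean n (\<lambda>x. g (V x)) - G.expectation (\<lambda>\<omega>. g (Y \<omega>))\<bar> \<le> B (pi / 2) - B 0"
  proof (rule distance_le)
    show "(B has_real_derivative ?k * sqrt err * sin t + ?k * sqrt (2 / pi) * ?d\<^sup>2 * rem * (sin t)\<^sup>2) (at t)" for t
    proof -
      have "((\<lambda>t. (t - sin t * cos t) / 2) has_real_derivative (1 - (cos t * cos t - sin t * sin t)) / 2) (at t)"
        by (auto intro!: derivative_eq_intros)
      moreover have "(1 - (cos t * cos t - sin t * sin t)) / 2 = (sin t)\<^sup>2"
        using sin_cos_squared_add[of t] by (simp add: power2_eq_square)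
      ultimately show ?thesis
        unfolding B_def by (auto intro!: derivative_eq_intros)
    qed
    fix t :: real assume t: "0 < t" "t < pi / 2"
    then have s: "0 \<le> sin t" and c: "0 < cos t" by (auto intro!: sin_ge_zero cos_gt_zero)
    have "\<bar>dpath t\<bar> \<le> sin t * cos t * ((?k / cos t) * sqrt err) +
        cos t * (sin t * (sin t / cos t * (?k * sqrt (2 / pi))) * ?d\<^sup>2 * rem)"
      using c by (intro abs_dpath_le s smooth2_lipschitz[OF C s c] smooth2_HS_bound[OF C grad c])
        (auto simp: onorm_pos_le matrix_vector_mul_bounded_linear)
    also have "\<dots> = ?k * sqrt err * sin t + ?k * sqrt (2 / pi) * ?d\<^sup>2 * rem * (sin t)\<^sup>2"
      using c by (simp add: power2_eq_square)
    finally show "\<bar>dpath t\<bar> \<le> ?k * sqrt err * sin t + ?k * sqrt (2 / pi) * ?d\<^sup>2 * rem * (sin t)\<^sup>2" .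
  qed
  also have "B (pi / 2) - B 0 = ?k * sqrt err + (sqrt (2 / pi) * (pi / 4)) * ?k * ?d\<^sup>2 * rem"
    by (simp add: B_def)
  also have "sqrt (2 / pi) * (pi / 4) = sqrt (2 * pi) / 4"
    using pi_gt_zero real_sqrt_mult_self[of pi] by (simp add: real_sqrt_mult real_sqrt_divide field_simps)
  finally show ?thesis .
qed

end

section \<open>Transfer to the probability space and adjustment of the constants\<close>

theorem theorem4p1:
  fixes M :: "'a measure" and N :: "'b measure"
    and n :: nat and X :: "nat \<Rightarrow> 'a \<Rightarrow> real"
    and F :: "'d::{finite,linorder} \<Rightarrow> (nat \<Rightarrow> real) \<Rightarrow> real"
    and Y :: "'b \<Rightarrow> real ^ 'd::{finite,linorder}"
    and C :: "real ^ 'd::{finite,linorder} ^ 'd::{finite,linorder}"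
    and \<alpha> :: real
  assumes "prob_space M" and "prob_space N"
    and "CARD('d) \<ge> 2" and "n \<ge> 1"
    and "iid_rademacher M n X"
    and "centered_gaussian_vector N Y C"
    and "\<And>i. F i \<in> borel_measurable (Pi\<^sub>M {1..n} (\<lambda>_. borel))"
    and "\<And>i. integrable M (functional n X (F i))"
    and "\<And>i. (\<integral>\<omega>. functional n X (F i) \<omega> \<partial>M) = 0"
    and "\<And>i j. integrable M (\<lambda>\<omega>. functional n X (F i) \<omega> * functional n X (F j) \<omega>)"
    and "\<alpha> \<in> {0..1}"
  shows "(d3 M (\<lambda>\<omega>. \<chi> i. functional n X (F i) \<omega>) N Y
      \<le> ereal (real CARD('d) / 2 *
            sqrt (\<Sum>i\<in>UNIV. \<Sum>j\<in>UNIV. \<integral>\<omega>. \<bar>C $ i $ j - T_alpha M n X F \<alpha> i j \<omega>\<bar>\<^sup>2 \<partial>M)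
          + (real CARD('d))\<^sup>2 / 3 *
            (\<Sum>i\<in>UNIV. \<Sum>k=1..n. \<integral>\<omega>. \<bar>malliavin n X k (F i) \<omega>\<bar> ^ 3 \<partial>M))) \<and>
     (positive_definite C \<longrightarrow>
      d2 M (\<lambda>\<omega>. \<chi> i. functional n X (F i) \<omega>) N Y
      \<le> ereal (onorm ((*v) (matrix_inv C)) * sqrt (onorm ((*v) C)) *
            sqrt (\<Sum>i\<in>UNIV. \<Sum>j\<in>UNIV. \<integral>\<omega>. \<bar>C $ i $ j - T_alpha M n X F \<alpha> i j \<omega>\<bar>\<^sup>2 \<partial>M)
          + sqrt (2 * pi) * onorm ((*v) (matrix_inv C)) powr (3 / 2) * onorm ((*v) C) *
            (real CARD('d))\<^sup>2 / 4 *
            (\<Sum>i\<in>UNIV. \<Sum>k=1..n. \<integral>\<omega>. \<bar>malliavin n X k (F i) \<omega>\<bar> ^ 3 \<partial>M)))"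
proof -
  interpret R: rademacher M n X
    using assms(1,4,5) by (simp add: rademacher_def rademacher_axioms_def)
  interpret G: centered_gaussian N Y C
    using assms(2,6) by (simp add: centered_gaussian_def centered_gaussian_axioms_def)
  note F = assms(7)
  have F_XX[measurable]: "(\<lambda>\<omega>. F i (R.signs \<omega>)) \<in> borel_measurable M" for i
    by (rule measurable_compose[OF R.signs_measurable F])
  have D_XX[measurable]: "(\<lambda>\<omega>. coord_diff k (F i) (R.signs \<omega>)) \<in> borel_measurable M" if "k \<in> {1..n}" for i k
    by (rule measurable_compose[OF R.signs_measurable R.coord_diff_measurable[OF F that]])
  have mean: "cube_mean n (F i) = 0" for i
    using R.integral_signs[of "\<lambda>\<omega>. F i (R.signs \<omega>)" "F i"] assms(9)[of i] by (simp add: R.functional_eq)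
  define E where "E = (\<Sum>i\<in>UNIV. \<Sum>j\<in>UNIV. \<integral>\<omega>. \<bar>C $ i $ j - T_alpha M n X F \<alpha> i j \<omega>\<bar>\<^sup>2 \<partial>M)"
  define \<rho> where "\<rho> = (\<Sum>i\<in>UNIV. \<Sum>k=1..n. \<integral>\<omega>. \<bar>malliavin n X k (F i) \<omega>\<bar> ^ 3 \<partial>M)"
  have E_eq: "E = (\<Sum>i\<in>UNIV. \<Sum>j\<in>UNIV. cube_mean n (\<lambda>x. (C $ i $ j - R.T \<alpha> F i j x)\<^sup>2))"
    unfolding E_def
  proof (intro sum.cong refl R.integral_signs)
    fix i j
    have "T_alpha M n X F \<alpha> i j \<in> borel_measurable M"
      unfolding T_alpha_def[abs_def] R.malliavin_eq
      by (intro borel_measurable_sum borel_measurable_times borel_measurable_add borel_measurable_const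
          borel_measurable_cond_exp2 D_XX)
    then show "(\<lambda>\<omega>. \<bar>C $ i $ j - T_alpha M n X F \<alpha> i j \<omega>\<bar>\<^sup>2) \<in> borel_measurable M" by simp
    show "AE \<omega> in M. \<bar>C $ i $ j - T_alpha M n X F \<alpha> i j \<omega>\<bar>\<^sup>2 = (C $ i $ j - R.T \<alpha> F i j (R.signs \<omega>))\<^sup>2"
      using R.T_alpha_eq[where F = F and \<alpha> = \<alpha> and i = i and j = j, OF F] by eventually_elim (simp add: R.T_def)
  qed
  have \<rho>_eq: "\<rho> = (\<Sum>i\<in>UNIV. \<Sum>k=1..n. cube_mean n (\<lambda>x. \<bar>coord_diff k (F i) x\<bar> ^ 3))"
    unfolding \<rho>_def R.malliavin_eq by (intro sum.cong refl R.integral_signs) auto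
  have nonneg: "0 \<le> E" "0 \<le> \<rho>"
    unfolding E_eq \<rho>_eq by (auto intro!: sum_nonneg cube_mean_nonneg)
  have mean_g: "(\<integral>\<omega>. g (\<chi> i. functional n X (F i) \<omega>) \<partial>M) = cube_mean n (\<lambda>x. g (\<chi> i. F i x))"
    if "continuous_on UNIV g" for g :: "real ^ 'd::{finite,linorder} \<Rightarrow> real"
  proof (rule R.integral_signs)
    have "(\<lambda>\<omega>. \<chi> i. F i (R.signs \<omega>)) \<in> borel_measurable M"
      by (subst borel_measurable_euclidean_space) (auto simp: Basis_vec_def inner_axis)
    then show "(\<lambda>\<omega>. g (\<chi> i. functional n X (F i) \<omega>)) \<in> borel_measurable M"
      unfolding R.functional_eq by (rule measurable_compose) (rule borel_measurable_continuous_onI[OF that])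
  qed (simp add: R.functional_eq)
  have "d3 M (\<lambda>\<omega>. \<chi> i. functional n X (F i) \<omega>) N Y \<le> ereal (real CARD('d) / 2 * sqrt E + (real CARD('d))\<^sup>2 / 3 * \<rho>)"
    unfolding d3_def test_distance_def
  proof (rule SUP_least)
    fix g :: "real ^ 'd::{finite,linorder} \<Rightarrow> real"
    assume "g \<in> {g. C_k 3 g \<and> (\<forall>k\<in>{1, 2, 3}. deriv_sup_norm k g \<le> 1)}"
    then have "C_k 3 g" "\<And>k. k \<in> {1, 2, 3} \<Longrightarrow> deriv_sup_norm k g \<le> 1" by auto
    note t = d3_test_function[OF this]
    interpret I: interpolation M n X N Y C F \<alpha> g
      by unfold_locales (use mean assms(11) t in auto)
    show "ereal \<bar>(\<integral>\<omega>. g (\<chi> i. functional n X (F i) \<omega>) \<partial>M) - (\<integral>\<omega>. g (Y \<omega>) \<partial>N)\<bar> \<le>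
        ereal (real CARD('d) / 2 * sqrt E + (real CARD('d))\<^sup>2 / 3 * \<rho>)"
      using I.d3_distance_le[OF t(4)] mean_g[OF I.g_cont(1)]
      by (simp add: I.V_def I.err_def I.rem_def E_eq \<rho>_eq)
  qed
  moreover have "d2 M (\<lambda>\<omega>. \<chi> i. functional n X (F i) \<omega>) N Y \<le>
      ereal (onorm ((*v) (matrix_inv C)) * sqrt (onorm ((*v) C)) * sqrt E +
        sqrt (2 * pi) * onorm ((*v) (matrix_inv C)) powr (3 / 2) * onorm ((*v) C) * (real CARD('d))\<^sup>2 / 4 * \<rho>)"
    if C: "positive_definite C"
    unfolding d2_def test_distance_def
  proof (rule SUP_least)
    fix g :: "real ^ 'd::{finite,linorder} \<Rightarrow> real"
    assume "g \<in> {g. C_k 2 g \<and> lip_norm g \<le> 1 \<and> M2 g \<le> 1}"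
    then have g: "C_k 2 g" "lip_norm g \<le> 1" "M2 g \<le> 1" by auto
    note t = d2_test_function[OF this]
    interpret I: interpolation M n X N Y C F \<alpha> g
      by unfold_locales (use mean assms(11) g t in auto)
    define a b where "a = onorm ((*v) (matrix_inv C))" and "b = onorm ((*v) C)"
    have ab: "0 \<le> a" "0 \<le> b" "1 \<le> a * b"
      using positive_definite_onorm_mult_ge_1[OF C]
      by (simp_all add: a_def b_def onorm_pos_le matrix_vector_mul_bounded_linear)
    \<comment> \<open>Since \<open>a * b\<close> is at least 1, \<open>sqrt a\<close> may be
      enlarged by \<open>sqrt (a * b)\<close> for the first term and by \<open>a * b\<close> for the
      second, which gives the two stated constants.\<close>
    have "sqrt a * 1 \<le> sqrt a * sqrt (a * b)"
      by (intro mult_left_mono) (use ab in auto)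
    then have k1: "sqrt a \<le> a * sqrt b" using ab by (simp add: real_sqrt_mult flip: mult.assoc)
    have "sqrt a * 1 \<le> sqrt a * (a * b)" by (intro mult_left_mono ab) (use ab in auto)
    moreover have "a powr (3 / 2) = a * sqrt a"
      using powr_add[of a 1 "1/2"] ab by (simp add: powr_half_sqrt)
    ultimately have k2: "sqrt a \<le> a powr (3 / 2) * b" by (simp add: mult_ac)
    have "\<bar>cube_mean n (\<lambda>x. g (\<chi> i. F i x)) - (\<integral>\<omega>. g (Y \<omega>) \<partial>N)\<bar> \<le>
        sqrt a * sqrt E + sqrt (2 * pi) / 4 * sqrt a * (real CARD('d))\<^sup>2 * \<rho>"
      using I.d2_distance_le[OF C t(1)] by (simp add: I.V_def I.err_def I.rem_def E_eq \<rho>_eq a_def)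
    also have "\<dots> \<le> a * sqrt b * sqrt E + sqrt (2 * pi) / 4 * (a powr (3 / 2) * b) * (real CARD('d))\<^sup>2 * \<rho>"
      by (intro add_mono mult_right_mono mult_left_mono k1 k2) (use nonneg in auto)
    finally show "ereal \<bar>(\<integral>\<omega>. g (\<chi> i. functional n X (F i) \<omega>) \<partial>M) - (\<integral>\<omega>. g (Y \<omega>) \<partial>N)\<bar> \<le>
      ereal (onorm ((*v) (matrix_inv C)) * sqrt (onorm ((*v) C)) * sqrt E +
        sqrt (2 * pi) * onorm ((*v) (matrix_inv C)) powr (3 / 2) * onorm ((*v) C) * (real CARD('d))\<^sup>2 / 4 * \<rho>)"
      using mean_g[OF I.g_cont(1)] by (simp add: a_def b_def mult_ac)
  qed
  ultimately show ?thesis unfolding E_def \<rho>_def by blast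
qed

end
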